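(* Let $p\in\{1,\dots,r\}$ and let $q\in\mathrm{Aut}(\Gamma)p$ be an index in the orbit of $p$; let $P$ and $Q$ be the maximal parabolic subgroups of $G$ corresponding to $\alpha_p$ and $\alpha_q$. Then, as identities of meromorphic functions of $s\in\mathbb{C}$, $$\xi^{G/P}_{\mathbb{Q}}(1-s)=\xi^{G/P}_{\mathbb{Q}}(s)=\xi^{G/Q}_{\mathbb{Q}}(s).$$
   Context: **Root systems.** $G$ is a semisimple algebraic group of rank $r$ over $\mathbb{Q}$ with root system $\Phi$; everything below depends only on $\Phi$, $\Delta$ and the index $p$. $V$ is an $r$-dimensional real vector space with inner product $\langle\cdot,\cdot\rangle$ (extended bilinearly to $V\otimes\mathbb{C}$), $\Phi\subset V$ a (reduced, crystallographic) root system of rank $r$, $\Delta=\{\alpha_1,\dots,\alpha_r\}$ a fundamental system, $\Phi_+$ the corresponding positive system, $\Phi_-=-\Phi_+$, $\alpha^\vee=2\alpha/\langle\alpha,\alpha\rangle$, and $\lambda_1,\dots,\lambda_r$ the fundamental weights, $\langle\alpha_i^\vee,\lambda_j\rangle=\delta_{ij}$. $\rho=\frac12\sum_{\alpha\in\Phi_+}\alpha=\sum_j\lambda_j$ and $\mathrm{ht}\,\alpha^\vee=\langle\rho,\alpha^\vee\rangle$. $W$ is the Weyl group, and $\Phi_w=\Phi_+\cap w^{-1}\Phi_-$ for $w\in W$. $\Gamma$ is the Dynkin diagram of $\Phi$ and $\mathrm{Aut}(\Gamma)$ its automorphism group, regarded as a group of permutations of the indices $\{1,\dots,r\}$. For $1\le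 p\le r$: the maximal parabolic subgroup $P$ corresponds to $\alpha_p$; $\Delta_p=\Delta\setminus\{\alpha_p\}$; $\Phi_p=\{\alpha\in\Phi:\langle\lambda_p,\alpha\rangle=0\}$; $\Phi_{p+}=\Phi_p\cap\Phi_+$; $\rho_p=\frac12\sum_{\alpha\in\Phi_{p+}}\alpha$; $c_p=2\langle\lambda_p-\rho_p,\alpha_p^\vee\rangle$. **Periods.** $\xi(s)=\pi^{-s/2}\Gamma(s/2)\zeta(s)$ with $\zeta$ the Riemann zeta function. For $\lambda,T$, $$\omega^G_{\mathbb{Q}}(\lambda;T)=\sum_{w\in W}e^{\langle w\lambda-\rho,T\rangle}\Bigl(\prod_{\alpha\in\Delta}\frac{1}{\langle w\lambda-\rho,\alpha^\vee\rangle}\Bigr)\Bigl(\prod_{\alpha\in\Phi_w}\frac{\xi(\langle\lambda,\alpha^\vee\rangle)}{\xi(\langle\lambda,\alpha^\vee\rangle+1)}\Bigr).$$ Writing $\lambda=\rho+\sum_k s_k\lambda_k$ with complex coordinates $s_k=\langle\lambda-\rho,\alpha_k^\vee\rangle$ and $s=s_p$, $\omega^{G/P}_{\mathbb{Q}}(s;T)$ is the iterated residue of $\omega^G_{\mathbb{Q}}(\lambda;T)$ at $s_k=0$ for all $k\ne p$. Taken term by term, it is a sum over those $w\in W$ with $\Delta_p\subset w^{-1}(\Delta\cup\Phi_-)$ (call these admissible for $p$), the $w$-term being $$e^{\langle w(\rho+s\lambda_p)-\rho,T\rangle}\Bigl(\prod_{\alpha\in(w^{-1}\Delta)\setminus\Delta_p}\frac{1}{\langle\lambda_p,\alpha^\vee\rangle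 s+\mathrm{ht}\,\alpha^\vee-1}\Bigr)H_{p,w}(s),$$ $$H_{p,w}(s)=\prod_{\alpha\in\Phi_w\setminus\Delta_p}\xi(\langle\lambda_p,\alpha^\vee\rangle s+\mathrm{ht}\,\alpha^\vee)\prod_{\alpha\in\Phi_w}\frac{1}{\xi(\langle\lambda_p,\alpha^\vee\rangle s+\mathrm{ht}\,\alpha^\vee+1)}.$$ **Weng's zeta function.** $\xi^{G/P}_{\mathbb{Q};o}(s;T)$ is obtained from $\omega^{G/P}_{\mathbb{Q}}(s;T)$ by multiplying by the minimal product of $\xi$ functions cancelling all $\xi$-denominators. Precisely: after formal cancellation, $H_{p,w}(s)=\prod_{k\ge0,\,h\ge1}\xi(ks+h)^{e_{p,w}(k,h)}$ with $$e_{p,w}(k,h)=\sharp\{\alpha\in\Phi_w\setminus\Delta_p:\langle\lambda_p,\alpha^\vee\rangle=k,\ \mathrm{ht}\,\alpha^\vee=h\}-\sharp\{\alpha\in\Phi_w:\langle\lambda_p,\alpha^\vee\rangle=k,\ \mathrm{ht}\,\alpha^\vee=h-1\},$$ and $$\xi^{G/P}_{\mathbb{Q};o}(s;T)=\omega^{G/P}_{\mathbb{Q}}(s;T)\prod_{k\ge0,\,h\ge1}\xi(ks+h)^{m_p(k,h)},\qquad m_p(k,h)=\max_{w\text{ admissible for }p}\max(0,-e_{p,w}(k,h)),$$ a product with only finitely many nontrivial factors. **Normalized Weng's zeta function.** $\xi^{G/P}_{\mathbb{Q}}(s)=\xi^{G/P}_{\mathbb{Q};o}\bigl(s-(c_p+1)/2;\,0\bigr)$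 (i.e. $T=0$). The same definitions with $q$ in place of $p$ give $\xi^{G/Q}_{\mathbb{Q}}$. *)

theory Defs
  imports
    "HOL-Complex_Analysis.Complex_Analysis"
    "HOL-Combinatorics.Permutations"
begin

section \<open>Root systems\<close>

text \<open>
  The ambient space is a Euclidean space, its dimension is the rank \<open>r\<close>. A fundamental system is
  given as a family \<open>\<alpha> 1, \<dots>, \<alpha> r\<close>; the values of \<open>\<alpha>\<close> outside \<open>{1..r}\<close> are never used.
\<close>

definition coroot :: "'a::euclidean_space \<Rightarrow> 'a" where
  "coroot a = (2 / (a \<bullet> a)) *\<^sub>R a"

definition reflection :: "'a::euclidean_space \<Rightarrow> 'a \<Rightarrow> 'a" where
  "reflection a v = v - (v \<bullet> coroot a) *\<^sub>R a"

definition root_system :: "'a::euclidean_space set \<Rightarrow> bool" where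
  "root_system \<Phi> \<longleftrightarrow>
     finite \<Phi> \<and> 0 \<notin> \<Phi> \<and> span \<Phi> = UNIV \<and>
     (\<forall>a\<in>\<Phi>. reflection a ` \<Phi> = \<Phi>) \<and>
     (\<forall>a\<in>\<Phi>. \<forall>b\<in>\<Phi>. b \<bullet> coroot a \<in> \<int>) \<and>
     (\<forall>a\<in>\<Phi>. \<forall>c. c *\<^sub>R a \<in> \<Phi> \<longrightarrow> c = 1 \<or> c = -1)"

definition indices :: "'a::euclidean_space itself \<Rightarrow> nat set" where
  "indices _ = {1..DIM('a)}"

definition pos_roots :: "'a::euclidean_space set \<Rightarrow> (nat \<Rightarrow> 'a) \<Rightarrow> 'a set" where
  "pos_roots \<Phi> \<alpha> =
     {b\<in>\<Phi>. \<exists>c :: nat \<Rightarrow> nat. b = (\<Sum>i\<in>indices TYPE('a). real (c i) *\<^sub>R \<alpha> i)}"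

definition neg_roots :: "'a::euclidean_space set \<Rightarrow> (nat \<Rightarrow> 'a) \<Rightarrow> 'a set" where
  "neg_roots \<Phi> \<alpha> = uminus ` pos_roots \<Phi> \<alpha>"

definition simple_roots :: "(nat \<Rightarrow> 'a::euclidean_space) \<Rightarrow> 'a set" where
  "simple_roots \<alpha> = \<alpha> ` indices TYPE('a)"

definition fundamental_system :: "'a::euclidean_space set \<Rightarrow> (nat \<Rightarrow> 'a) \<Rightarrow> bool" where
  "fundamental_system \<Phi> \<alpha> \<longleftrightarrow>
     inj_on \<alpha> (indices TYPE('a)) \<and> simple_roots \<alpha> \<subseteq> \<Phi> \<and> independent (simple_roots \<alpha>) \<and>
     \<Phi> = pos_roots \<Phi> \<alpha> \<union> neg_roots \<Phi> \<alpha>"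

definition fund_weight :: "(nat \<Rightarrow> 'a::euclidean_space) \<Rightarrow> nat \<Rightarrow> 'a" where
  "fund_weight \<alpha> j =
     (THE v. \<forall>i\<in>indices TYPE('a). coroot (\<alpha> i) \<bullet> v = (if i = j then 1 else 0))"

definition half_sum :: "'a::euclidean_space set \<Rightarrow> (nat \<Rightarrow> 'a) \<Rightarrow> 'a" where
  "half_sum \<Phi> \<alpha> = (1/2) *\<^sub>R (\<Sum>a\<in>pos_roots \<Phi> \<alpha>. a)"

definition coroot_height :: "'a::euclidean_space set \<Rightarrow> (nat \<Rightarrow> 'a) \<Rightarrow> 'a \<Rightarrow> real" where
  "coroot_height \<Phi> \<alpha> a = half_sum \<Phi> \<alpha> \<bullet> coroot a"

inductive_set weyl_group :: "'a::euclidean_space set \<Rightarrow> ('a \<Rightarrow> 'a) set"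
  for \<Phi> :: "'a set" where
  weyl_id: "id \<in> weyl_group \<Phi>"
| weyl_step: "a \<in> \<Phi> \<Longrightarrow> w \<in> weyl_group \<Phi> \<Longrightarrow> reflection a \<circ> w \<in> weyl_group \<Phi>"

definition inversions :: "'a::euclidean_space set \<Rightarrow> (nat \<Rightarrow> 'a) \<Rightarrow> ('a \<Rightarrow> 'a) \<Rightarrow> 'a set" where
  "inversions \<Phi> \<alpha> w = pos_roots \<Phi> \<alpha> \<inter> w -` neg_roots \<Phi> \<alpha>"


section \<open>The Dynkin diagram\<close>

text \<open>
  Two different vertices \<open>i\<close>, \<open>j\<close> are joined by \<open>\<langle>\<alpha> i, (\<alpha> j)\<^sup>\<or>\<rangle> \<langle>\<alpha> j, (\<alpha> i)\<^sup>\<or>\<rangle>\<close> edges, and a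
  multiple edge carries an arrow from the longer to the shorter root. For a simple edge the two
  roots have the same length, so that \<open>dynkin_arrow\<close> never holds there.
\<close>

definition dynkin_edges :: "(nat \<Rightarrow> 'a::euclidean_space) \<Rightarrow> nat \<Rightarrow> nat \<Rightarrow> real" where
  "dynkin_edges \<alpha> i j =
     (if i = j then 0 else (\<alpha> i \<bullet> coroot (\<alpha> j)) * (\<alpha> j \<bullet> coroot (\<alpha> i)))"

definition dynkin_arrow :: "(nat \<Rightarrow> 'a::euclidean_space) \<Rightarrow> nat \<Rightarrow> nat \<Rightarrow> bool" where
  "dynkin_arrow \<alpha> i j \<longleftrightarrow> dynkin_edges \<alpha> i j \<noteq> 0 \<and> norm (\<alpha> i) > norm (\<alpha> j)"

definition dynkin_aut :: "(nat \<Rightarrow> 'a::euclidean_space) \<Rightarrow> (nat \<Rightarrow> nat) set" where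
  "dynkin_aut \<alpha> =
     {\<sigma>. \<sigma> permutes indices TYPE('a) \<and>
         (\<forall>i\<in>indices TYPE('a). \<forall>j\<in>indices TYPE('a).
            dynkin_edges \<alpha> (\<sigma> i) (\<sigma> j) = dynkin_edges \<alpha> i j \<and>
            (dynkin_arrow \<alpha> (\<sigma> i) (\<sigma> j) \<longleftrightarrow> dynkin_arrow \<alpha> i j))}"


section \<open>Maximal parabolic data\<close>

definition simple_roots_except :: "(nat \<Rightarrow> 'a::euclidean_space) \<Rightarrow> nat \<Rightarrow> 'a set" where
  "simple_roots_except \<alpha> p = simple_roots \<alpha> - {\<alpha> p}"

definition parabolic_pos_roots :: "'a::euclidean_space set \<Rightarrow> (nat \<Rightarrow> 'a) \<Rightarrow> nat \<Rightarrow> 'a set" where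
  "parabolic_pos_roots \<Phi> \<alpha> p = {a\<in>\<Phi>. fund_weight \<alpha> p \<bullet> a = 0} \<inter> pos_roots \<Phi> \<alpha>"

definition parabolic_half_sum :: "'a::euclidean_space set \<Rightarrow> (nat \<Rightarrow> 'a) \<Rightarrow> nat \<Rightarrow> 'a" where
  "parabolic_half_sum \<Phi> \<alpha> p = (1/2) *\<^sub>R (\<Sum>a\<in>parabolic_pos_roots \<Phi> \<alpha> p. a)"

definition parabolic_const :: "'a::euclidean_space set \<Rightarrow> (nat \<Rightarrow> 'a) \<Rightarrow> nat \<Rightarrow> real" where
  "parabolic_const \<Phi> \<alpha> p =
     2 * ((fund_weight \<alpha> p - parabolic_half_sum \<Phi> \<alpha> p) \<bullet> coroot (\<alpha> p))"


section \<open>The completed Riemann zeta function\<close>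

text \<open>
  The Riemann zeta function is the analytic continuation of its Dirichlet series to
  \<open>\<complex> - {1}\<close>, which is unique by the identity theorem; the value at the pole is a convention.
\<close>

definition riemann_zeta :: "complex \<Rightarrow> complex" where
  "riemann_zeta = (THE f. f holomorphic_on (- {1}) \<and>
      (\<forall>s. Re s > 1 \<longrightarrow> f s = (\<Sum>n. 1 / of_nat (Suc n) powr s)) \<and> f 1 = 0)"

text \<open>
  In HOL, \<open>Gamma\<close> vanishes at its poles, so this is the completed zeta function away from the
  non-positive even integers (where \<open>Gamma (s / 2)\<close> has its poles) and \<open>1\<close>. In the definitions
  below this affects the values of meromorphic functions on a discrete set only.
\<close>

definition completed_zeta :: "complex \<Rightarrow> complex" where
  "completed_zeta s = of_real pi powr (- s / 2) * Gamma (s / 2) * riemann_zeta s"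


section \<open>Periods\<close>

text \<open>
  The complexification of the ambient space is represented by pairs \<open>(x, y)\<close>, standing for
  \<open>x + \<i> y\<close>, with the pairing and the action of the Weyl group extended complex linearly.
\<close>

definition cinner :: "'a::euclidean_space \<times> 'a \<Rightarrow> 'a \<Rightarrow> complex" where
  "cinner l v = Complex (fst l \<bullet> v) (snd l \<bullet> v)"

definition weight_point ::
    "'a::euclidean_space set \<Rightarrow> (nat \<Rightarrow> 'a) \<Rightarrow> (nat \<Rightarrow> complex) \<Rightarrow> 'a \<times> 'a" where
  "weight_point \<Phi> \<alpha> s =
     (half_sum \<Phi> \<alpha> + (\<Sum>k\<in>indices TYPE('a). Re (s k) *\<^sub>R fund_weight \<alpha> k),
      \<Sum>k\<in>indices TYPE('a). Im (s k) *\<^sub>R fund_weight \<alpha> k)"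

definition period ::
    "'a::euclidean_space set \<Rightarrow> (nat \<Rightarrow> 'a) \<Rightarrow> 'a \<times> 'a \<Rightarrow> 'a \<Rightarrow> complex" where
  "period \<Phi> \<alpha> l T =
     (\<Sum>w\<in>weyl_group \<Phi>.
        exp (cinner (map_prod w w l - (half_sum \<Phi> \<alpha>, 0)) T) *
        (\<Prod>a\<in>simple_roots \<alpha>. 1 / cinner (map_prod w w l - (half_sum \<Phi> \<alpha>, 0)) (coroot a)) *
        (\<Prod>a\<in>inversions \<Phi> \<alpha> w.
           completed_zeta (cinner l (coroot a)) / completed_zeta (cinner l (coroot a) + 1)))"

text \<open>
  Residues at \<open>s k = 0\<close>, taken successively for the indices \<open>k\<close> in the list, the head of the list
  first, with the remaining coordinates kept as parameters.
\<close>

fun iterated_residue ::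
    "nat list \<Rightarrow> ((nat \<Rightarrow> complex) \<Rightarrow> complex) \<Rightarrow> (nat \<Rightarrow> complex) \<Rightarrow> complex" where
  "iterated_residue [] F s = F s"
| "iterated_residue (k # ks) F s =
     iterated_residue ks (\<lambda>s'. residue (\<lambda>z. F (s'(k := z))) 0) s"

definition parabolic_period ::
    "'a::euclidean_space set \<Rightarrow> (nat \<Rightarrow> 'a) \<Rightarrow> nat \<Rightarrow> complex \<Rightarrow> 'a \<Rightarrow> complex" where
  "parabolic_period \<Phi> \<alpha> p s T =
     iterated_residue (sorted_list_of_set (indices TYPE('a) - {p}))
       (\<lambda>s'. period \<Phi> \<alpha> (weight_point \<Phi> \<alpha> s') T) ((\<lambda>_. 0)(p := s))"


section \<open>Weng's zeta function\<close>

definition admissible :: "'a::euclidean_space set \<Rightarrow> (nat \<Rightarrow> 'a) \<Rightarrow> nat \<Rightarrow> ('a \<Rightarrow> 'a) set" where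
  "admissible \<Phi> \<alpha> p =
     {w \<in> weyl_group \<Phi>. simple_roots_except \<alpha> p \<subseteq> w -` (simple_roots \<alpha> \<union> neg_roots \<Phi> \<alpha>)}"

definition xi_exponent ::
    "'a::euclidean_space set \<Rightarrow> (nat \<Rightarrow> 'a) \<Rightarrow> nat \<Rightarrow> ('a \<Rightarrow> 'a) \<Rightarrow> nat \<Rightarrow> nat \<Rightarrow> int" where
  "xi_exponent \<Phi> \<alpha> p w k h =
     int (card {a \<in> inversions \<Phi> \<alpha> w - simple_roots_except \<alpha> p.
                  fund_weight \<alpha> p \<bullet> coroot a = real k \<and> coroot_height \<Phi> \<alpha> a = real h}) -
     int (card {a \<in> inversions \<Phi> \<alpha> w.
                  fund_weight \<alpha> p \<bullet> coroot a = real k \<and> coroot_height \<Phi> \<alpha> a = real h - 1})"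

definition max_exponent ::
    "'a::euclidean_space set \<Rightarrow> (nat \<Rightarrow> 'a) \<Rightarrow> nat \<Rightarrow> nat \<Rightarrow> nat \<Rightarrow> nat" where
  "max_exponent \<Phi> \<alpha> p k h =
     nat (Max ((\<lambda>w. max 0 (- xi_exponent \<Phi> \<alpha> p w k h)) ` admissible \<Phi> \<alpha> p))"

text \<open>The product over all \<open>k \<ge> 0\<close>, \<open>h \<ge> 1\<close> is restricted to the finitely many factors with
  a nonzero exponent.\<close>

definition weng_zeta_unnormalized ::
    "'a::euclidean_space set \<Rightarrow> (nat \<Rightarrow> 'a) \<Rightarrow> nat \<Rightarrow> complex \<Rightarrow> 'a \<Rightarrow> complex" where
  "weng_zeta_unnormalized \<Phi> \<alpha> p s T =
     parabolic_period \<Phi> \<alpha> p s T *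
     (\<Prod>(k, h)\<in>{(k, h). h \<ge> 1 \<and> max_exponent \<Phi> \<alpha> p k h \<noteq> 0}.
        completed_zeta (of_nat k * s + of_nat h) ^ max_exponent \<Phi> \<alpha> p k h)"

definition weng_zeta :: "'a::euclidean_space set \<Rightarrow> (nat \<Rightarrow> 'a) \<Rightarrow> nat \<Rightarrow> complex \<Rightarrow> complex" where
  "weng_zeta \<Phi> \<alpha> p s =
     weng_zeta_unnormalized \<Phi> \<alpha> p (s - of_real ((parabolic_const \<Phi> \<alpha> p + 1) / 2)) 0"

end

theory Submission
  imports Defs
begin

text \<open>
  Write \<open>\<lambda>(s) = \<rho> + s \<lambda>\<^sub>p\<close>, and \<open>\<xi>\<close> for the completed zeta function. The residue of the period is a sum over
  the admissible Weyl group elements \<open>w\<close>: near \<open>\<lambda>(s)\<close> with \<open>s\<close> generic, the singularities of a term are simple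
  poles along coordinate hyperplanes, and the term has all the poles required by the iterated residue if
  and only if \<open>w\<close> is admissible (\<open>iterated_residue_simple_poles\<close>, \<open>parabolic_period_eq\<close>).

  For the first equation let \<open>w\<^sub>0\<close> and \<open>w\<^sub>p\<close> be the longest elements of the Weyl group and of the subgroup
  generated by the simple reflections other than the \<open>p\<close>-th. Then \<open>w \<mapsto> w\<^sub>0 w w\<^sub>p\<close> permutes the admissible
  elements, and \<open>w\<^sub>p \<lambda>(s) = - \<lambda>(- c\<^sub>p - s)\<close>. At \<open>T = 0\<close> the rational factors of \<open>w\<close> at \<open>- c\<^sub>p - s\<close> and of
  \<open>w\<^sub>0 w w\<^sub>p\<close> at \<open>s\<close> coincide. Among the positive roots on which \<open>\<lambda>\<^sub>p\<close> does not vanish, the inversions of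
  \<open>w\<^sub>0 w w\<^sub>p\<close> are the images of the non-inversions of \<open>w\<close>; as \<open>\<xi>(1 - s) = \<xi>(s)\<close> exchanges numerators and
  denominators, the factors made of \<open>\<xi>\<close> differ by a product over all these roots, which does not depend
  on \<open>w\<close> (\<open>axis_term_flip\<close>). All exponents are therefore shifted by the same amounts, and so are their
  extrema; the maximum of the negated exponents is never below 0, because the identity is admissible with
  exponents 0 (\<open>max_exponent_flip\<close>). Thus the clearing product changes by precisely the inverse of that common factor
  (\<open>clearing_flip\<close>). The shift by \<open>(c\<^sub>p + 1) / 2\<close> turns \<open>s \<mapsto> - c\<^sub>p - s\<close> into \<open>s \<mapsto> 1 - s\<close>.

  For the second equation, a diagram automorphism preserves the Cartan integers. The linear map that
  permutes the simple roots accordingly normalizes the Weyl group and preserves the roots and their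
  pairings with coroots; it carries all data for \<open>p\<close> to those for \<open>q\<close>
  (\<open>dynkin_aut_cartan\<close>, \<open>L_weng_zeta_unnormalized\<close>).

  The analytic continuation and the functional equation of the zeta function are obtained from the Mellin
  transform of \<open>1 / (exp x - 1)\<close>: the transform of the partial fraction expansion of this function is, up
  to elementary factors, the Dirichlet series at \<open>1 - s\<close>
  (\<open>has_mellin_bose_reg\<close>, \<open>riemann_zeta_eq\<close>, \<open>completed_zeta_reflection\<close>).
\<close>

section \<open>Partial fractions of the hyperbolic cotangent\<close>

text \<open>The reflection formula \<open>\<Gamma>(z) \<Gamma>(1 - z) = \<pi> / sin (\<pi> z)\<close> has the logarithmic derivative
  \<open>\<psi>(1 - z) - \<psi>(z) = \<pi> cot (\<pi> z)\<close>, and the digamma function \<open>\<psi>\<close> is a limit of finite sums of simple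
  fractions, up to a logarithm that cancels in the difference.\<close>
lemma coth_partial_fractions:
  assumes x: "x > (0::real)"
  shows "(\<lambda>n. 2 * x / (x\<^sup>2 + (2 * pi * real (Suc n))\<^sup>2)) sums (1 / (exp x - 1) - 1 / x + 1 / 2)"
proof -
  \<comment> \<open>\<open>\<pi> z = \<i> x / 2\<close> turns the cotangent into \<open>coth (x / 2)\<close>.\<close>
  define z where "z = \<i> * of_real (x / (2 * pi))"
  have Imz: "Im z = x / (2 * pi)" by (simp add: z_def)
  have nz: "z + of_int m \<noteq> 0" for m
  proof
    assume "z + of_int m = 0"
    hence "Im (z + of_int m) = 0" by (simp only: zero_complex.simps)
    thus False using x by (simp add: Imz)
  qed
  have ni: "z \<notin> \<int>" "1 - z \<notin> \<int>"
  proof -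
    show "z \<notin> \<int>" using nz[of "- m" for m] by (auto elim!: Ints_cases)
    thus "1 - z \<notin> \<int>" by simp
  qed
  have sz: "sin (of_real pi * z) \<noteq> 0"
  proof
    assume "sin (of_real pi * z) = 0"
    then obtain m :: int where "of_real pi * z = of_int m * of_real pi"
      by (auto simp: sin_eq_0)
    hence "z = of_int m" by simp
    thus False using ni by auto
  qed
  have d1: "((\<lambda>z. Gamma z * Gamma (1 - z)) has_field_derivative
      (Gamma z * Digamma z * Gamma (1 - z) - Gamma z * (Gamma (1 - z) * Digamma (1 - z)))) (at z)"
    using ni by (auto intro!: derivative_eq_intros dest: nonpos_Ints_Int)
  have d2: "((\<lambda>z. of_real pi / sin (of_real pi * z)) has_field_derivative
      (- of_real pi * (of_real pi * cos (of_real pi * z)) / (sin (of_real pi * z))\<^sup>2)) (at z)"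
    using sz by (auto intro!: derivative_eq_intros simp: power2_eq_square)
  have "Gamma z * Digamma z * Gamma (1 - z) - Gamma z * (Gamma (1 - z) * Digamma (1 - z)) =
      - of_real pi * (of_real pi * cos (of_real pi * z)) / (sin (of_real pi * z))\<^sup>2"
    using d1 d2 unfolding Gamma_reflection_complex by (rule DERIV_unique)
  also have "Gamma z * Digamma z * Gamma (1 - z) - Gamma z * (Gamma (1 - z) * Digamma (1 - z)) =
      (Gamma z * Gamma (1 - z)) * (Digamma z - Digamma (1 - z))" by (simp add: algebra_simps)
  finally have eq: "of_real pi / sin (of_real pi * z) * (Digamma z - Digamma (1 - z)) =
      - of_real pi * (of_real pi * cos (of_real pi * z)) / (sin (of_real pi * z))\<^sup>2"
    unfolding Gamma_reflection_complex .
  have "Digamma z - Digamma (1 - z) = sin (of_real pi * z) / of_real pi *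
      (of_real pi / sin (of_real pi * z) * (Digamma z - Digamma (1 - z)))" using sz by simp
  also have "\<dots> = - (of_real pi * cos (of_real pi * z) / sin (of_real pi * z))"
    unfolding eq using sz by (simp add: power2_eq_square)
  finally have "Digamma (1 - z) - Digamma z = of_real pi * cos (of_real pi * z) / sin (of_real pi * z)"
    by (simp add: algebra_simps)
  moreover have "Digamma (z + 1) = Digamma z + 1 / z"
    using nz[of 0] by (simp add: Digamma_plus1)
  ultimately have D: "Digamma (1 - z) - Digamma (1 + z) =
      of_real pi * cos (of_real pi * z) / sin (of_real pi * z) - 1 / z"
    by (simp add: add.commute)
  have "(\<lambda>m. (of_real (ln (real m)) - (\<Sum>n<m. inverse ((1 - z) + of_nat n))) -
             (of_real (ln (real m)) - (\<Sum>n<m. inverse ((1 + z) + of_nat n))))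
        \<longlonglongrightarrow> Digamma (1 - z) - Digamma (1 + z)"
    using ni nz[of 1] by (intro tendsto_diff Digamma_LIMSEQ) (auto simp: add.commute)
  also have "(\<lambda>m. (of_real (ln (real m)) - (\<Sum>n<m. inverse ((1 - z) + of_nat n))) -
             (of_real (ln (real m)) - (\<Sum>n<m. inverse ((1 + z) + of_nat n)))) =
      (\<lambda>m. \<Sum>n<m. inverse ((1 + z) + of_nat n) - inverse ((1 - z) + of_nat n))"
    by (simp add: sum_subtractf fun_eq_iff)
  finally have "(\<lambda>n. inverse ((1 + z) + of_nat n) - inverse ((1 - z) + of_nat n)) sums
      (Digamma (1 - z) - Digamma (1 + z))" unfolding sums_def .
  hence S: "(\<lambda>n. \<i> / (2 * of_real pi) * (inverse ((1 + z) + of_nat n) - inverse ((1 - z) + of_nat n))) sums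
      (\<i> / (2 * of_real pi) * (Digamma (1 - z) - Digamma (1 + z)))" by (rule sums_mult)
  have T: "\<i> / (2 * of_real pi) * (inverse ((1 + z) + of_nat n) - inverse ((1 - z) + of_nat n)) =
      of_real (2 * x / (x\<^sup>2 + (2 * pi * real (Suc n))\<^sup>2))" for n
  proof -
    have a: "1 + z + of_nat n \<noteq> 0" using nz[of "int n + 1"] by (simp add: algebra_simps)
    have b: "1 - z + of_nat n \<noteq> 0" using nz[of "- (int n + 1)"] by (auto simp: algebra_simps)
    have c: "(1 + z + of_nat n) * (1 - z + of_nat n) =
        of_real ((x\<^sup>2 + (2 * pi * real (Suc n))\<^sup>2) / (4 * pi\<^sup>2))"
      unfolding z_def by (simp add: field_simps power2_eq_square)
    have pos: "x\<^sup>2 + (2 * pi * real (Suc n))\<^sup>2 > 0" using x by (intro add_pos_nonneg) auto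
    have "inverse ((1 + z) + of_nat n) - inverse ((1 - z) + of_nat n) =
      - (2 * z) / ((1 + z + of_nat n) * (1 - z + of_nat n))"
      using a b by (simp add: field_simps)
    also have "\<dots> = - (2 * z) * (4 * of_real pi ^ 2) / of_real (x\<^sup>2 + (2 * pi * real (Suc n))\<^sup>2)"
      unfolding c by simp
    finally have d: "inverse ((1 + z) + of_nat n) - inverse ((1 - z) + of_nat n) = \<dots>" .
    show ?thesis
      unfolding d using pos by (simp add: z_def power2_eq_square del: of_nat_Suc)
  qed
  have E: "\<i> / (2 * of_real pi) * (Digamma (1 - z) - Digamma (1 + z)) =
      of_real (1 / (exp x - 1) - 1 / x + 1 / 2)"
  proof -
    define e where "e = exp (x / 2)"
    have e: "e > 1" using x by (simp add: e_def)
    have ee: "exp x = e * e" by (simp add: e_def flip: exp_add)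
    have iz: "\<i> * (of_real pi * z) = of_real (- (x / 2))" "- complex_of_real (- (x / 2)) = of_real (x/2)"
      by (simp_all add: z_def)
    have c: "cos (of_real pi * z) = of_real ((1 / e + e) / 2)"
      unfolding cos_exp_eq iz exp_of_real e_def by (simp add: exp_minus field_simps)
    have s: "sin (of_real pi * z) = of_real ((1 / e - e) / 2) / \<i>"
      unfolding sin_exp_eq iz exp_of_real e_def by (simp add: exp_minus field_simps)
    have r: "((1 / e + e) / 2) / ((1 / e - e) / 2) = - ((e * e + 1) / (e * e - 1))"
    proof -
      have "1 / e - e \<noteq> 0" "e * e - 1 \<noteq> 0" using e by (auto simp: field_simps)
         (smt (verit, best) mult_less_cancel_left2)+
      thus ?thesis using e by (simp add: field_simps)
    qed
    have "\<i> / (2 * of_real pi) * (Digamma (1 - z) - Digamma (1 + z)) =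
      - (1/2) * (of_real (((1 / e + e) / 2) / ((1 / e - e) / 2))) - 1 / of_real x"
    proof -
      have "\<i> / (2 * of_real pi) * (of_real pi * C / (S / \<i>) - 1 / z) = - (1/2) * (C / S) - 1 / of_real x"
        for C S :: complex using x by (simp add: z_def right_diff_distrib)
      thus ?thesis unfolding D c s of_real_divide[of "(1 / e + e) / 2"] .
    qed
    also have "\<dots> = of_real ((1/2) * ((e * e + 1) / (e * e - 1)) - 1 / x)"
      unfolding r by simp
    also have "(1/2) * ((e * e + 1) / (e * e - 1)) = 1 / (exp x - 1) + 1/2"
      using x unfolding ee[symmetric] by (simp add: field_simps)
    finally show ?thesis by simp
  qed
  show ?thesis using S unfolding T E sums_of_real_iff .
qed

section \<open>Mellin transforms\<close>

lemma norm_exp_minus_1_le: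
  fixes w :: complex
  shows "norm (exp w - 1) \<le> norm w * exp (norm w)"
proof -
  have "norm (exp w - exp 0) \<le> exp (norm w) * norm (w - 0)"
  proof (rule field_differentiable_bound[of "cball 0 (norm w)"])
    show "(exp has_field_derivative exp z) (at z within cball 0 (norm w))" for z :: complex
      by (rule DERIV_subset[OF DERIV_exp]) auto
    show "norm (exp z) \<le> exp (norm w)" if "z \<in> cball 0 (norm w)" for z :: complex
      using norm_exp[of z] that by (meson dual_order.trans exp_le_cancel_iff mem_cball_0)
  qed auto
  thus ?thesis by (simp add: mult.commute)
qed

definition mellin :: "(real \<Rightarrow> real) \<Rightarrow> complex \<Rightarrow> complex" where
  "mellin g s = (LINT x|lborel. of_real x powr (s - 1) * of_real (indicator {0<..} x * g x))"

lemma mellin_integrand_measurable [measurable]: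
  fixes g :: "real \<Rightarrow> real"
  assumes [measurable]: "g \<in> borel_measurable borel"
  shows "(\<lambda>x. of_real x powr (s - 1) * of_real (indicator {0<..} x * g x) :: complex) \<in> borel_measurable borel"
proof -
  have "(\<lambda>x. of_real x powr (s - 1) * of_real (indicator {0<..} x * g x) :: complex) =
     (\<lambda>x. exp ((s - 1) * of_real (ln x)) * of_real (indicator {0<..} x * g x))"
    by (auto simp: fun_eq_iff powr_def indicator_def Ln_of_real)
  also have "\<dots> \<in> borel_measurable borel" by measurable
  finally show ?thesis .
qed

text \<open>The difference quotients of \<open>x\<^sup>s\<close> in \<open>s\<close> are bounded by the powers of \<open>x\<close> with the real exponents
  \<open>Re s + 2 d\<close> and \<open>Re s - 2 d\<close>, because \<open>\<bar>x\<^sup>h - 1\<bar> \<le> \<bar>h ln x\<bar> exp \<bar>h ln x\<bar>\<close>. Both exponents stay in the strip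
  of absolute convergence, so that dominated convergence yields a complex derivative.\<close>
lemma mellin_holomorphic:
  fixes g :: "real \<Rightarrow> real"
  assumes [measurable]: "g \<in> borel_measurable borel"
  assumes int: "\<And>\<sigma>. a < \<sigma> \<Longrightarrow> \<sigma> < b \<Longrightarrow> integrable lborel (\<lambda>x. x powr (\<sigma> - 1) * (indicator {0<..} x * g x))"
  shows "mellin g holomorphic_on {s. a < Re s \<and> Re s < b}"
proof -
  let ?f = "\<lambda>s x. of_real x powr (s - 1) * of_real (indicator {0<..} x * g x) :: complex"
  have intc: "integrable lborel (?f s)" if "a < Re s" "Re s < b" for s
  proof (rule Bochner_Integration.integrable_bound[OF int[OF that]])
    show "?f s \<in> borel_measurable lborel" by simp
    show "AE x in lborel. norm (?f s x) \<le> norm (x powr (Re s - 1) * (indicator {0<..} x * g x))"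
      by (auto simp: indicator_def norm_mult norm_powr_real_powr)
  qed
  have "\<exists>f'. (mellin g has_field_derivative f') (at s)" if s: "a < Re s" "Re s < b" for s
  proof -
    define d where "d = min (Re s - a) (b - Re s) / 3"
    have d: "d > 0" "a < Re s - 2 * d" "Re s + 2 * d < b" using s unfolding d_def by (auto simp: min_def field_simps)
    define D where "D = (LINT x|lborel. of_real (ln x) * ?f s x)"
    have "((\<lambda>h. (mellin g (s + h) - mellin g s) / h) \<longlongrightarrow> D) (at 0)"
    proof (subst tendsto_at_iff_sequentially, intro allI impI)
      fix X :: "nat \<Rightarrow> complex"
      assume X: "\<forall>i. X i \<in> UNIV - {0}" "X \<longlonglongrightarrow> 0"
      obtain N where N: "\<And>n. n \<ge> N \<Longrightarrow> norm (X n) < d"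
        using X(2) d(1) by (auto simp: lim_sequentially dist_norm)
      define Y where "Y = (\<lambda>n. X (n + N))"
      have Y: "Y n \<noteq> 0" "norm (Y n) < d" "Y \<longlonglongrightarrow> 0" for n
        using X N[of "n + N"] LIMSEQ_ignore_initial_segment[OF X(2), of N] by (auto simp: Y_def)
      have "(\<lambda>n. LINT x|lborel. (?f (s + Y n) x - ?f s x) / Y n) \<longlonglongrightarrow> D"
        unfolding D_def
      proof (rule integral_dominated_convergence)
        let ?w = "\<lambda>x. (x powr (Re s + 2 * d - 1) * (indicator {0<..} x * g x))"
        let ?v = "\<lambda>x. (x powr (Re s - 2 * d - 1) * (indicator {0<..} x * g x))"
        show "integrable lborel (\<lambda>x. 1 / d * (norm (?w x) + norm (?v x)))"
          using d by (intro integrable_mult_right Bochner_Integration.integrable_add integrable_norm int) auto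
        show "(\<lambda>x. of_real (ln x) * ?f s x) \<in> borel_measurable lborel" by simp
        show "(\<lambda>x. (?f (s + Y n) x - ?f s x) / Y n) \<in> borel_measurable lborel" for n by simp
        show "AE x in lborel. (\<lambda>n. (?f (s + Y n) x - ?f s x) / Y n) \<longlonglongrightarrow> of_real (ln x) * ?f s x"
        proof (rule AE_I2)
          fix x :: real
          show "(\<lambda>n. (?f (s + Y n) x - ?f s x) / Y n) \<longlonglongrightarrow> of_real (ln x) * ?f s x"
          proof (cases "x > 0")
            case True
            have eq: "?f s' x = exp ((s' - 1) * of_real (ln x)) * of_real (g x)" for s'
              using True by (simp add: powr_def Ln_of_real)
            have "((\<lambda>s. ?f s x) has_field_derivative of_real (ln x) * ?f s x) (at s)"
              unfolding eq by (auto intro!: derivative_eq_intros)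
            hence "((\<lambda>h. (?f (s + h) x - ?f s x) / h) \<longlongrightarrow> of_real (ln x) * ?f s x) (at 0)"
              by (simp add: DERIV_def)
            thus ?thesis using Y by (auto simp: tendsto_at_iff_sequentially o_def)
          qed auto
        qed
        show "AE x in lborel. norm ((?f (s + Y n) x - ?f s x) / Y n) \<le> 1 / d * (norm (?w x) + norm (?v x))" for n
        proof (rule AE_I2)
          fix x :: real
          show "norm ((?f (s + Y n) x - ?f s x) / Y n) \<le> 1 / d * (norm (?w x) + norm (?v x))"
          proof (cases "x > 0")
            case True
            define l where "l = \<bar>ln x\<bar>"
            have eq: "?f s' x = exp ((s' - 1) * of_real (ln x)) * of_real (g x)" for s'
              using True by (simp add: powr_def Ln_of_real)
            have "exp ((s + Y n - 1) * of_real (ln x)) =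
                exp (Y n * of_real (ln x)) * exp ((s - 1) * of_real (ln x))"
              by (simp add: algebra_simps flip: exp_add)
            hence "?f (s + Y n) x - ?f s x = (exp (Y n * of_real (ln x)) - 1) * ?f s x"
              unfolding eq by (simp add: algebra_simps)
            hence "norm ((?f (s + Y n) x - ?f s x) / Y n) =
               norm (exp (Y n * of_real (ln x)) - 1) / norm (Y n) * norm (?f s x)"
              by (simp add: norm_mult norm_divide)
            also have "norm (exp (Y n * of_real (ln x)) - 1) \<le> norm (Y n) * l * exp (norm (Y n) * l)"
              using norm_exp_minus_1_le[of "Y n * of_real (ln x)"] by (simp add: norm_mult l_def)
            also have "\<dots> / norm (Y n) = l * exp (norm (Y n) * l)" using Y by simp
            also have "\<dots> \<le> (exp (d * l) / d) * exp (d * l)"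
            proof (intro mult_mono)
              have "d * l \<le> exp (d * l)" using exp_ge_add_one_self[of "d * l"] by linarith
              thus "l \<le> exp (d * l) / d" using d by (simp add: field_simps)
              show "exp (norm (Y n) * l) \<le> exp (d * l)"
                using Y(2)[of n] by (auto intro!: mult_right_mono simp: l_def)
            qed (use d in auto)
            also have "\<dots> = 1 / d * exp (2 * d * l)" by (simp flip: exp_add)
            also have "exp (2 * d * l) \<le> x powr (2 * d) + x powr (- 2 * d)"
              using True by (auto simp: powr_def l_def abs_if)
            finally have "norm ((?f (s + Y n) x - ?f s x) / Y n) \<le>
                1 / d * (x powr (2 * d) + x powr (- 2 * d)) * norm (?f s x)"
              using d by (auto simp: divide_right_mono mult_right_mono)
            also have "norm (?f s x) = x powr (Re s - 1) * \<bar>g x\<bar>"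
              using True by (simp add: norm_mult norm_powr_real_powr)
            also have "1 / d * (x powr (2 * d) + x powr (- 2 * d)) * (x powr (Re s - 1) * \<bar>g x\<bar>) =
               1 / d * (norm (?w x) + norm (?v x))"
              using True by (simp add: abs_mult algebra_simps add_divide_distrib flip: powr_add)
            finally show ?thesis .
          qed auto
        qed
      qed
      also have "(\<lambda>n. LINT x|lborel. (?f (s + Y n) x - ?f s x) / Y n) =
          (\<lambda>n. (mellin g (s + Y n) - mellin g s) / Y n)"
      proof
        fix n
        have "\<bar>Re (Y n)\<bar> < d" using Y(2)[of n] abs_Re_le_cmod[of "Y n"] by linarith
        hence "integrable lborel (?f (s + Y n))" using d s by (intro intc) auto
        moreover have "integrable lborel (?f s)" using s by (intro intc)
        ultimately show "(LINT x|lborel. (?f (s + Y n) x - ?f s x) / Y n) =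
            (mellin g (s + Y n) - mellin g s) / Y n"
          by (simp add: mellin_def)
      qed
      finally have "(\<lambda>n. (mellin g (s + X (n + N)) - mellin g s) / X (n + N)) \<longlonglongrightarrow> D" by (simp add: Y_def)
      thus "((\<lambda>h. (mellin g (s + h) - mellin g s) / h) \<circ> X) \<longlonglongrightarrow> D"
        unfolding o_def by (rule LIMSEQ_offset)
    qed
    thus ?thesis by (auto simp: DERIV_def)
  qed
  thus ?thesis
    by (auto simp: holomorphic_on_def field_differentiable_def intro: has_field_derivative_at_within)
qed

text \<open>At real exponents the transform is a real integral. Convergence is part of the relation, as for
  \<^const>\<open>has_bochner_integral\<close>, so that sums of transforms need no separate side conditions.\<close>
definition has_mellin :: "(real \<Rightarrow> real) \<Rightarrow> real \<Rightarrow> real \<Rightarrow> bool" where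
  "has_mellin g s r \<longleftrightarrow>
     has_bochner_integral lborel (\<lambda>x. x powr (s - 1) * (indicator {0<..} x * g x)) r"

lemma has_mellin_imp_mellin:
  assumes "has_mellin g s r"
  shows "mellin g (of_real s) = of_real r"
proof -
  have "mellin g (of_real s) = (LINT x|lborel. of_real (x powr (s - 1) * (indicator {0<..} x * g x)))"
    unfolding mellin_def
    by (intro Bochner_Integration.integral_cong) (auto simp: indicator_def simp flip: powr_of_real)
  also have "\<dots> = of_real r"
    using assms unfolding has_mellin_def integral_complex_of_real
    by (simp add: has_bochner_integral_integral_eq)
  finally show ?thesis .
qed

lemma has_mellin_add: "has_mellin f s a \<Longrightarrow> has_mellin g s b \<Longrightarrow> has_mellin (\<lambda>x. f x + g x) s (a + b)"
  unfolding has_mellin_def using has_bochner_integral_add by (simp add: algebra_simps)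

lemma has_mellin_cmult: "has_mellin f s a \<Longrightarrow> has_mellin (\<lambda>x. c * f x) s (c * a)"
proof -
  assume "has_mellin f s a"
  hence "has_bochner_integral lborel (\<lambda>x. c * (x powr (s - 1) * (indicator {0<..} x * f x))) (c * a)"
    unfolding has_mellin_def by (rule has_bochner_integral_mult_right)
  thus ?thesis unfolding has_mellin_def by (simp add: mult_ac)
qed

lemma has_mellin_cong:
  assumes "\<And>x. x > 0 \<Longrightarrow> f x = g x" "has_mellin f s a"
  shows "has_mellin g s a"
proof -
  have "(\<lambda>x. x powr (s - 1) * (indicator {0<..} x * f x)) = (\<lambda>x. x powr (s - 1) * (indicator {0<..} x * g x))"
    using assms(1) by (auto simp: indicator_def)
  thus ?thesis using assms(2) unfolding has_mellin_def by simp
qed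

lemma has_mellin_unique: "has_mellin f s a \<Longrightarrow> has_mellin f s b \<Longrightarrow> a = b"
  unfolding has_mellin_def using has_bochner_integral_eq by blast

lemma has_mellin_nn_integral:
  assumes [measurable]: "g \<in> borel_measurable borel" and "\<And>x. x > 0 \<Longrightarrow> g x \<ge> 0" "r \<ge> 0"
  shows "has_mellin g s r \<longleftrightarrow>
     (\<integral>\<^sup>+x. ennreal (x powr (s - 1) * (indicator {0<..} x * g x)) \<partial>lborel) = ennreal r" (is "?A \<longleftrightarrow> ?B")
proof
  have nn: "x powr (s - 1) * (indicator {0<..} x * g x) \<ge> 0" for x using assms by (auto simp: indicator_def)
  show "?B \<Longrightarrow> ?A" unfolding has_mellin_def
    by (rule has_bochner_integral_nn_integral) (use nn assms in auto)
  show ?B if ?A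
    using that nn unfolding has_mellin_def has_bochner_integral_iff
    by (auto simp: nn_integral_eq_integral)
qed

lemma has_mellin_has_integral:
  assumes [measurable]: "g \<in> borel_measurable borel" and "\<And>x. x > 0 \<Longrightarrow> g x \<ge> 0"
  assumes "((\<lambda>x. x powr (s - 1) * g x) has_integral r) {0<..}"
  shows "has_mellin g s r"
proof -
  have "r \<ge> 0" using assms by (intro has_integral_nonneg[OF assms(3)]) auto
  moreover have "(\<integral>\<^sup>+x. ennreal (indicator {0<..} x * (x powr (s - 1) * g x)) \<partial>lborel) = ennreal r"
    using assms by (intro nn_integral_has_integral_lebesgue) auto
  ultimately show ?thesis using assms by (subst has_mellin_nn_integral) (auto simp: mult_ac)
qed

text \<open>All terms are nonnegative, so that summation and integration may be exchanged; the convergence of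
  the integral is then a consequence of the convergence of the series of transforms.\<close>
lemma has_mellin_sums:
  assumes [measurable]: "\<And>n. g n \<in> borel_measurable borel" "f \<in> borel_measurable borel"
    and nn: "\<And>n x. x > 0 \<Longrightarrow> g n x \<ge> 0"
    and s: "\<And>x. x > 0 \<Longrightarrow> (\<lambda>n. g n x) sums f x"
    and h: "\<And>n. has_mellin (g n) s (r n)" and rnn: "\<And>n. r n \<ge> 0" and R: "r sums R"
  shows "has_mellin f s R"
proof -
  have fnn: "f x \<ge> 0" if "x > 0" for x by (rule sums_le[OF _ sums_zero s[OF that]]) (rule nn[OF that])
  have Rnn: "R \<ge> 0" by (rule sums_le[OF _ sums_zero R]) (rule rnn)
  have "(\<integral>\<^sup>+x. ennreal (x powr (s - 1) * (indicator {0<..} x * f x)) \<partial>lborel) =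
     (\<integral>\<^sup>+x. (\<Sum>n. ennreal (x powr (s - 1) * (indicator {0<..} x * g n x))) \<partial>lborel)"
  proof (rule nn_integral_cong)
    fix x :: real
    show "ennreal (x powr (s - 1) * (indicator {0<..} x * f x)) =
      (\<Sum>n. ennreal (x powr (s - 1) * (indicator {0<..} x * g n x)))"
      using nn[of x] s[of x]
      by (cases "x > 0") (auto intro!: suminf_ennreal_eq[symmetric] sums_mult)
  qed
  also have "\<dots> = (\<Sum>n. \<integral>\<^sup>+x. ennreal (x powr (s - 1) * (indicator {0<..} x * g n x)) \<partial>lborel)"
    by (rule nn_integral_suminf) auto
  also have "\<dots> = (\<Sum>n. ennreal (r n))"
    using h nn rnn by (subst (asm) has_mellin_nn_integral) auto
  also have "\<dots> = ennreal R" using rnn R by (rule suminf_ennreal_eq)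
  finally show ?thesis using fnn Rnn by (subst has_mellin_nn_integral) auto
qed

lemma has_mellin_integrable:
  "has_mellin g s r \<Longrightarrow> integrable lborel (\<lambda>x. x powr (s - 1) * (indicator {0<..} x * g x))"
  unfolding has_mellin_def has_bochner_integral_iff by simp

lemma has_mellin_exp:
  assumes s: "s > 0" and n: "n > 0"
  shows "has_mellin (\<lambda>x. exp (- n * x)) s (Gamma s / n powr s)"
proof -
  have G: "Gamma s > 0" using s by (rule Gamma_real_pos)
  let ?I = "\<integral>\<^sup>+x. ennreal (x powr (s - 1) * (indicator {0<..} x * exp (- n * x))) \<partial>lborel"
  have "ennreal (Gamma s) = (\<integral>\<^sup>+t. ennreal (indicator {0..} t * t powr (s - 1) / exp t) \<partial>lborel)"
    by (rule Gamma_conv_nn_integral_real[OF s])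
  also have "\<dots> = ennreal n * (\<integral>\<^sup>+t. ennreal (indicator {0..} (0 + n * t) * (0 + n * t) powr (s - 1) / exp (0 + n * t)) \<partial>lborel)"
    using n by (subst nn_integral_real_affine[where t = 0 and c = n]) auto
  also have "(\<lambda>t. ennreal (indicator {0..} (0 + n * t) * (0 + n * t) powr (s - 1) / exp (0 + n * t))) =
     (\<lambda>x. ennreal (n powr (s - 1)) * ennreal (x powr (s - 1) * (indicator {0<..} x * exp (- n * x))))"
    using n by (auto simp: fun_eq_iff indicator_def powr_mult exp_minus field_simps zero_le_mult_iff simp flip: ennreal_mult)
  also have "(\<integral>\<^sup>+x. ennreal (n powr (s - 1)) * ennreal (x powr (s - 1) * (indicator {0<..} x * exp (- n * x))) \<partial>lborel) = ennreal (n powr (s - 1)) * ?I"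
    by (rule nn_integral_cmult) auto
  finally have "ennreal (1 / n powr s) * ennreal (Gamma s) = ennreal (1 / n powr s) * (ennreal n * (ennreal (n powr (s - 1)) * ?I))"
    by simp
  also have "\<dots> = ennreal (1 / n powr s * (n * n powr (s - 1))) * ?I"
  proof -
    have "ennreal (1 / n powr s) * (ennreal n * (ennreal (n powr (s - 1)) * J)) =
        ennreal (1 / n powr s * (n * n powr (s - 1))) * J" for J
      using n by (simp add: ennreal_mult mult.assoc del: times_divide_eq_left times_divide_eq_right)
    thus ?thesis .
  qed
  also have "1 / n powr s * (n * n powr (s - 1)) = 1"
    using n by (simp add: powr_diff)
  finally show ?thesis using G n
    by (subst has_mellin_nn_integral) (auto simp flip: ennreal_mult)
qed

text \<open>The substitution \<open>t = x\<^sup>2 / (a\<^sup>2 + x\<^sup>2)\<close> reduces the integral to Euler's Beta integral with the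
  parameters \<open>(1 + s) / 2\<close> and \<open>(1 - s) / 2\<close>, whose sum is 1.\<close>
lemma has_mellin_pole_pair:
  assumes s: "-1 < s" "s < 1" and a: "a > 0"
  shows "has_mellin (\<lambda>x. 2 * x / (x\<^sup>2 + a\<^sup>2)) s (a powr (s - 1) * (Gamma ((1 + s) / 2) * Gamma ((1 - s) / 2)))"
proof (rule has_mellin_has_integral)
  define A B where "A = (1 + s) / 2" and "B = (1 - s) / 2"
  have AB: "A > 0" "B > 0" "A + B = 1" using s by (auto simp: A_def B_def field_simps)
  let ?f = "\<lambda>t. t powr (A - 1) * (1 - t) powr (B - 1)"
  let ?g = "\<lambda>y. y\<^sup>2 / (a\<^sup>2 + y\<^sup>2)" and ?g' = "\<lambda>y. 2 * a\<^sup>2 * y / (a\<^sup>2 + y\<^sup>2)\<^sup>2"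
  have pos: "a\<^sup>2 + y\<^sup>2 > 0" for y using a by (intro add_pos_nonneg) auto
  have img: "?g ` {0<..} = {0<..<1}"
  proof (intro equalityI subsetI)
    fix t assume "t \<in> ?g ` {0<..}" thus "t \<in> {0<..<1}" using a pos by (auto simp: field_simps)
  next
    fix t :: real assume t: "t \<in> {0<..<1}"
    define y where "y = a * sqrt (t / (1 - t))"
    have y2: "y\<^sup>2 = a\<^sup>2 * (t / (1 - t))" using t by (simp add: y_def power_mult_distrib)
    have "a\<^sup>2 + y\<^sup>2 = a\<^sup>2 / (1 - t)" unfolding y2 using t by (simp add: field_simps)
    hence "?g y = t" using t a unfolding y2 by simp
    moreover have "y > 0" using t a by (simp add: y_def)
    ultimately show "t \<in> ?g ` {0<..}" by force
  qed
  have "(?f has_integral Beta A B) {0<..<1}"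
    using has_integral_Beta_real[OF AB(1,2)] by (simp add: has_integral_Icc_iff_Ioo)
  hence "?f absolutely_integrable_on {0<..<1} \<and> integral {0<..<1} ?f = Beta A B"
    by (auto simp: has_integral_iff intro!: nonnegative_absolutely_integrable_1)
  hence "(\<lambda>y. \<bar>?g' y\<bar> * ?f (?g y)) absolutely_integrable_on {0<..} \<and>
      integral {0<..} (\<lambda>y. \<bar>?g' y\<bar> * ?f (?g y)) = Beta A B"
    unfolding img[symmetric]
  proof (rule iffD2[OF has_absolute_integral_change_of_variables_1'[of "{0<..}" ?g ?g' ?f "Beta A B"], rotated 3], goal_cases)
    case (2 x)
    have "((\<lambda>y. y\<^sup>2 / (a\<^sup>2 + y\<^sup>2)) has_real_derivative (2 * x * (a\<^sup>2 + x\<^sup>2) - x\<^sup>2 * (2 * x)) / ((a\<^sup>2 + x\<^sup>2) * (a\<^sup>2 + x\<^sup>2))) (at x within {0<..})"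
      using pos[of x] by (auto intro!: derivative_eq_intros)
    thus ?case by (simp add: algebra_simps power2_eq_square)
  next
    case 3
    show ?case
    proof (rule inj_onI)
      fix x y assume xy: "x \<in> {0<..}" "y \<in> {0<..}" "?g x = ?g y"
      have "x\<^sup>2 * (a\<^sup>2 + y\<^sup>2) = y\<^sup>2 * (a\<^sup>2 + x\<^sup>2)"
        using xy(3) pos[of x] pos[of y] by (subst (asm) frac_eq_eq) auto
      hence "x\<^sup>2 = y\<^sup>2" using a by (simp add: algebra_simps)
      thus "x = y" using xy(1,2) by simp
    qed
  qed auto
  hence I: "((\<lambda>y. \<bar>?g' y\<bar> * ?f (?g y)) has_integral Beta A B) {0<..}"
    unfolding has_integral_iff using set_lebesgue_integral_eq_integral(1) by blast
  have "((\<lambda>y. a powr (1 - s) * (y powr (s - 1) * (2 * y / (y\<^sup>2 + a\<^sup>2)))) has_integral Beta A B) {0<..}"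
  proof (rule has_integral_eq[OF _ I])
    fix y :: real assume "y \<in> {0<..}" hence y: "y > 0" by simp
    define q where "q = a\<^sup>2 + y\<^sup>2"
    have q: "q > 0" using pos[of y] by (simp add: q_def)
    have *: "1 - y\<^sup>2 / q = a\<^sup>2 / q" using q by (simp add: field_simps) (simp add: q_def)
    have y2: "(y\<^sup>2) powr (A - 1) = y powr (s - 1)"
    proof -
      have "(y\<^sup>2) powr (A - 1) = y powr (2 * (A - 1))" using y by (simp add: powr_powr flip: powr_numeral)
      also have "2 * (A - 1) = s - 1" by (simp add: A_def)
      finally show ?thesis .
    qed
    have a2: "(a\<^sup>2) powr (B - 1) = a powr (- s - 1)"
    proof -
      have "(a\<^sup>2) powr (B - 1) = a powr (2 * (B - 1))" using a by (simp add: powr_powr flip: powr_numeral)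
      also have "2 * (B - 1) = - s - 1" by (simp add: B_def)
      finally show ?thesis .
    qed
    have "A - 1 + (B - 1) = - 1" using AB(3) by simp
    hence q2: "q powr (A - 1) * q powr (B - 1) = 1 / q"
      using q by (simp add: powr_minus_divide flip: powr_add)
    have a3: "a\<^sup>2 * a powr (- s - 1) = a powr (1 - s)"
      using a by (simp flip: powr_add powr_numeral)
    have "\<bar>?g' y\<bar> * ?f (?g y) = (2 * a\<^sup>2 * y / q\<^sup>2) * ((y\<^sup>2 / q) powr (A - 1) * (a\<^sup>2 / q) powr (B - 1))"
      using y q unfolding q_def[symmetric] * by (simp add: abs_mult)
    also have "\<dots> = (2 * a\<^sup>2 * y / q\<^sup>2) * (y powr (s - 1) * a powr (- s - 1) / (q powr (A - 1) * q powr (B - 1)))"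
      using y a q by (simp add: powr_divide y2 a2)
    also have "\<dots> = (a\<^sup>2 * a powr (- s - 1)) * (y powr (s - 1) * (2 * y / q))"
      unfolding q2 using q by (simp add: field_simps power2_eq_square)
    finally show "\<bar>?g' y\<bar> * ?f (?g y) = a powr (1 - s) * (y powr (s - 1) * (2 * y / (y\<^sup>2 + a\<^sup>2)))"
      unfolding a3 q_def by (simp add: add.commute)
  qed
  hence "((\<lambda>y. a powr (s - 1) * (a powr (1 - s) * (y powr (s - 1) * (2 * y / (y\<^sup>2 + a\<^sup>2))))) has_integral a powr (s - 1) * Beta A B) {0<..}"
    by (rule has_integral_mult_right)
  moreover have "a powr (s - 1) * a powr (1 - s) = 1" using a by (simp flip: powr_add)
  moreover have "Beta A B = Gamma A * Gamma B" using AB by (simp add: Beta_def)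
  ultimately show "((\<lambda>x. x powr (s - 1) * (2 * x / (x\<^sup>2 + a\<^sup>2))) has_integral
     a powr (s - 1) * (Gamma ((1 + s) / 2) * Gamma ((1 - s) / 2))) {0<..}"
    unfolding A_def[symmetric] B_def[symmetric] by (simp add: mult.assoc[symmetric])
qed auto

lemma has_mellin_power_near_0:
  assumes "c > 0" "c = s + k"
  shows "has_mellin (\<lambda>x. indicator {..<1} x * x powr k) s (1 / c)"
proof (rule has_mellin_has_integral)
  have "((\<lambda>x. x powr (c - 1)) has_integral (1 powr (c - 1 + 1) / (c - 1 + 1))) {0..1}"
    using assms by (intro has_integral_powr_from_0) auto
  hence "((\<lambda>x. x powr (c - 1)) has_integral (1 / c)) {0<..<1}"
    by (simp add: has_integral_Icc_iff_Ioo)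
  hence "((\<lambda>x. if x \<in> {0<..<1} then x powr (c - 1) else 0) has_integral (1 / c)) {0<..}"
    by (subst has_integral_restrict) auto
  thus "((\<lambda>x. x powr (s - 1) * (indicator {..<1} x * x powr k)) has_integral 1 / c) {0<..}"
    by (rule has_integral_eq[rotated]) (auto simp: indicator_def assms(2) algebra_simps simp flip: powr_add)
qed (auto simp: indicator_def)

lemma has_mellin_power_near_inf:
  assumes "c < 0" "c = s + k"
  shows "has_mellin (\<lambda>x. indicator {1..} x * x powr k) s (- 1 / c)"
proof (rule has_mellin_has_integral)
  have "((\<lambda>x. x powr (c - 1)) has_integral - (1 powr (c - 1 + 1) / (c - 1 + 1))) {1..}"
    using has_integral_powr_to_inf[of "c - 1" 1] assms by simp
  hence "((\<lambda>x. x powr (c - 1)) has_integral (- 1 / c)) {1..}" by simp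
  hence "((\<lambda>x. if x \<in> {1..} then x powr (c - 1) else 0) has_integral (- 1 / c)) {0<..}"
    by (subst has_integral_restrict) auto
  thus "((\<lambda>x. x powr (s - 1) * (indicator {1..} x * x powr k)) has_integral - 1 / c) {0<..}"
    by (rule has_integral_eq[rotated]) (auto simp: indicator_def assms(2) algebra_simps simp flip: powr_add)
qed (auto simp: indicator_def)

section \<open>The Dirichlet series of the zeta function as a Mellin transform\<close>

definition dirichlet_zeta :: "complex \<Rightarrow> complex" where
  "dirichlet_zeta s = (\<Sum>n. 1 / of_nat (Suc n) powr s)"

lemma summable_zeta_real:
  assumes "s > (1::real)"
  shows "summable (\<lambda>n. 1 / real (Suc n) powr s)"
proof -
  have "summable (\<lambda>n. real (Suc n) powr (- s))"
    using assms by (subst summable_Suc_iff) (simp add: summable_real_powr_iff)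
  thus ?thesis by (simp add: powr_minus_divide)
qed

lemma norm_zeta_term: "norm (1 / of_nat (Suc n) powr s :: complex) = 1 / real (Suc n) powr Re s"
  using norm_powr_real_powr[of "of_nat (Suc n)" s] by (simp add: norm_divide del: of_nat_Suc)

lemma dirichlet_zeta_of_real:
  assumes "s > 1"
  shows "dirichlet_zeta (of_real s) = of_real (\<Sum>n. 1 / real (Suc n) powr s)"
proof -
  have "1 / of_nat (Suc n) powr complex_of_real s = of_real (1 / real (Suc n) powr s)" for n
    using powr_of_real[of "real (Suc n)" s] by (simp del: of_nat_Suc)
  thus ?thesis
    unfolding dirichlet_zeta_def using suminf_of_real[OF summable_zeta_real[OF assms], where ?'a = complex]
    by (simp only:)
qed

lemma dirichlet_zeta_holomorphic: "dirichlet_zeta holomorphic_on {s. Re s > 1}"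
proof (rule holomorphic_uniform_sequence[where f = "\<lambda>N s. \<Sum>n<N. 1 / of_nat (Suc n) powr s"])
  show "open {s. Re s > 1}" by (rule open_halfspace_Re_gt)
  show "(\<lambda>s. \<Sum>n<N. 1 / of_nat (Suc n) powr s) holomorphic_on {s. Re s > 1}" for N
    by (auto intro!: holomorphic_intros simp del: of_nat_Suc)
  fix z assume "z \<in> {s. Re s > 1}"
  hence z: "Re z > 1" by simp
  define d where "d = (Re z - 1) / 2"
  have d: "d > 0" using z by (simp add: d_def)
  have ball: "Re s \<ge> 1 + d" if "s \<in> cball z d" for s
    using abs_Re_le_cmod[of "z - s"] that unfolding d_def by (auto simp: dist_norm field_simps)
  have "uniform_limit (cball z d) (\<lambda>N s. \<Sum>n<N. 1 / of_nat (Suc n) powr s) dirichlet_zeta sequentially"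
    unfolding dirichlet_zeta_def
  proof (rule Weierstrass_m_test)
    show "summable (\<lambda>n. 1 / real (Suc n) powr (1 + d))" using d by (intro summable_zeta_real) auto
    show "norm (1 / of_nat (Suc n) powr s) \<le> 1 / real (Suc n) powr (1 + d)" if "s \<in> cball z d" for n s
      unfolding norm_zeta_term using ball[OF that] by (intro divide_left_mono powr_mono) auto
  qed
  thus "\<exists>d>0. cball z d \<subseteq> {s. Re s > 1} \<and>
     uniform_limit (cball z d) (\<lambda>N s. \<Sum>n<N. 1 / of_nat (Suc n) powr s) dirichlet_zeta sequentially"
    using d ball by (intro exI[of _ d]) force
qed

text \<open>The function \<open>bose\<close> is the generating series of the exponentials \<open>exp (- n x)\<close>, whose transforms
  are the terms of \<open>\<Gamma>(s) \<zeta>(s)\<close>. Near 0 it behaves like \<open>1 / x - 1 / 2\<close>; \<open>bose_reg\<close> is the rest, which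
  vanishes at 0 to first order.\<close>
definition bose :: "real \<Rightarrow> real" where "bose x = 1 / (exp x - 1)"
definition bose_reg :: "real \<Rightarrow> real" where "bose_reg x = 1 / (exp x - 1) - 1 / x + 1 / 2"

lemma bose_measurable [measurable]: "bose \<in> borel_measurable borel" "bose_reg \<in> borel_measurable borel"
  unfolding bose_def[abs_def] bose_reg_def[abs_def] by measurable

text \<open>The geometric series is transformed term by term.\<close>
lemma has_mellin_bose:
  assumes s: "s > 1"
  shows "has_mellin bose s (Gamma s * (\<Sum>n. 1 / real (Suc n) powr s))"
proof (rule has_mellin_sums)
  show "(\<lambda>n. exp (- real (Suc n) * x)) sums bose x" if x: "x > 0" for x
  proof -
    have "(\<lambda>n. exp (- x) * exp (- x) ^ n) sums (exp (- x) * (1 / (1 - exp (- x))))"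
      using x by (intro sums_mult geometric_sums) auto
    also have "(\<lambda>n. exp (- x) * exp (- x) ^ n) = (\<lambda>n. exp (- real (Suc n) * x))"
      by (auto simp: fun_eq_iff algebra_simps simp flip: exp_of_nat_mult exp_add)
    also have "exp (- x) * (1 / (1 - exp (- x))) = bose x"
      using x by (simp add: bose_def exp_minus field_simps)
    finally show ?thesis .
  qed
  show "has_mellin (\<lambda>x. exp (- real (Suc n) * x)) s (Gamma s / real (Suc n) powr s)" for n
    using s by (intro has_mellin_exp) auto
  show "Gamma s / real (Suc n) powr s \<ge> 0" for n using s Gamma_real_pos[of s] by simp
  show "(\<lambda>n. Gamma s / real (Suc n) powr s) sums (Gamma s * (\<Sum>n. 1 / real (Suc n) powr s))"
    using sums_mult[OF summable_sums[OF summable_zeta_real[OF s]], of "Gamma s"] by simp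
qed auto

text \<open>The source of the functional equation: the transform of the \<open>n\<close>-th partial fraction of \<open>bose_reg\<close>
  is a multiple of \<open>n powr (s - 1)\<close>, which is the \<open>n\<close>-th term of the Dirichlet series at \<open>1 - s\<close>.\<close>
lemma has_mellin_bose_reg:
  assumes s: "-1 < s" "s < 0"
  shows "has_mellin bose_reg s
     ((2 * pi) powr (s - 1) * (Gamma ((1 + s) / 2) * Gamma ((1 - s) / 2)) * (\<Sum>n. 1 / real (Suc n) powr (1 - s)))"
proof (rule has_mellin_sums)
  let ?c = "Gamma ((1 + s) / 2) * Gamma ((1 - s) / 2)"
  have c: "?c > 0" using s by (intro mult_pos_pos Gamma_real_pos) auto
  show "(\<lambda>n. 2 * x / (x\<^sup>2 + (2 * pi * real (Suc n))\<^sup>2)) sums bose_reg x" if x: "x > 0" for x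
    unfolding bose_reg_def by (rule coth_partial_fractions[OF x])
  show "has_mellin (\<lambda>x. 2 * x / (x\<^sup>2 + (2 * pi * real (Suc n))\<^sup>2)) s ((2 * pi * real (Suc n)) powr (s - 1) * ?c)" for n
    using s by (intro has_mellin_pole_pair) auto
  show "(2 * pi * real (Suc n)) powr (s - 1) * ?c \<ge> 0" for n using c by simp
  have eq: "(2 * pi * real (Suc n)) powr (s - 1) * ?c = (2 * pi) powr (s - 1) * ?c * (1 / real (Suc n) powr (1 - s))" for n
  proof -
    have "(2 * pi * real (Suc n)) powr (s - 1) = (2 * pi) powr (s - 1) * real (Suc n) powr (s - 1)"
      by (rule powr_mult)
    also have "real (Suc n) powr (s - 1) = 1 / real (Suc n) powr (1 - s)"
      using powr_minus_divide[of "real (Suc n)" "1 - s"] by simp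
    finally show ?thesis by (simp add: field_simps del: of_nat_Suc)
  qed
  show "(\<lambda>n. (2 * pi * real (Suc n)) powr (s - 1) * ?c) sums
     ((2 * pi) powr (s - 1) * ?c * (\<Sum>n. 1 / real (Suc n) powr (1 - s)))"
    unfolding eq using s by (intro sums_mult summable_sums summable_zeta_real) auto
qed auto

lemma integrable_mellin_near_inf:
  fixes g :: "real \<Rightarrow> real"
  assumes [measurable]: "g \<in> borel_measurable borel" and "\<sigma> \<le> \<sigma>'"
    and "integrable lborel (\<lambda>x. x powr (\<sigma>' - 1) * (indicator {0<..} x * g x))"
  shows "integrable lborel (\<lambda>x. x powr (\<sigma> - 1) * (indicator {0<..} x * (indicator {1..} x * g x)))"
proof (rule Bochner_Integration.integrable_bound[OF assms(3)])
  show "AE x in lborel. norm (x powr (\<sigma> - 1) * (indicator {0<..} x * (indicator {1..} x * g x)))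
         \<le> norm (x powr (\<sigma>' - 1) * (indicator {0<..} x * g x))"
    using assms(2) by (auto simp: indicator_def abs_mult intro!: mult_right_mono powr_mono)
qed auto

lemma integrable_mellin_near_0:
  fixes g :: "real \<Rightarrow> real"
  assumes [measurable]: "g \<in> borel_measurable borel" and "\<sigma>' \<le> \<sigma>"
    and "integrable lborel (\<lambda>x. x powr (\<sigma>' - 1) * (indicator {0<..} x * g x))"
  shows "integrable lborel (\<lambda>x. x powr (\<sigma> - 1) * (indicator {0<..} x * (indicator {..<1} x * g x)))"
proof (rule Bochner_Integration.integrable_bound[OF assms(3)])
  show "AE x in lborel. norm (x powr (\<sigma> - 1) * (indicator {0<..} x * (indicator {..<1} x * g x)))
         \<le> norm (x powr (\<sigma>' - 1) * (indicator {0<..} x * g x))"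
    using assms(2) by (auto simp: indicator_def abs_mult intro!: mult_right_mono powr_mono')
qed auto

lemma has_mellinI_integrable:
  "integrable lborel (\<lambda>x. x powr (s - 1) * (indicator {0<..} x * g x)) \<Longrightarrow> \<exists>r. has_mellin g s r"
  unfolding has_mellin_def has_bochner_integral_iff by auto

text \<open>The transforms of \<open>bose\<close> over \<open>{1..}\<close>, an entire function, and of \<open>bose_reg\<close> over \<open>{0<..<1}\<close>, which
  converges for \<open>Re s > -1\<close>. Their sum is available to the right of 1 and in the strip \<open>-1 < Re s < 0\<close>.\<close>
definition bose_upper :: "complex \<Rightarrow> complex" where
  "bose_upper = mellin (\<lambda>x. indicator {1..} x * bose x)"
definition bose_lower :: "complex \<Rightarrow> complex" where
  "bose_lower = mellin (\<lambda>x. indicator {..<1} x * bose_reg x)"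

lemma integrable_bose_upper:
  "integrable lborel (\<lambda>x. x powr (\<sigma> - 1) * (indicator {0<..} x * (indicator {1..} x * bose x)))"
  by (rule integrable_mellin_near_inf[where \<sigma>' = "max \<sigma> 2"])
     (auto intro!: has_mellin_integrable[OF has_mellin_bose])

lemma integrable_bose_lower:
  assumes "\<sigma> > -1"
  shows "integrable lborel (\<lambda>x. x powr (\<sigma> - 1) * (indicator {0<..} x * (indicator {..<1} x * bose_reg x)))"
proof (rule integrable_mellin_near_0[where \<sigma>' = "min \<sigma> (-1/2)"])
  show "integrable lborel (\<lambda>x. x powr (min \<sigma> (- 1 / 2) - 1) * (indicator {0<..} x * bose_reg x))"
    by (rule has_mellin_integrable[OF has_mellin_bose_reg]) (use assms in auto)
qed auto

lemma bose_upper_holomorphic: "bose_upper holomorphic_on A"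
proof -
  have "bose_upper field_differentiable (at s)" for s
  proof (rule holomorphic_on_imp_differentiable_at)
    show "bose_upper holomorphic_on {z. Re s - 1 < Re z \<and> Re z < Re s + 1}"
      unfolding bose_upper_def by (intro mellin_holomorphic integrable_bose_upper) auto
    show "open {z. Re s - 1 < Re z \<and> Re z < Re s + 1}"
      by (intro open_Collect_conj open_halfspace_Re_gt open_halfspace_Re_lt)
  qed auto
  thus ?thesis by (simp add: holomorphic_on_def field_differentiable_at_within)
qed

lemma bose_lower_holomorphic: "bose_lower holomorphic_on {s. Re s > -1}"
proof -
  have "bose_lower field_differentiable (at s)" if "Re s > -1" for s
  proof (rule holomorphic_on_imp_differentiable_at)
    show "bose_lower holomorphic_on {z. - 1 < Re z \<and> Re z < Re s + 1}"
      unfolding bose_lower_def by (intro mellin_holomorphic integrable_bose_lower) auto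
    show "open {z. - 1 < Re z \<and> Re z < Re s + 1}"
      by (intro open_Collect_conj open_halfspace_Re_gt open_halfspace_Re_lt)
  qed (use that in auto)
  thus ?thesis by (simp add: holomorphic_on_def field_differentiable_at_within)
qed

text \<open>Here the powers \<open>1 / x\<close> and \<open>1 / 2\<close> are integrated over \<open>{0<..<1}\<close>.\<close>
lemma bose_split_right:
  assumes s: "s > 1"
  shows "bose_lower (of_real s) + bose_upper (of_real s) =
     of_real (Gamma s) * dirichlet_zeta (of_real s) - 1 / (of_real s - 1) + 1 / (2 * of_real s)"
proof -
  have i: "integrable lborel (\<lambda>x. x powr (s - 1) * (indicator {0<..} x * bose x))"
    by (rule has_mellin_integrable[OF has_mellin_bose[OF s]])
  obtain e where e: "has_mellin (\<lambda>x. indicator {1..} x * bose x) s e"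
    using has_mellinI_integrable[OF integrable_bose_upper] by auto
  obtain l where l: "has_mellin (\<lambda>x. indicator {..<1} x * bose x) s l"
    using has_mellinI_integrable[OF integrable_mellin_near_0[OF bose_measurable(1) order.refl i]] by auto
  have "has_mellin bose s (l + e)"
    by (rule has_mellin_cong[OF _ has_mellin_add[OF l e]]) (auto simp: indicator_def)
  hence 1: "l + e = Gamma s * (\<Sum>n. 1 / real (Suc n) powr s)"
    using has_mellin_unique[OF _ has_mellin_bose[OF s]] by blast
  have "has_mellin (\<lambda>x. indicator {..<1} x * bose_reg x) s (l + (- 1) * (1 / (s - 1)) + 1 / 2 * (1 / s))"
    by (rule has_mellin_cong[OF _ has_mellin_add[OF has_mellin_add[OF l
          has_mellin_cmult[OF has_mellin_power_near_0[where k = "-1"]]]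
          has_mellin_cmult[OF has_mellin_power_near_0[where k = 0]]]])
       (use s in \<open>auto simp: indicator_def bose_def bose_reg_def powr_minus_divide\<close>)
  from has_mellin_imp_mellin[OF this] has_mellin_imp_mellin[OF e] have
    "bose_lower (of_real s) + bose_upper (of_real s) = of_real (l + e - 1 / (s - 1) + 1 / 2 * (1 / s))"
    unfolding bose_lower_def bose_upper_def by simp
  thus ?thesis unfolding 1 dirichlet_zeta_of_real[OF s] by simp
qed

text \<open>Here the powers \<open>1 / x\<close> and \<open>1 / 2\<close> are integrated over \<open>{1..}\<close>. The resulting rational function of
  \<open>s\<close> is the same as on the right, which makes one side the continuation of the other.\<close>
lemma bose_split_left:
  assumes s: "-1 < s" "s < 0"
  shows "bose_lower (of_real s) + bose_upper (of_real s) =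
     of_real ((2 * pi) powr (s - 1) * (Gamma ((1 + s) / 2) * Gamma ((1 - s) / 2))) * dirichlet_zeta (1 - of_real s)
       - 1 / (of_real s - 1) + 1 / (2 * of_real s)"
proof -
  obtain e where e: "has_mellin (\<lambda>x. indicator {1..} x * bose x) s e"
    using has_mellinI_integrable[OF integrable_bose_upper] by auto
  obtain l where l: "has_mellin (\<lambda>x. indicator {..<1} x * bose_reg x) s l"
    using has_mellinI_integrable[OF integrable_bose_lower[OF s(1)]] by auto
  have "has_mellin bose_reg s (l + (e + (- 1) * (- 1 / (s - 1)) + 1 / 2 * (- 1 / s)))"
    by (rule has_mellin_cong[OF _ has_mellin_add[OF l has_mellin_add[OF has_mellin_add[OF e
          has_mellin_cmult[OF has_mellin_power_near_inf[where k = "-1"]]]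
          has_mellin_cmult[OF has_mellin_power_near_inf[where k = 0]]]]])
       (use s in \<open>auto simp: indicator_def bose_def bose_reg_def powr_minus_divide\<close>)
  from has_mellin_unique[OF this has_mellin_bose_reg[OF s]]
  have 1: "l + e = (2 * pi) powr (s - 1) * (Gamma ((1 + s) / 2) * Gamma ((1 - s) / 2)) *
      (\<Sum>n. 1 / real (Suc n) powr (1 - s)) - 1 / (s - 1) + 1 / (2 * s)" by simp
  have "bose_lower (of_real s) + bose_upper (of_real s) = of_real (l + e)"
    using has_mellin_imp_mellin[OF e] has_mellin_imp_mellin[OF l]
    unfolding bose_lower_def bose_upper_def by simp
  thus ?thesis unfolding 1 using dirichlet_zeta_of_real[of "1 - s"] s by simp
qed

section \<open>Analytic continuation and functional equation of the zeta function\<close>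

text \<open>Two expressions for \<open>(s - 1) \<zeta>(s)\<close>, the first for \<open>Re s > -1\<close> and the second for \<open>Re s < 0\<close>. The second
  is the functional equation read as a definition. In the first one the poles of the rational function
  at 1 and 0 have been cancelled by \<open>s - 1\<close> and by the zero of \<open>1 / \<Gamma>(s)\<close>.\<close>
definition zeta_right :: "complex \<Rightarrow> complex" where
  "zeta_right s = rGamma s * ((s - 1) * (bose_lower s + bose_upper s) + 1) - (s - 1) * rGamma (s + 1) / 2"

definition zeta_left :: "complex \<Rightarrow> complex" where
  "zeta_left s = (s - 1) * of_real pi powr (s - 1/2) * Gamma ((1 - s) / 2) * rGamma (s / 2) * dirichlet_zeta (1 - s)"

lemma zeta_right_holomorphic: "zeta_right holomorphic_on {s. Re s > -1}"
  unfolding zeta_right_def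
  by (intro holomorphic_intros bose_lower_holomorphic bose_upper_holomorphic) auto

lemma zeta_left_holomorphic: "zeta_left holomorphic_on {s. Re s < 0}"
proof -
  have "(dirichlet_zeta \<circ> (\<lambda>s. 1 - s)) holomorphic_on {s. Re s < 0}"
    by (rule holomorphic_on_compose_gen[OF _ dirichlet_zeta_holomorphic]) (auto intro!: holomorphic_intros)
  hence "(\<lambda>s. dirichlet_zeta (1 - s)) holomorphic_on {s. Re s < 0}" by (simp add: o_def)
  moreover have "(1 - s) / 2 \<notin> \<int>\<^sub>\<le>\<^sub>0" if "Re s < 0" for s
    using that by (auto elim!: nonpos_Ints_cases simp: complex_eq_iff)
  ultimately show ?thesis unfolding zeta_left_def by (auto intro!: holomorphic_intros)
qed

lemma zeta_right_algebra:
  fixes s :: complex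
  assumes "s \<noteq> 0" "s - 1 \<noteq> 0" "bose_lower s + bose_upper s = X - 1 / (s - 1) + 1 / (2 * s)"
  shows "zeta_right s = (s - 1) * (rGamma s * X)"
proof -
  have "(s - 1) * (X - 1 / (s - 1) + 1 / (2 * s)) + 1 = (s - 1) * X + (s - 1) / (2 * s)"
    using assms(1,2) by (simp add: ring_distribs)
  hence "zeta_right s = rGamma s * ((s - 1) * X + (s - 1) / (2 * s)) - (s - 1) * rGamma (s + 1) / 2"
    unfolding zeta_right_def assms(3) by simp
  also have "rGamma s = s * rGamma (s + 1)" using rGamma_plus1[of s] by simp
  also have "s * rGamma (s + 1) * ((s - 1) * X + (s - 1) / (2 * s)) - (s - 1) * rGamma (s + 1) / 2 =
      (s - 1) * (s * rGamma (s + 1) * X)"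
    using assms(1) by (simp add: field_simps)
  also have "s * rGamma (s + 1) = rGamma s" using rGamma_plus1[of s] by simp
  finally show ?thesis .
qed

lemma zeta_right_eq_dirichlet_real:
  assumes s: "s > (1::real)"
  shows "zeta_right (of_real s) = (of_real s - 1) * dirichlet_zeta (of_real s)"
proof -
  have G: "rGamma (complex_of_real s) * of_real (Gamma s) = 1"
  proof -
    have "Gamma s > 0" using s by (intro Gamma_real_pos) auto
    thus ?thesis by (simp add: rGamma_inverse_Gamma Gamma_complex_of_real)
  qed

  have nz: "complex_of_real s - 1 \<noteq> 0" "complex_of_real s \<noteq> 0"
    using s by auto
  have "zeta_right (of_real s) =
      (rGamma (complex_of_real s) * of_real (Gamma s)) * ((of_real s - 1) * dirichlet_zeta (of_real s))"
    using zeta_right_algebra[OF nz(2,1) bose_split_right[OF s]] by (simp only: mult_ac)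
  thus ?thesis unfolding G by simp
qed

text \<open>Legendre's duplication formula converts the factor \<open>\<Gamma>((1 + s) / 2) / \<Gamma>(s)\<close> into \<open>1 / \<Gamma>(s / 2)\<close>.\<close>
lemma zeta_right_eq_left_real:
  assumes s: "-1 < s" "s < 0"
  shows "zeta_right (of_real s) = zeta_left (of_real s)"
proof -
  define S where "S = complex_of_real s"
  have nz: "S - 1 \<noteq> 0" "S \<noteq> 0"
    using s by (auto simp: S_def)
  have ni: "S / 2 \<notin> \<int>\<^sub>\<le>\<^sub>0" "S / 2 + 1 / 2 \<notin> \<int>\<^sub>\<le>\<^sub>0" "S \<notin> \<int>\<^sub>\<le>\<^sub>0"
  proof -
    show "S \<notin> \<int>\<^sub>\<le>\<^sub>0" using s by (auto elim!: nonpos_Ints_cases simp: S_def complex_eq_iff)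
    show "S / 2 \<notin> \<int>\<^sub>\<le>\<^sub>0"
    proof
      assume "S / 2 \<in> \<int>\<^sub>\<le>\<^sub>0"
      then obtain n where n: "S / 2 = of_int n" by (auto elim!: nonpos_Ints_cases)
      hence "s = 2 * real_of_int n" by (simp add: S_def complex_eq_iff)
      hence "real_of_int n < 0" "real_of_int n > -1" using s by auto
      hence "n < 0" "n > -1" by simp_all
      thus False by simp
    qed
    show "S / 2 + 1/2 \<notin> \<int>\<^sub>\<le>\<^sub>0" using s
      by (auto elim!: nonpos_Ints_cases simp: S_def complex_eq_iff)
  qed
  define A B where "A = Gamma (S / 2)" and "B = Gamma ((1 + S) / 2)"
  have AB: "A \<noteq> 0" "B \<noteq> 0" using ni by (auto simp: A_def B_def Gamma_eq_zero_iff add_divide_distrib add.commute)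
  have dup: "A * B = exp ((1 - S) * of_real (ln 2)) * of_real (sqrt pi) * Gamma S"
    using Gamma_legendre_duplication[OF ni(1,2)] by (simp add: A_def B_def add_divide_distrib add.commute)
  have rG: "rGamma S * (A * B) = exp ((1 - S) * of_real (ln 2)) * of_real (sqrt pi)"
    unfolding dup using ni(3) by (simp add: rGamma_inverse_Gamma Gamma_eq_zero_iff)
  define C where "C = of_real ((2 * pi) powr (s - 1)) * B * Gamma ((1 - S) / 2)"
  have C: "of_real ((2 * pi) powr (s - 1) * (Gamma ((1 + s) / 2) * Gamma ((1 - s) / 2))) = C"
    by (simp add: C_def B_def S_def flip: Gamma_complex_of_real)
  have 1: "zeta_right S = (S - 1) * (rGamma S * C) * dirichlet_zeta (1 - S)"
    using zeta_right_algebra[OF nz(2,1) bose_split_left[OF s, folded S_def, unfolded C]]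
    by (simp only: mult_ac)
  have pw: "complex_of_real ((2 * pi) powr (s - 1)) = exp ((S - 1) * of_real (ln 2)) * exp ((S - 1) * of_real (ln pi))"
    by (simp add: powr_def S_def ln_mult algebra_simps flip: exp_of_real exp_add)
  have sp: "complex_of_real (sqrt pi) = exp (of_real (ln pi) / 2)"
  proof -
    have "sqrt pi = exp (ln pi / 2)" by (simp add: powr_half_sqrt[symmetric] powr_def)
    thus ?thesis by (simp flip: exp_of_real)
  qed
  have "rGamma S * C * A = (rGamma S * (A * B)) * of_real ((2 * pi) powr (s - 1)) * Gamma ((1 - S) / 2)"
    by (simp add: C_def)
  also have "\<dots> = (exp ((1 - S) * of_real (ln 2)) * exp ((S - 1) * of_real (ln 2))) *
      (exp (of_real (ln pi) / 2) * exp ((S - 1) * of_real (ln pi))) * Gamma ((1 - S) / 2)"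
    unfolding rG pw sp by (simp only: mult_ac)
  also have "exp ((1 - S) * of_real (ln 2)) * exp ((S - 1) * of_real (ln 2)) = 1"
    by (simp flip: exp_add add: algebra_simps)
  also have "exp (of_real (ln pi) / 2) * exp ((S - 1) * of_real (ln pi)) = of_real pi powr (S - 1/2)"
    by (simp flip: exp_add add: powr_def Ln_of_real algebra_simps)
  finally have "rGamma S * C = of_real pi powr (S - 1/2) * Gamma ((1 - S) / 2) * rGamma (S / 2)"
    using AB by (simp add: field_simps A_def rGamma_inverse_Gamma)
  thus ?thesis unfolding 1 S_def[symmetric] zeta_left_def by simp
qed

lemma islimpt_of_real_interval:
  fixes a b x :: real
  assumes "a < x" "x < b"
  shows "of_real x islimpt ((of_real ` {a<..<b}) :: complex set)"
proof (rule islimptI)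
  fix T :: "complex set" assume "of_real x \<in> T" "open T"
  then obtain e where e: "e > 0" "ball (of_real x) e \<subseteq> T" by (auto simp: open_contains_ball)
  define y where "y = x + min e (b - x) / 2"
  have "x < y" "y < b" "dist x y < e"
    using e assms unfolding y_def by (auto simp: dist_real_def min_def field_simps)
  hence "dist (complex_of_real x) (of_real y) < e" by (simp only: dist_of_real)
  thus "\<exists>y\<in>of_real ` {a<..<b}. y \<in> T \<and> y \<noteq> (of_real x :: complex)"
    using e assms \<open>x < y\<close> \<open>y < b\<close> by (intro bexI[of _ "of_real y"]) auto
qed

lemma zeta_right_eq_dirichlet:
  assumes "Re s > 1"
  shows "zeta_right s = (s - 1) * dirichlet_zeta s"
proof -
  have "zeta_right s - (s - 1) * dirichlet_zeta s = 0"
  proof (rule analytic_continuation[where f = "\<lambda>s. zeta_right s - (s - 1) * dirichlet_zeta s"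
       and S = "{s. Re s > 1}" and U = "of_real ` {1<..<3}" and \<xi> = 2])
    show "(\<lambda>s. zeta_right s - (s - 1) * dirichlet_zeta s) holomorphic_on {s. Re s > 1}"
      by (intro holomorphic_intros dirichlet_zeta_holomorphic holomorphic_on_subset[OF zeta_right_holomorphic]) auto
    show "connected {s. Re s > 1}" by (intro convex_connected convex_halfspace_Re_gt)
    show "2 islimpt complex_of_real ` {1<..<3}" using islimpt_of_real_interval[of 1 2 3] by simp
  qed (use assms in \<open>auto simp: open_halfspace_Re_gt zeta_right_eq_dirichlet_real\<close>)
  thus ?thesis by simp
qed

lemma zeta_right_eq_left:
  assumes "-1 < Re s" "Re s < 0"
  shows "zeta_right s = zeta_left s"
proof -
  have "zeta_right s - zeta_left s = 0"
  proof (rule analytic_continuation[where f = "\<lambda>s. zeta_right s - zeta_left s"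
       and S = "{s. Re s > -1} \<inter> {s. Re s < 0}" and U = "of_real ` {-1<..<0}" and \<xi> = "of_real (-1/2)"])
    show "(\<lambda>s. zeta_right s - zeta_left s) holomorphic_on {s. Re s > -1} \<inter> {s. Re s < 0}"
      by (intro holomorphic_intros holomorphic_on_subset[OF zeta_right_holomorphic]
            holomorphic_on_subset[OF zeta_left_holomorphic]) auto
    show "connected ({s. Re s > -1} \<inter> {s. Re s < 0})"
      by (intro convex_connected convex_Int convex_halfspace_Re_gt convex_halfspace_Re_lt)
    show "of_real (-1/2) islimpt complex_of_real ` {-1<..<0}" by (intro islimpt_of_real_interval) auto
    show "open ({s. Re s > -1} \<inter> {s. Re s < 0})"
      by (intro open_Int open_halfspace_Re_gt open_halfspace_Re_lt)
  qed (use assms in \<open>auto simp: zeta_right_eq_left_real\<close>)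
  thus ?thesis by simp
qed

text \<open>The two expressions agree on the strip \<open>-1 < Re s < 0\<close>, so that together they form an entire function.\<close>
definition zeta_entire :: "complex \<Rightarrow> complex" where
  "zeta_entire s = (if Re s > -1 then zeta_right s else zeta_left s)"

lemma zeta_entire_holomorphic: "zeta_entire holomorphic_on A"
proof -
  have 1: "zeta_entire holomorphic_on {s. Re s > -1}"
    by (rule holomorphic_transform[OF zeta_right_holomorphic]) (simp add: zeta_entire_def)
  have 2: "zeta_entire holomorphic_on {s. Re s < 0}"
    by (rule holomorphic_transform[OF zeta_left_holomorphic]) (simp add: zeta_entire_def zeta_right_eq_left)
  have "zeta_entire holomorphic_on ({s. Re s > -1} \<union> {s. Re s < 0})"
    by (intro holomorphic_on_Un 1 2 open_halfspace_Re_gt open_halfspace_Re_lt)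
  also have "{s. Re s > -1} \<union> {s. Re s < 0} = UNIV" by auto
  finally show ?thesis by (rule holomorphic_on_subset) auto
qed

text \<open>The definite description of the zeta function denotes this quotient because, by the identity theorem,
  a function holomorphic off 1 is determined by its values on \<open>Re s > 1\<close>. At \<open>s = 1\<close> both sides are 0,
  the right-hand side since division by 0 gives 0.\<close>
theorem riemann_zeta_eq: "riemann_zeta s = zeta_entire s / (s - 1)"
proof -
  let ?P = "\<lambda>f. f holomorphic_on (- {1}) \<and>
      (\<forall>s. Re s > 1 \<longrightarrow> f s = (\<Sum>n. 1 / of_nat (Suc n) powr s)) \<and> f 1 = (0::complex)"
  have P: "?P (\<lambda>s. zeta_entire s / (s - 1))"
  proof (intro conjI allI impI)
    show "(\<lambda>s. zeta_entire s / (s - 1)) holomorphic_on - {1}"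
      by (intro holomorphic_intros zeta_entire_holomorphic) auto
    fix s :: complex assume s: "Re s > 1"
    hence "s \<noteq> 1" by auto
    thus "zeta_entire s / (s - 1) = (\<Sum>n. 1 / of_nat (Suc n) powr s)"
      using s zeta_right_eq_dirichlet[OF s] by (simp add: zeta_entire_def dirichlet_zeta_def)
  qed simp
  have "riemann_zeta = (\<lambda>s. zeta_entire s / (s - 1))"
    unfolding riemann_zeta_def
  proof (rule the_equality)
    show "?P (\<lambda>s. zeta_entire s / (s - 1))" by (rule P)
    fix f assume f: "?P f"
    have "f s = zeta_entire s / (s - 1)" if "s \<noteq> 1" for s
    proof (rule analytic_continuation_open[where s = "{s. Re s > 1}" and s' = "- {1}" and f = f
        and g = "\<lambda>s. zeta_entire s / (s - 1)" and z = s])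
      show "connected (- {1::complex})" by (intro connected_punctured_universe) simp
      have "2 \<in> {s. Re s > 1}" by simp
      thus "{s. Re s > 1} \<noteq> {}" by blast
      show "f z = zeta_entire z / (z - 1)" if "z \<in> {s. Re s > 1}" for z using P f that by simp
    qed (use f P that in \<open>auto simp: open_halfspace_Re_gt\<close>)
    hence "f s = zeta_entire s / (s - 1)" for s using f by (cases "s = 1") simp_all
    thus "f = (\<lambda>s. zeta_entire s / (s - 1))" by blast
  qed
  thus ?thesis by (rule fun_cong)
qed

lemma riemann_zeta_eq_dirichlet: "Re s > 1 \<Longrightarrow> riemann_zeta s = dirichlet_zeta s"
  using zeta_right_eq_dirichlet[of s] by (auto simp: riemann_zeta_eq zeta_entire_def)

lemma completed_zeta_reflection_left:
  assumes s: "Re s < 0" and ni: "s / 2 \<notin> \<int>\<^sub>\<le>\<^sub>0"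
  shows "completed_zeta (1 - s) = completed_zeta s"
proof -
  have "zeta_entire s = zeta_left s" using s by (simp add: zeta_entire_def zeta_right_eq_left)
  moreover have "s - 1 \<noteq> 0" using s by auto
  ultimately have z: "riemann_zeta s = of_real pi powr (s - 1/2) * Gamma ((1 - s) / 2) * rGamma (s / 2) * dirichlet_zeta (1 - s)"
    by (simp add: riemann_zeta_eq zeta_left_def)
  have g: "Gamma (s / 2) * rGamma (s / 2) = 1"
    using ni by (simp add: rGamma_inverse_Gamma Gamma_eq_zero_iff)
  have "completed_zeta s = (of_real pi powr (- s / 2) * of_real pi powr (s - 1/2)) * (Gamma (s / 2) * rGamma (s / 2)) * Gamma ((1 - s) / 2) * dirichlet_zeta (1 - s)"
    unfolding completed_zeta_def z by (simp only: mult_ac)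
  also have "complex_of_real pi powr (- s / 2) * of_real pi powr (s - 1/2) = of_real pi powr (- (1 - s) / 2)"
  proof -
    have "- s / 2 + (s - 1/2) = - (1 - s) / 2" by (simp add: field_simps)
    thus ?thesis by (simp only: powr_add[symmetric])
  qed
  finally show ?thesis using s by (simp add: g completed_zeta_def riemann_zeta_eq_dirichlet)
qed

lemma completed_zeta_holomorphic_off_Ints: "completed_zeta holomorphic_on - \<int>"
proof -
  have "s / 2 \<notin> \<int>\<^sub>\<le>\<^sub>0" if "s \<notin> \<int>" for s :: complex
  proof
    assume "s / 2 \<in> \<int>\<^sub>\<le>\<^sub>0"
    hence "2 * (s / 2) \<in> \<int>" by (intro Ints_mult) (auto dest: nonpos_Ints_Int)
    thus False using that by simp
  qed
  moreover have "s - 1 \<noteq> 0" if "s \<notin> \<int>" for s :: complex using that by auto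
  ultimately show ?thesis unfolding completed_zeta_def riemann_zeta_eq
    by (auto intro!: holomorphic_intros zeta_entire_holomorphic)
qed

text \<open>For \<open>Re s < 0\<close> this is the definition of \<open>zeta_left\<close>. The identity theorem extends it to the complement
  of the integers, which is connected since the integers are countable.\<close>
theorem completed_zeta_reflection:
  assumes "s \<notin> \<int>"
  shows "completed_zeta (1 - s) = completed_zeta s"
proof -
  have op: "open (- \<int> :: complex set)" by (simp add: closed_Ints open_Compl)
  have cn: "connected (- \<int> :: complex set)"
  proof (rule path_connected_imp_connected, rule path_connected_complement_countable)
    show "countable (\<int> :: complex set)" unfolding Ints_def by simp
  qed simp
  show ?thesis
  proof (rule analytic_continuation_open[where s = "- \<int> \<inter> {s. Re s < 0}" and s' = "- \<int>"
        and f = "\<lambda>s. completed_zeta (1 - s)" and g = completed_zeta and z = s])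
    have "Complex (-1) 1 \<notin> \<int>" by (auto elim!: Ints_cases simp: complex_eq_iff)
    hence "Complex (-1) 1 \<in> - \<int> \<inter> {s. Re s < 0}" by simp
    thus "- \<int> \<inter> {s::complex. Re s < 0} \<noteq> {}" by blast
    have "(completed_zeta \<circ> (\<lambda>s. 1 - s)) holomorphic_on - \<int>"
      by (rule holomorphic_on_compose_gen[OF _ completed_zeta_holomorphic_off_Ints])
         (auto intro!: holomorphic_intros)
    thus "(\<lambda>s. completed_zeta (1 - s)) holomorphic_on - \<int>" by (simp add: o_def)
    fix z :: complex assume z: "z \<in> - \<int> \<inter> {s. Re s < 0}"
    show "completed_zeta (1 - z) = completed_zeta z"
    proof (rule completed_zeta_reflection_left)
      show "z / 2 \<notin> \<int>\<^sub>\<le>\<^sub>0"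
      proof
        assume "z / 2 \<in> \<int>\<^sub>\<le>\<^sub>0"
        hence "2 * (z / 2) \<in> \<int>" by (intro Ints_mult) (auto dest: nonpos_Ints_Int)
        thus False using z by simp
      qed
    qed (use z in auto)
  qed (use assms op cn completed_zeta_holomorphic_off_Ints in \<open>auto intro: open_Int open_halfspace_Re_lt\<close>)
qed

section \<open>Zeros and singularities of the completed zeta function\<close>

text \<open>The function \<open>z \<xi>(1 + z)\<close> with its singularity at 0 removed; its value at 0 is the residue of the
  completed zeta function \<open>\<xi>\<close> at 1.\<close>
definition xi_reg :: "complex \<Rightarrow> complex" where
  "xi_reg z = of_real pi powr (- (1 + z) / 2) * Gamma ((1 + z) / 2) * zeta_entire (1 + z)"

lemma completed_zeta_near_1: "completed_zeta (1 + z) = xi_reg z / z"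
  by (simp add: completed_zeta_def xi_reg_def riemann_zeta_eq)

lemma xi_reg_holomorphic: "xi_reg holomorphic_on {z. Re z > -1}"
proof -
  have "(1 + z) / 2 \<notin> \<int>\<^sub>\<le>\<^sub>0" if "Re z > -1" for z
    using that by (auto elim!: nonpos_Ints_cases simp: complex_eq_iff)
  moreover have "(\<lambda>z. zeta_entire (1 + z)) holomorphic_on {z. Re z > -1}"
  proof -
    have "(zeta_entire \<circ> (\<lambda>z. 1 + z)) holomorphic_on {z. Re z > -1}"
      by (intro holomorphic_on_compose zeta_entire_holomorphic holomorphic_intros)
    thus ?thesis by (simp add: o_def)
  qed
  ultimately show ?thesis unfolding xi_reg_def by (auto intro!: holomorphic_intros)
qed

lemma completed_zeta_holomorphic_right: "completed_zeta holomorphic_on {z. Re z > 1}"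
proof -
  have "s / 2 \<notin> \<int>\<^sub>\<le>\<^sub>0" "s - 1 \<noteq> 0" if "Re s > 1" for s
    using that by (auto elim!: nonpos_Ints_cases simp: complex_eq_iff)
  thus ?thesis unfolding completed_zeta_def riemann_zeta_eq
    by (auto intro!: holomorphic_intros zeta_entire_holomorphic)
qed

lemma completed_zeta_nat_nonzero:
  assumes "h \<ge> (2::nat)"
  shows "completed_zeta (of_nat h) \<noteq> 0"
proof -
  have h: "real h > 1" using assms by simp
  have "0 < (\<Sum>n. 1 / real (Suc n) powr real h)"
    by (rule suminf_pos[OF summable_zeta_real[OF h]]) simp
  hence "dirichlet_zeta (of_real (real h)) \<noteq> 0" unfolding dirichlet_zeta_of_real[OF h] by simp
  hence "riemann_zeta (of_nat h) \<noteq> 0" using h by (subst riemann_zeta_eq_dirichlet) simp_all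
  moreover have "of_nat h / (2 :: complex) \<notin> \<int>\<^sub>\<le>\<^sub>0"
    using assms by (auto elim!: nonpos_Ints_cases simp: complex_eq_iff)
  ultimately show ?thesis by (simp add: completed_zeta_def Gamma_eq_zero_iff)
qed

lemma completed_zeta_meromorphic: "completed_zeta meromorphic_on A"
proof -
  have 1: "(\<lambda>s. of_real pi powr (- s / 2) :: complex) analytic_on UNIV"
    unfolding analytic_on_open[OF open_UNIV] by (auto intro!: holomorphic_intros)
  have 2: "(\<lambda>s. Gamma (s / 2) :: complex) meromorphic_on UNIV"
  proof -
    have "(\<lambda>s::complex. rGamma (s / 2)) analytic_on UNIV"
      unfolding analytic_on_open[OF open_UNIV] by (auto intro!: holomorphic_intros)
    hence "(\<lambda>s::complex. inverse (rGamma (s / 2))) meromorphic_on UNIV"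
      by (intro meromorphic_on_inverse analytic_on_imp_meromorphic_on)
    thus ?thesis by (simp add: Gamma_def)
  qed
  have 3: "zeta_entire analytic_on UNIV"
    unfolding analytic_on_open[OF open_UNIV] by (rule zeta_entire_holomorphic)
  have "completed_zeta meromorphic_on UNIV"
    unfolding completed_zeta_def[abs_def] riemann_zeta_eq
    by (intro meromorphic_on_mult meromorphic_on_divide 2
         analytic_on_imp_meromorphic_on[OF 1] analytic_on_imp_meromorphic_on[OF 3] meromorphic_on_diff meromorphic_on_id meromorphic_on_const)
  thus ?thesis by (rule meromorphic_on_subset) auto
qed

text \<open>Values of the completed zeta function enter the period as numerators and as denominators; at these
  arguments both kinds of factors are analytic and nonzero.\<close>
definition xi_good :: "complex set" where
  "xi_good = {z. completed_zeta analytic_on {z} \<and> completed_zeta z \<noteq> 0}"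

lemma xi_goodI:
  assumes "completed_zeta holomorphic_on U" "open U" "z \<in> U" "completed_zeta z \<noteq> 0"
  shows "z \<in> xi_good"
  using assms unfolding xi_good_def by (auto simp: analytic_at)

lemma nat_in_xi_good: "h \<ge> 2 \<Longrightarrow> of_nat h \<in> xi_good"
  by (rule xi_goodI[OF completed_zeta_holomorphic_right open_halfspace_Re_gt])
     (auto simp: completed_zeta_nat_nonzero)

lemma open_xi_good: "open xi_good"
proof (rule openI)
  fix z assume "z \<in> xi_good"
  then obtain U where U: "open U" "z \<in> U" "completed_zeta holomorphic_on U" and nz: "completed_zeta z \<noteq> 0"
    by (auto simp: xi_good_def analytic_at)
  have "open (U \<inter> completed_zeta -` (- {0}))"
    by (intro continuous_open_preimage holomorphic_on_imp_continuous_on U) auto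
  moreover have "z \<in> U \<inter> completed_zeta -` (- {0})" using U nz by simp
  moreover have "U \<inter> completed_zeta -` (- {0}) \<subseteq> xi_good" using U xi_goodI by auto
  ultimately obtain e where "e > 0" "ball z e \<subseteq> xi_good" by (meson open_contains_ball subset_trans)
  thus "\<exists>T>0. ball z T \<subseteq> xi_good" by auto
qed

lemma completed_zeta_holomorphic_good: "completed_zeta holomorphic_on xi_good"
proof -
  have "completed_zeta analytic_on xi_good"
    by (subst analytic_on_analytic_at) (auto simp: xi_good_def)
  thus ?thesis by (rule analytic_imp_holomorphic)
qed

lemma eventually_xi_good: "eventually (\<lambda>z. z \<in> xi_good) (cosparse UNIV)"
proof -
  have "eventually (\<lambda>z. completed_zeta analytic_on {z}) (cosparse UNIV)"
    by (rule meromorphic_on_imp_analytic_cosparse[OF completed_zeta_meromorphic])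
  moreover have "eventually (\<lambda>z. completed_zeta z \<noteq> 0) (cosparse UNIV)"
  proof -
    have "\<not> eventually (\<lambda>z. completed_zeta z = 0) (cosparse UNIV)"
    proof
      assume "eventually (\<lambda>z. completed_zeta z = 0) (cosparse UNIV)"
      hence "eventually (\<lambda>z. completed_zeta z = 0) (at 2)"
        by (rule eventually_cosparse_imp_eventually_at) simp
      moreover have "2 \<in> xi_good" using nat_in_xi_good[of 2] by simp
      hence "eventually (\<lambda>z. z \<in> xi_good) (at 2)" using open_xi_good by (rule eventually_at_in_open'[rotated])
      ultimately have "eventually (\<lambda>z::complex. False) (at 2)"
        by eventually_elim (auto simp: xi_good_def)
      thus False by simp
    qed
    thus ?thesis
      using meromorphic_imp_constant_or_avoid[OF completed_zeta_meromorphic[of UNIV], of 0] by auto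
  qed
  ultimately show ?thesis unfolding xi_good_def by eventually_elim auto
qed

section \<open>Iterated residues\<close>

text \<open>Taking the residue in one coordinate retains the terms that have this coordinate in the denominator
  and sets it to zero in what remains of them. The result has the same form in the other coordinates,
  so that the residues can be taken one after the other.\<close>
lemma iterated_residue_simple_poles:
  fixes G :: "'w \<Rightarrow> (nat \<Rightarrow> complex) \<Rightarrow> complex" and A :: "'w \<Rightarrow> nat set"
  assumes "finite \<Omega>" "distinct ks" "e > 0"
    and U: "\<And>s k z. s \<in> U \<Longrightarrow> k \<in> set ks \<Longrightarrow> norm z < e \<Longrightarrow> s(k := z) \<in> U"
    and hol: "\<And>w s k. w \<in> \<Omega> \<Longrightarrow> s \<in> U \<Longrightarrow> k \<in> set ks \<Longrightarrow> (\<lambda>z. G w (s(k := z))) holomorphic_on ball 0 e"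
    and F: "\<And>s. s \<in> U \<Longrightarrow> (\<forall>k\<in>set ks. s k \<noteq> 0) \<Longrightarrow>
              F s = (\<Sum>w\<in>\<Omega>. G w s / (\<Prod>k\<in>A w \<inter> set ks. s k))"
    and s: "s \<in> U"
  shows "iterated_residue ks F s =
    (\<Sum>w | w \<in> \<Omega> \<and> set ks \<subseteq> A w. G w (\<lambda>k. if k \<in> set ks then 0 else s k))"
  using assms
proof (induction ks arbitrary: F G \<Omega>)
  case Nil
  thus ?case by simp
next
  case (Cons k ks)
  define \<Omega>' where "\<Omega>' = {w \<in> \<Omega>. k \<in> A w}"
  define G' where "G' = (\<lambda>w s. G w (s(k := 0)))"
  define F' where "F' = (\<lambda>s. residue (\<lambda>z. F (s(k := z))) 0)"
  have k: "k \<notin> set ks" using Cons.prems by simp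
  have step: "F' t = (\<Sum>w\<in>\<Omega>'. G' w t / (\<Prod>j\<in>A w \<inter> set ks. t j))"
    if t: "t \<in> U" and nz: "\<forall>j\<in>set ks. t j \<noteq> 0" for t
  proof -
    define f where "f z = (\<Sum>w\<in>\<Omega>. G w (t(k := z)) * (if k \<in> A w then 1 else z) / (\<Prod>j\<in>A w \<inter> set ks. t j))" for z
    have "F (t(k := z)) = f z / (z - 0)" if z: "z \<noteq> 0" "norm z < e" for z
    proof -
      have "F (t(k := z)) = (\<Sum>w\<in>\<Omega>. G w (t(k := z)) / (\<Prod>j\<in>A w \<inter> set (k # ks). (t(k := z)) j))"
      proof (rule Cons.prems(6))
        show "t(k := z) \<in> U" by (rule Cons.prems(4)[OF t]) (use z in auto)
        show "\<forall>j\<in>set (k # ks). (t(k := z)) j \<noteq> 0" using z nz by simp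
      qed
      also have "\<dots> = (\<Sum>w\<in>\<Omega>. G w (t(k := z)) * (if k \<in> A w then 1 else z) / (\<Prod>j\<in>A w \<inter> set ks. t j) / z)"
      proof (rule sum.cong[OF refl])
        fix w
        have *: "(\<Prod>j\<in>A w \<inter> set ks. (t(k := z)) j) = (\<Prod>j\<in>A w \<inter> set ks. t j)"
          using k by (intro prod.cong) auto
        show "G w (t(k := z)) / (\<Prod>j\<in>A w \<inter> set (k # ks). (t(k := z)) j) =
            G w (t(k := z)) * (if k \<in> A w then 1 else z) / (\<Prod>j\<in>A w \<inter> set ks. t j) / z"
        proof (cases "k \<in> A w")
          case True
          hence "A w \<inter> set (k # ks) = insert k (A w \<inter> set ks)" by auto
          thus ?thesis using True k z * by (simp add: mult.commute)
        next
          case False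
          hence "A w \<inter> set (k # ks) = A w \<inter> set ks" by auto
          thus ?thesis using False z by (simp only: *) simp
        qed
      qed
      finally show ?thesis unfolding f_def by (simp add: sum_divide_distrib)
    qed
    moreover have "eventually (\<lambda>z. z \<in> ball 0 e - {0}) (at (0::complex))"
      using Cons.prems(3) by (intro eventually_at_in_open) auto
    ultimately have "eventually (\<lambda>z. F (t(k := z)) = f z / (z - 0)) (at 0)"
      by (auto elim!: eventually_mono)
    hence "F' t = residue (\<lambda>z. f z / (z - 0)) 0" unfolding F'_def by (intro residue_cong) auto
    also have "\<dots> = f 0"
    proof (rule residue_simple)
      show "f holomorphic_on ball 0 e" unfolding f_def
      proof (intro holomorphic_intros)
        show "(\<lambda>z. G w (t(k := z))) holomorphic_on ball 0 e" if "w \<in> \<Omega>" for w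
          by (rule Cons.prems(5)[OF that t]) simp
        show "(\<lambda>z. if k \<in> A w then 1 else z) holomorphic_on ball 0 e" for w
          by (cases "k \<in> A w") (auto intro!: holomorphic_intros)
      qed (use nz in simp)
    qed (use Cons.prems(3) in auto)
    also have "\<dots> = (\<Sum>w\<in>\<Omega>. if k \<in> A w then G' w t / (\<Prod>j\<in>A w \<inter> set ks. t j) else 0)"
      unfolding f_def G'_def by (intro sum.cong) auto
    also have "\<dots> = (\<Sum>w\<in>\<Omega>'. G' w t / (\<Prod>j\<in>A w \<inter> set ks. t j))"
      unfolding \<Omega>'_def using Cons.prems(1) by (subst sum.inter_filter) auto
    finally show ?thesis .
  qed
  have "iterated_residue (k # ks) F s = iterated_residue ks F' s" by (simp add: F'_def)
  also have "\<dots> = (\<Sum>w | w \<in> \<Omega>' \<and> set ks \<subseteq> A w. G' w (\<lambda>j. if j \<in> set ks then 0 else s j))"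
  proof (rule Cons.IH)
    show "(\<lambda>z. G' w (t(j := z))) holomorphic_on ball 0 e" if "w \<in> \<Omega>'" "t \<in> U" "j \<in> set ks" for w t j
    proof -
      have "t(k := 0) \<in> U" by (rule Cons.prems(4)[OF that(2)]) (use Cons.prems(3) in auto)
      hence "(\<lambda>z. G w ((t(k := 0))(j := z))) holomorphic_on ball 0 e"
        by (rule Cons.prems(5)[rotated]) (use that in \<open>auto simp: \<Omega>'_def\<close>)
      moreover have "(t(k := 0))(j := z) = (t(j := z))(k := 0)" for z using k that by (auto simp: fun_eq_iff)
      ultimately show ?thesis unfolding G'_def by simp
    qed
  qed (use Cons.prems step in \<open>auto simp: \<Omega>'_def\<close>)
  also have "\<dots> = (\<Sum>w | w \<in> \<Omega> \<and> set (k # ks) \<subseteq> A w. G w (\<lambda>j. if j \<in> set (k # ks) then 0 else s j))"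
  proof (rule sum.cong)
    have "(\<lambda>j. if j \<in> set ks then 0 else s j)(k := 0) = (\<lambda>j. if j \<in> set (k # ks) then 0 else s j)"
      by auto
    thus "G' w (\<lambda>j. if j \<in> set ks then 0 else s j) = G w (\<lambda>j. if j \<in> set (k # ks) then 0 else s j)" for w
      unfolding G'_def by simp
  qed (auto simp: \<Omega>'_def)
  finally show ?case .
qed

section \<open>Root systems and Weyl groups\<close>

lemma linear_reflection: "linear (reflection a)"
  unfolding reflection_def by (intro linearI) (auto simp: inner_add_left scaleR_add_left algebra_simps)

lemma inner_coroot_self: "a \<noteq> 0 \<Longrightarrow> a \<bullet> coroot a = 2"
  by (simp add: coroot_def)

lemma coroot_coroot: "coroot (coroot a) = a"
proof (cases "a = 0")
  case False
  hence "a \<bullet> a \<noteq> 0" by simp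
  thus ?thesis by (simp add: coroot_def)
qed (simp add: coroot_def)

lemma coroot_uminus: "coroot (- a) = - coroot a"
  by (simp add: coroot_def)

lemma inner_coroot_scaleR: "(v \<bullet> coroot a) *\<^sub>R a = (v \<bullet> a) *\<^sub>R coroot a"
  by (simp add: coroot_def)

lemma reflection_self: "a \<noteq> 0 \<Longrightarrow> reflection a a = - a"
  by (simp add: reflection_def inner_coroot_self scaleR_2)

lemma reflection_reflection: "a \<noteq> 0 \<Longrightarrow> reflection a (reflection a v) = v"
  by (simp add: reflection_def inner_coroot_self algebra_simps)

lemma reflection_inner: "a \<noteq> 0 \<Longrightarrow> reflection a u \<bullet> reflection a v = u \<bullet> v"
proof -
  assume "a \<noteq> 0"
  hence n: "a \<bullet> a \<noteq> 0" by simp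
  have "reflection a u \<bullet> reflection a v = u \<bullet> v - (v \<bullet> coroot a) * (u \<bullet> a) - (u \<bullet> coroot a) * (a \<bullet> v)
     + (u \<bullet> coroot a) * (v \<bullet> coroot a) * (a \<bullet> a)"
    unfolding reflection_def by (simp add: inner_diff_left inner_diff_right algebra_simps)
  thus ?thesis using n by (simp add: coroot_def inner_commute)
qed

text \<open>Most of the reindexing below is along a map that permutes a set of roots.\<close>
lemma image_Collect_stable:
  assumes "f ` A = A"
  shows "f ` {x \<in> A. P (f x)} = {x \<in> A. P x}"
proof -
  have "f ` {x \<in> A. P (f x)} = {x \<in> f ` A. P x}" by auto
  thus ?thesis by (simp only: assms)
qed

lemma reflection_involution_comp: "a \<noteq> 0 \<Longrightarrow> reflection a \<circ> reflection a = id"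
  by (simp add: fun_eq_iff reflection_reflection)

text \<open>The index set of the simple roots depends only on the type of the ambient space; as a parameter it
  has a short name.\<close>
locale based_root_system =
  fixes \<Phi> :: "'a::euclidean_space set" and \<alpha> :: "nat \<Rightarrow> 'a" and II :: "nat set"
  assumes rs: "root_system \<Phi>" and fs: "fundamental_system \<Phi> \<alpha>"
    and II_def: "II = indices TYPE('a)"
begin

lemmas simple_roots_II = simple_roots_def[of \<alpha>, folded II_def]
  and pos_roots_II = pos_roots_def[of \<Phi> \<alpha>, folded II_def]
  and fund_weight_II = fund_weight_def[of \<alpha>, folded II_def]
  and weight_point_II = weight_point_def[of \<Phi> \<alpha>, folded II_def]
  and parabolic_period_II = parabolic_period_def[of \<Phi> \<alpha>, folded II_def]
  and dynkin_aut_II = dynkin_aut_def[of \<alpha>, folded II_def]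

abbreviation "Pos \<equiv> pos_roots \<Phi> \<alpha>"
abbreviation "Neg \<equiv> neg_roots \<Phi> \<alpha>"
abbreviation "W \<equiv> weyl_group \<Phi>"
abbreviation "Inv \<equiv> inversions \<Phi> \<alpha>"
abbreviation "Adm \<equiv> admissible \<Phi> \<alpha>"
abbreviation "Simple \<equiv> simple_roots \<alpha>"
abbreviation "s i \<equiv> reflection (\<alpha> i)"

lemma finite_II [simp]: "finite II" and card_II: "card II = DIM('a)"
  by (simp_all add: II_def indices_def)

lemma finite_roots: "finite \<Phi>" and roots_nonzero: "0 \<notin> \<Phi>" and span_roots: "span \<Phi> = UNIV"
  and reflection_roots: "a \<in> \<Phi> \<Longrightarrow> reflection a ` \<Phi> = \<Phi>"
  and root_coroot_int: "a \<in> \<Phi> \<Longrightarrow> b \<in> \<Phi> \<Longrightarrow> b \<bullet> coroot a \<in> \<int>"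
  and reduced: "a \<in> \<Phi> \<Longrightarrow> c *\<^sub>R a \<in> \<Phi> \<Longrightarrow> c = 1 \<or> c = -1"
  using rs unfolding root_system_def by blast+

lemma inj_simple: "inj_on \<alpha> II" and simple_in_roots: "i \<in> II \<Longrightarrow> \<alpha> i \<in> \<Phi>"
  and independent_simple: "independent (\<alpha> ` II)" and roots_eq: "\<Phi> = Pos \<union> Neg"
  using fs unfolding fundamental_system_def simple_roots_II II_def[symmetric] by blast+

lemma root_nonzero: "a \<in> \<Phi> \<Longrightarrow> a \<noteq> 0" using roots_nonzero by blast

lemma reflection_root: "a \<in> \<Phi> \<Longrightarrow> b \<in> \<Phi> \<Longrightarrow> reflection a b \<in> \<Phi>"
  using reflection_roots by blast

lemma uminus_root: "a \<in> \<Phi> \<Longrightarrow> - a \<in> \<Phi>"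
  using reflection_root[of a a] root_nonzero reflection_self by metis

lemma span_simple: "span (\<alpha> ` II) = UNIV"
proof -
  have "card (\<alpha> ` II) = DIM('a)" using card_image[OF inj_simple] card_II by simp
  hence "UNIV \<subseteq> span (\<alpha> ` II)"
    by (intro card_ge_dim_independent independent_simple) auto
  thus ?thesis by auto
qed

definition coef :: "'a \<Rightarrow> nat \<Rightarrow> real" where
  "coef v i = representation (\<alpha> ` II) v (\<alpha> i)"

lemma coef_add: "coef (u + v) i = coef u i + coef v i"
  and coef_scale: "coef (c *\<^sub>R v) i = c * coef v i"
  and coef_diff: "coef (u - v) i = coef u i - coef v i"
  and coef_uminus: "coef (- v) i = - coef v i"
proof -
  note r = independent_simple
  have sp: "x \<in> span (\<alpha> ` II)" for x using span_simple by simp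
  show "coef (u + v) i = coef u i + coef v i" unfolding coef_def by (simp add: representation_add[OF r sp sp])
  show "coef (c *\<^sub>R v) i = c * coef v i" unfolding coef_def by (simp add: representation_scale[OF r sp])
  show "coef (u - v) i = coef u i - coef v i" unfolding coef_def by (simp add: representation_diff[OF r sp sp])
  show "coef (- v) i = - coef v i" unfolding coef_def by (simp add: representation_neg[OF r sp])
qed

lemma linear_coef: "linear (\<lambda>v. coef v i)"
  by (intro linearI) (auto simp: coef_add coef_scale)

lemma coef_sum: "coef (\<Sum>x\<in>A. f x) i = (\<Sum>x\<in>A. coef (f x) i)"
  using linear_sum[OF linear_coef, of f A i] .

lemma coef_simple: "i \<in> II \<Longrightarrow> j \<in> II \<Longrightarrow> coef (\<alpha> j) i = (if i = j then 1 else 0)"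
  unfolding coef_def using inj_simple
  by (subst representation_basis[OF independent_simple]) (auto dest: inj_onD)

lemma coef_lincomb: "i \<in> II \<Longrightarrow> coef (\<Sum>j\<in>II. c j *\<^sub>R \<alpha> j) i = c i"
  by (simp add: coef_sum coef_scale coef_simple if_distrib[of "(*) _"] cong: if_cong)

text \<open>The simple roots are as many as the dimension and independent, hence a basis.\<close>
lemma coef_expand: "v = (\<Sum>i\<in>II. coef v i *\<^sub>R \<alpha> i)"
proof -
  have "v \<in> span (\<alpha> ` II)" using span_simple by simp
  then obtain u where "v = (\<Sum>x\<in>\<alpha> ` II. u x *\<^sub>R x)" by (auto simp: span_finite)
  hence v: "v = (\<Sum>i\<in>II. u (\<alpha> i) *\<^sub>R \<alpha> i)" by (simp add: sum.reindex[OF inj_simple])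
  have "coef v i = u (\<alpha> i)" if "i \<in> II" for i using coef_lincomb[OF that, of "\<lambda>i. u (\<alpha> i)"] v by simp
  thus ?thesis using v by simp
qed

lemma coef_eqI: "(\<And>i. i \<in> II \<Longrightarrow> coef u i = coef v i) \<Longrightarrow> u = v"
  using coef_expand[of u] coef_expand[of v] by simp

lemma pos_roots_iff: "b \<in> Pos \<longleftrightarrow> b \<in> \<Phi> \<and> (\<forall>i\<in>II. coef b i \<in> \<nat>)"
proof
  assume "b \<in> Pos"
  then obtain c :: "nat \<Rightarrow> nat" where "b \<in> \<Phi>" "b = (\<Sum>i\<in>II. real (c i) *\<^sub>R \<alpha> i)"
    by (auto simp: pos_roots_II)
  thus "b \<in> \<Phi> \<and> (\<forall>i\<in>II. coef b i \<in> \<nat>)" by (auto simp: coef_lincomb)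
next
  assume b: "b \<in> \<Phi> \<and> (\<forall>i\<in>II. coef b i \<in> \<nat>)"
  hence "\<forall>i\<in>II. \<exists>n::nat. coef b i = real n" by (auto elim!: Nats_cases)
  then obtain c where "\<forall>i\<in>II. coef b i = real (c i)" by metis
  hence "b = (\<Sum>i\<in>II. real (c i) *\<^sub>R \<alpha> i)" using coef_expand[of b] by simp
  thus "b \<in> Pos" using b by (auto simp: pos_roots_II)
qed

lemma pos_root: "b \<in> Pos \<Longrightarrow> b \<in> \<Phi>" by (simp add: pos_roots_iff)
lemma finite_Pos [simp]: "finite Pos" using finite_roots pos_root by (auto intro: finite_subset)
lemma coef_pos_nonneg: "b \<in> Pos \<Longrightarrow> i \<in> II \<Longrightarrow> coef b i \<ge> 0"
  by (auto simp: pos_roots_iff elim!: Nats_cases)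
lemma neg_roots_iff: "b \<in> Neg \<longleftrightarrow> - b \<in> Pos"
  by (auto simp: neg_roots_def image_iff) (metis minus_minus)
lemma root_cases: "b \<in> \<Phi> \<Longrightarrow> b \<in> Pos \<or> - b \<in> Pos"
  using roots_eq neg_roots_iff by auto

lemma exists_coef_nonzero: "b \<noteq> 0 \<Longrightarrow> \<exists>i\<in>II. coef b i \<noteq> 0"
  using coef_expand[of b] by (metis (no_types, lifting) scaleR_eq_0_iff sum.neutral)

lemma exists_coef_pos: "b \<in> Pos \<Longrightarrow> \<exists>i\<in>II. coef b i > 0"
  using exists_coef_nonzero[of b] coef_pos_nonneg[of b] root_nonzero[OF pos_root, of b] by force

lemma pos_root_by_coef: "b \<in> \<Phi> \<Longrightarrow> i \<in> II \<Longrightarrow> coef b i > 0 \<Longrightarrow> b \<in> Pos"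
  using root_cases[of b] coef_pos_nonneg[of "- b" i] by (auto simp: coef_uminus)

lemma not_pos_and_neg: "b \<in> Pos \<Longrightarrow> - b \<notin> Pos"
  using exists_coef_pos[of b] coef_pos_nonneg[of "- b"] by (force simp: coef_uminus)

lemma not_pos_iff: "b \<in> \<Phi> \<Longrightarrow> b \<notin> Pos \<longleftrightarrow> - b \<in> Pos"
  using root_cases not_pos_and_neg by blast

lemma simple_pos: "i \<in> II \<Longrightarrow> \<alpha> i \<in> Pos"
  using pos_root_by_coef[of "\<alpha> i" i] simple_in_roots by (simp add: coef_simple)

lemma simple_nonzero: "i \<in> II \<Longrightarrow> \<alpha> i \<noteq> 0"
  using simple_in_roots root_nonzero by blast

lemma coef_reflection: "i \<in> II \<Longrightarrow> j \<in> II \<Longrightarrow> coef (s i v) j = coef v j - (if i = j then v \<bullet> coroot (\<alpha> i) else 0)"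
  by (auto simp: reflection_def coef_diff coef_scale coef_simple)

text \<open>Otherwise \<open>b\<close> is a multiple of \<open>\<alpha> i\<close>, and the root system is reduced.\<close>
lemma pos_root_other_coef:
  assumes "b \<in> Pos" "i \<in> II" "b \<noteq> \<alpha> i"
  shows "\<exists>j\<in>II - {i}. coef b j > 0"
proof (rule ccontr)
  assume "\<not> ?thesis"
  hence "coef b j = 0" if "j \<in> II - {i}" for j using coef_pos_nonneg[OF assms(1)] that by force
  hence "b = coef b i *\<^sub>R \<alpha> i" using assms(2)
    by (intro coef_eqI) (auto simp: coef_scale coef_simple)
  moreover from this have "coef b i = 1 \<or> coef b i = -1"
    using reduced[of "\<alpha> i" "coef b i"] simple_in_roots[OF assms(2)] pos_root[OF assms(1)] by simp
  moreover have "coef b i \<ge> 0" using coef_pos_nonneg assms by auto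
  ultimately show False using assms(3) by auto
qed

text \<open>The reflection changes only the \<open>i\<close>-th coordinate, and some other coordinate of \<open>b\<close> is positive; a root
  with one positive coordinate is positive.\<close>
lemma simple_reflection_pos:
  assumes "b \<in> Pos" "i \<in> II" "b \<noteq> \<alpha> i"
  shows "s i b \<in> Pos"
proof -
  obtain j where j: "j \<in> II" "j \<noteq> i" "coef b j > 0" using pos_root_other_coef[OF assms] by auto
  have "coef (s i b) j > 0" using j assms by (simp add: coef_reflection)
  thus ?thesis using j assms reflection_root simple_in_roots pos_root by (intro pos_root_by_coef) auto
qed

lemma simple_reflection_neq: "b \<in> Pos \<Longrightarrow> i \<in> II \<Longrightarrow> s i b \<noteq> \<alpha> i"
proof
  assume b: "b \<in> Pos" "i \<in> II" and "s i b = \<alpha> i"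
  hence "b = - \<alpha> i"
    using reflection_reflection[OF simple_nonzero[OF b(2)], of b] reflection_self[OF simple_nonzero[OF b(2)]] by simp
  thus False using b not_pos_and_neg simple_pos by metis
qed

lemma weyl_linear: "w \<in> W \<Longrightarrow> linear w"
proof (induction rule: weyl_group.induct)
  case weyl_id show ?case by (simp add: id_def linear_iff)
next
  case (weyl_step a w) thus ?case using linear_compose linear_reflection by blast
qed

lemma weyl_inner: "w \<in> W \<Longrightarrow> w u \<bullet> w v = u \<bullet> v"
  by (induction arbitrary: u v rule: weyl_group.induct) (auto simp: reflection_inner root_nonzero)

lemma weyl_roots: "w \<in> W \<Longrightarrow> w ` \<Phi> = \<Phi>"
proof (induction rule: weyl_group.induct)
  case (weyl_step a w)
  have "(reflection a \<circ> w) ` \<Phi> = reflection a ` (w ` \<Phi>)" by (simp only: image_comp)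
  thus ?case using weyl_step reflection_roots by simp
qed simp

lemma weyl_root: "w \<in> W \<Longrightarrow> a \<in> \<Phi> \<Longrightarrow> w a \<in> \<Phi>" using weyl_roots by blast

lemma weyl_comp: "w \<in> W \<Longrightarrow> v \<in> W \<Longrightarrow> w \<circ> v \<in> W"
  by (induction rule: weyl_group.induct) (auto simp: comp_assoc intro: weyl_group.intros)

lemma weyl_reflection: "a \<in> \<Phi> \<Longrightarrow> reflection a \<in> W"
  using weyl_group.weyl_step[OF _ weyl_group.weyl_id] by simp

lemma weyl_inj: "w \<in> W \<Longrightarrow> inj w"
proof (rule injI)
  fix x y assume w: "w \<in> W" "w x = w y"
  hence "w (x - y) = 0" using linear_diff[OF weyl_linear[OF w(1)]] by simp
  hence "(x - y) \<bullet> (x - y) = 0" using weyl_inner[OF w(1), of "x - y" "x - y"] by simp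
  thus "x = y" by simp
qed

lemma weyl_has_inverse: "w \<in> W \<Longrightarrow> \<exists>v\<in>W. v \<circ> w = id \<and> w \<circ> v = id"
proof (induction rule: weyl_group.induct)
  case weyl_id show ?case using weyl_group.weyl_id by (intro bexI[of _ id]) auto
next
  case (weyl_step a w)
  then obtain v where v: "v \<in> W" "v \<circ> w = id" "w \<circ> v = id" by blast
  have r: "reflection a \<circ> reflection a = id" using weyl_step root_nonzero reflection_involution_comp by blast
  have "(v \<circ> reflection a) \<circ> (reflection a \<circ> w) = v \<circ> (reflection a \<circ> reflection a) \<circ> w"
    by (simp only: comp_assoc)
  moreover have "(reflection a \<circ> w) \<circ> (v \<circ> reflection a) = reflection a \<circ> (w \<circ> v) \<circ> reflection a"
    by (simp only: comp_assoc)
  ultimately have "(v \<circ> reflection a) \<circ> (reflection a \<circ> w) = id"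
      "(reflection a \<circ> w) \<circ> (v \<circ> reflection a) = id"
    using v r by (simp_all only: comp_id id_comp)
  moreover have "v \<circ> reflection a \<in> W" using v weyl_step weyl_comp weyl_reflection by blast
  ultimately show ?case by blast
qed

lemma weyl_inv: assumes "w \<in> W" shows "inv w \<in> W" "w (inv w x) = x" "inv w (w x) = x"
proof -
  obtain v where v: "v \<in> W" "v \<circ> w = id" "w \<circ> v = id" using weyl_has_inverse[OF assms] by blast
  have iv: "inv w = v" using v by (metis inv_unique_comp)
  show "inv w \<in> W" using v iv by simp
  show "w (inv w x) = x" "inv w (w x) = x" using fun_cong[OF v(2), of x] fun_cong[OF v(3), of x] by (simp_all add: iv)
qed

lemma weyl_bij: "w \<in> W \<Longrightarrow> bij w"
  by (metis bijI' weyl_inv(2) weyl_inv(3))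

lemma weyl_uminus: "w \<in> W \<Longrightarrow> w (- x) = - w x" using linear_neg[OF weyl_linear] .

lemma weyl_coroot: "w \<in> W \<Longrightarrow> coroot (w a) = w (coroot a)"
  by (simp add: coroot_def weyl_inner linear_scale[OF weyl_linear])

lemma weyl_inner_inv: "w \<in> W \<Longrightarrow> u \<bullet> w v = inv w u \<bullet> v"
  by (metis weyl_inner weyl_inv(2))

text \<open>An element of the group is determined by the permutation that it induces on the finite spanning
  set of roots.\<close>
lemma finite_weyl: "finite W"
proof (rule finite_imageD[where f = "\<lambda>w. restrict w \<Phi>"])
  have "(\<lambda>w. restrict w \<Phi>) ` W \<subseteq> \<Phi> \<rightarrow>\<^sub>E \<Phi>" using weyl_root by auto
  thus "finite ((\<lambda>w. restrict w \<Phi>) ` W)" using finite_PiE[OF finite_roots, of "\<lambda>_. \<Phi>"] finite_roots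
    by (meson finite_subset)
  show "inj_on (\<lambda>w. restrict w \<Phi>) W"
  proof (rule inj_onI)
    fix v w assume vw: "v \<in> W" "w \<in> W" "restrict v \<Phi> = restrict w \<Phi>"
    have "v x = w x" if "x \<in> \<Phi>" for x using vw(3) that by (metis restrict_apply')
    hence "v x = w x" for x
      using linear_eq_on_span[OF weyl_linear[OF vw(1)] weyl_linear[OF vw(2)], of \<Phi>] span_roots by auto
    thus "v = w" by auto
  qed
qed

section \<open>Longest elements of parabolic subgroups\<close>

text \<open>The parabolic subgroup generated by the simple reflections with indices in \<open>J\<close>, built up from the right
  because the construction of the longest element multiplies on the right.\<close>
inductive_set simple_group :: "nat set \<Rightarrow> ('a \<Rightarrow> 'a) set" for J where
  simple_id: "id \<in> simple_group J"
| simple_step: "w \<in> simple_group J \<Longrightarrow> i \<in> J \<Longrightarrow> w \<circ> s i \<in> simple_group J"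

lemma simple_group_weyl:
  assumes "J \<subseteq> II" "w \<in> simple_group J"
  shows "w \<in> W"
  using assms(2)
proof (induction rule: simple_group.induct)
  case (simple_step w i)
  thus ?case using assms(1) by (intro weyl_comp weyl_reflection simple_in_roots) auto
qed (rule weyl_group.weyl_id)

lemma simple_group_left: "w \<in> simple_group J \<Longrightarrow> i \<in> J \<Longrightarrow> s i \<circ> w \<in> simple_group J"
proof (induction rule: simple_group.induct)
  case simple_id
  show ?case using simple_group.simple_step[OF simple_group.simple_id simple_id] by simp
next
  case (simple_step w k)
  hence "(s i \<circ> w) \<circ> s k \<in> simple_group J" by (intro simple_group.simple_step)
  thus ?case by (simp only: comp_assoc)
qed

lemma simple_group_coef:
  assumes "w \<in> simple_group J" "J \<subseteq> II" "j \<in> II - J"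
  shows "coef (w v) j = coef v j"
  using assms(1)
proof (induction arbitrary: v rule: simple_group.induct)
  case (simple_step w i)
  hence "coef ((w \<circ> s i) v) j = coef (s i v) j" by simp
  also have "\<dots> = coef v j" using simple_step assms by (subst coef_reflection) auto
  finally show ?case .
qed simp

text \<open>The positive roots of the standard Levi subgroup with simple roots \<open>\<alpha> j\<close>, \<open>j \<in> J\<close>.\<close>
definition levi_pos :: "nat set \<Rightarrow> 'a set" where
  "levi_pos J = {b \<in> Pos. \<forall>j\<in>II - J. coef b j = 0}"

lemma levi_pos_all: "levi_pos II = Pos" by (auto simp: levi_pos_def)
lemma finite_levi_pos [simp]: "finite (levi_pos J)" by (simp add: levi_pos_def)
lemma levi_pos_pos: "b \<in> levi_pos J \<Longrightarrow> b \<in> Pos" by (simp add: levi_pos_def)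
lemma simple_levi_pos: "J \<subseteq> II \<Longrightarrow> i \<in> J \<Longrightarrow> \<alpha> i \<in> levi_pos J"
  by (auto simp: levi_pos_def simple_pos coef_simple)

text \<open>An element with the largest number of inversions does it: if it maps \<open>\<alpha> i\<close> to a positive root, then
  multiplying it on the right by \<open>s i\<close> preserves the existing inversions up to \<open>s i\<close> and adds \<open>\<alpha> i\<close>.\<close>
lemma longest_makes_simple_negative:
  assumes J: "J \<subseteq> II"
  shows "\<exists>w\<in>simple_group J. \<forall>i\<in>J. - w (\<alpha> i) \<in> Pos"
proof -
  let ?N = "\<lambda>w. {b \<in> Pos. - w b \<in> Pos}"
  have "\<exists>w. w \<in> simple_group J \<and> (\<forall>v. v \<in> simple_group J \<longrightarrow> card (?N v) \<le> card (?N w))"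
  proof (rule ex_has_greatest_nat)
    show "id \<in> simple_group J" by (rule simple_group.simple_id)
    show "\<forall>v. v \<in> simple_group J \<longrightarrow> card (?N v) < Suc (card Pos)"
      by (auto intro!: card_mono simp: less_Suc_eq_le)
  qed
  then obtain w where w: "w \<in> simple_group J" and max: "\<And>v. v \<in> simple_group J \<Longrightarrow> card (?N v) \<le> card (?N w)"
    by blast
  have wW: "w \<in> W" using simple_group_weyl[OF J w] .
  have "- w (\<alpha> i) \<in> Pos" if i: "i \<in> J" for i
  proof (rule ccontr)
    have iI: "i \<in> II" using J i by auto
    assume "- w (\<alpha> i) \<notin> Pos"
    hence p: "w (\<alpha> i) \<in> Pos"
      using root_cases[OF weyl_root[OF wW simple_in_roots[OF iI]]] by auto
    have si: "s i (s i v) = v" for v by (rule reflection_reflection[OF simple_nonzero[OF iI]])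
    have neg: "s i (\<alpha> i) = - \<alpha> i" by (rule reflection_self[OF simple_nonzero[OF iI]])
    have ne: "b \<noteq> \<alpha> i" if "b \<in> ?N w" for b using that p not_pos_and_neg by auto
    have sub: "insert (\<alpha> i) (s i ` ?N w) \<subseteq> ?N (w \<circ> s i)"
    proof (intro insert_subsetI subsetI)
      show "\<alpha> i \<in> ?N (w \<circ> s i)"
        using p simple_pos[OF iI] weyl_uminus[OF wW, of "\<alpha> i"] by (simp add: neg)
      fix x assume "x \<in> s i ` ?N w"
      then obtain b where "x = s i b" "b \<in> ?N w" by auto
      moreover from this have "s i b \<in> Pos" using simple_reflection_pos[OF _ iI ne] by blast
      ultimately show "x \<in> ?N (w \<circ> s i)" using si by simp
    qed
    have "\<alpha> i \<notin> s i ` ?N w"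
    proof
      assume "\<alpha> i \<in> s i ` ?N w"
      then obtain b where "s i b = \<alpha> i" "b \<in> Pos" by (metis (no_types, lifting) imageE mem_Collect_eq)
      thus False using simple_reflection_neq[OF _ iI] by blast
    qed
    hence "card (insert (\<alpha> i) (s i ` ?N w)) = Suc (card (s i ` ?N w))" by simp
    also have "card (s i ` ?N w) = card (?N w)"
    proof (rule card_image, rule inj_onI)
      fix x y assume "s i x = s i y"
      hence "s i (s i x) = s i (s i y)" by simp
      thus "x = y" by (simp only: si)
    qed
    finally have "Suc (card (?N w)) \<le> card (?N (w \<circ> s i))"
      using card_mono[OF _ sub] by simp
    moreover have "card (?N (w \<circ> s i)) \<le> card (?N w)"
      by (intro max simple_group.simple_step w i)
    ultimately show False by simp
  qed
  thus ?thesis using w by blast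
qed

text \<open>The longest element of the parabolic subgroup of \<open>J\<close>, described by its action on the roots and on the
  coordinates outside \<open>J\<close> instead of by its length.\<close>
definition is_longest :: "nat set \<Rightarrow> ('a \<Rightarrow> 'a) \<Rightarrow> bool" where
  "is_longest J w \<longleftrightarrow> w \<in> W \<and> (\<lambda>b. - w b) ` levi_pos J = levi_pos J \<and>
     w ` (Pos - levi_pos J) = Pos - levi_pos J \<and>
     (\<lambda>b. - w b) ` (\<alpha> ` J) = \<alpha> ` J \<and>
     (\<forall>v. \<forall>j\<in>II - J. coef (w v) j = coef v j)"

lemma sum_Nats_eq_1:
  fixes c :: "'b \<Rightarrow> real"
  assumes "finite A" "\<And>x. x \<in> A \<Longrightarrow> c x \<in> \<nat>" "sum c A \<le> 1" "x \<in> A" "c x \<noteq> 0"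
  shows "c x = 1 \<and> (\<forall>y\<in>A - {x}. c y = 0)"
proof -
  have nn: "c y \<ge> 0" if "y \<in> A" for y using assms(2)[OF that] by (auto elim!: Nats_cases)
  have "c x \<ge> 1" using assms(2)[OF assms(4)] assms(5) by (auto elim!: Nats_cases)
  moreover have s: "sum c A = c x + sum c (A - {x})" using assms by (intro sum.remove) auto
  moreover have "sum c (A - {x}) \<ge> 0" by (intro sum_nonneg) (auto simp: nn)
  ultimately have "c x = 1" "sum c (A - {x}) = 0" using assms(3) by linarith+
  thus ?thesis using assms(1) nn by (subst (asm) sum_nonneg_eq_0_iff) auto
qed

text \<open>An element making the simple roots of \<open>J\<close> negative makes all their nonnegative combinations negative
  and keeps the coordinates outside \<open>J\<close>. That \<open>- w\<close> permutes the simple roots follows by comparing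
  coordinate sums: \<open>\<alpha> i\<close> is a combination, with the coordinates of \<open>- w (\<alpha> i)\<close> as coefficients, of roots
  whose coordinate sums are at least 1, so these coefficients sum to at most 1.\<close>
lemma longest_exists:
  assumes J: "J \<subseteq> II"
  shows "\<exists>w. is_longest J w"
proof -
  obtain w where w: "w \<in> simple_group J" and neg: "\<And>i. i \<in> J \<Longrightarrow> - w (\<alpha> i) \<in> Pos"
    using longest_makes_simple_negative[OF J] by blast
  have wW: "w \<in> W" using simple_group_weyl[OF J w] .
  have keep: "coef (w v) j = coef v j" if "j \<in> II - J" for v j
    using simple_group_coef[OF w J that] .
  have fJ: "finite J" using J finite_II by (rule finite_subset)
  have injw: "inj w" using weyl_inj[OF wW] .
  have expand: "b = (\<Sum>j\<in>J. coef b j *\<^sub>R \<alpha> j)" if "b \<in> levi_pos J" for b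
  proof -
    have "b = (\<Sum>j\<in>II. coef b j *\<^sub>R \<alpha> j)" by (rule coef_expand)
    also have "\<dots> = (\<Sum>j\<in>J. coef b j *\<^sub>R \<alpha> j)"
      using that J by (intro sum.mono_neutral_right) (auto simp: levi_pos_def)
    finally show ?thesis .
  qed
  have to_neg: "- w b \<in> levi_pos J" if b: "b \<in> levi_pos J" for b
  proof -
    have "- w b \<in> \<Phi>" using b weyl_root[OF wW] uminus_root by (auto simp: levi_pos_def pos_root)
    have "- w b = (\<Sum>j\<in>J. coef b j *\<^sub>R (- w (\<alpha> j)))"
      by (subst (1) expand[OF b]) (simp add: linear_sum[OF weyl_linear[OF wW]] linear_scale[OF weyl_linear[OF wW]] sum_negf)
    hence "coef (- w b) i = (\<Sum>j\<in>J. coef b j * coef (- w (\<alpha> j)) i)" for i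
      by (simp only: coef_sum coef_scale)
    moreover have "coef b j * coef (- w (\<alpha> j)) i \<ge> 0" if "i \<in> II" "j \<in> J" for i j
      using coef_pos_nonneg[OF levi_pos_pos[OF b], of j] coef_pos_nonneg[OF neg[OF that(2)] that(1)] that(2) J
      by (intro mult_nonneg_nonneg) auto
    ultimately have "coef (- w b) i \<ge> 0" if "i \<in> II" for i
      using that by (simp add: sum_nonneg)
    moreover obtain i where "i \<in> II" "coef (- w b) i \<noteq> 0"
      using exists_coef_nonzero root_nonzero[OF \<open>- w b \<in> \<Phi>\<close>] by blast
    ultimately have "- w b \<in> Pos" using pos_root_by_coef[OF \<open>- w b \<in> \<Phi>\<close>, of i] by force
    moreover have "coef (- w b) j = 0" if "j \<in> II - J" for j
      using b keep[OF that] that by (simp add: coef_uminus levi_pos_def)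
    ultimately show ?thesis by (simp add: levi_pos_def)
  qed
  have surj1: "(\<lambda>b. - w b) ` levi_pos J = levi_pos J"
  proof (rule endo_inj_surj)
    show "(\<lambda>b. - w b) ` levi_pos J \<subseteq> levi_pos J" using to_neg by blast
    show "inj_on (\<lambda>b. - w b) (levi_pos J)" using injw by (auto simp: inj_on_def inj_def)
  qed simp
  have surj2: "w ` (Pos - levi_pos J) = Pos - levi_pos J"
  proof (rule endo_inj_surj)
    show "w ` (Pos - levi_pos J) \<subseteq> Pos - levi_pos J"
    proof (intro subsetI)
      fix x assume "x \<in> w ` (Pos - levi_pos J)"
      then obtain b where b: "x = w b" "b \<in> Pos" "b \<notin> levi_pos J" by auto
      then obtain j where j: "j \<in> II - J" "coef b j \<noteq> 0" by (auto simp: levi_pos_def)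
      hence "coef x j > 0" using b coef_pos_nonneg[of b j] keep[OF j(1)] by force
      moreover have "x \<in> \<Phi>" using b weyl_root[OF wW] pos_root by simp
      ultimately show "x \<in> Pos - levi_pos J" using j pos_root_by_coef[of x j] by (force simp: levi_pos_def)
    qed
    show "inj_on w (Pos - levi_pos J)" using injw by (rule inj_on_subset) auto
  qed simp
  have "- w (\<alpha> i) \<in> \<alpha> ` J" if i: "i \<in> J" for i
  proof -
    define b where "b = - w (\<alpha> i)"
    have b: "b \<in> levi_pos J" unfolding b_def by (intro to_neg simple_levi_pos J i)
    have "\<forall>j\<in>J. \<exists>g. g \<in> levi_pos J \<and> \<alpha> j = - w g"
    proof
      fix j assume "j \<in> J"
      hence "\<alpha> j \<in> (\<lambda>b. - w b) ` levi_pos J" unfolding surj1 by (rule simple_levi_pos[OF J])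
      thus "\<exists>g. g \<in> levi_pos J \<and> \<alpha> j = - w g" by auto
    qed
    from bchoice[OF this] obtain g where g: "\<And>j. j \<in> J \<Longrightarrow> g j \<in> levi_pos J"
      "\<And>j. j \<in> J \<Longrightarrow> \<alpha> j = - w (g j)" by blast
    have "w (\<alpha> i) = w (\<Sum>j\<in>J. coef b j *\<^sub>R g j)"
    proof -
      have "w (\<alpha> i) = - b" by (simp add: b_def)
      also have "b = (\<Sum>j\<in>J. coef b j *\<^sub>R \<alpha> j)" by (rule expand[OF b])
      also have "\<dots> = (\<Sum>j\<in>J. coef b j *\<^sub>R - w (g j))"
        by (rule sum.cong[OF refl]) (simp only: g(2))
      also have "- \<dots> = w (\<Sum>j\<in>J. coef b j *\<^sub>R g j)"
        by (simp add: linear_sum[OF weyl_linear[OF wW]] linear_scale[OF weyl_linear[OF wW]] sum_negf)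
      finally show ?thesis .
    qed
    hence a: "\<alpha> i = (\<Sum>j\<in>J. coef b j *\<^sub>R g j)" using injw by (simp add: inj_eq)
    have ht: "(\<Sum>k\<in>II. coef x k) \<ge> 1" if "x \<in> Pos" for x
    proof -
      obtain k where k: "k \<in> II" "coef x k > 0" using exists_coef_pos[OF \<open>x \<in> Pos\<close>] by auto
      hence "coef x k \<ge> 1" using that by (auto simp: pos_roots_iff elim!: Nats_cases dest!: bspec)
      also have "coef x k \<le> (\<Sum>k\<in>II. coef x k)"
        using that k by (intro member_le_sum) (auto intro: coef_pos_nonneg)
      finally show ?thesis .
    qed
    have bnat: "coef b j \<in> \<nat>" if "j \<in> J" for j using b that J by (auto simp: levi_pos_def pos_roots_iff)
    have "(\<Sum>j\<in>J. coef b j) \<le> (\<Sum>j\<in>J. coef b j * (\<Sum>k\<in>II. coef (g j) k))"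
    proof (intro sum_mono)
      fix j assume j: "j \<in> J"
      have "coef b j * 1 \<le> coef b j * (\<Sum>k\<in>II. coef (g j) k)"
        using ht[OF levi_pos_pos[OF g(1)[OF j]]] bnat[OF j] by (intro mult_left_mono) (auto elim!: Nats_cases)
      thus "coef b j \<le> coef b j * (\<Sum>k\<in>II. coef (g j) k)" by simp
    qed
    also have "\<dots> = (\<Sum>k\<in>II. coef (\<alpha> i) k)"
    proof -
      have "(\<Sum>k\<in>II. coef (\<alpha> i) k) = (\<Sum>k\<in>II. \<Sum>j\<in>J. coef b j * coef (g j) k)"
        by (subst a) (simp add: coef_sum coef_scale)
      also have "\<dots> = (\<Sum>j\<in>J. \<Sum>k\<in>II. coef b j * coef (g j) k)" by (rule sum.swap)
      finally show ?thesis by (simp only: sum_distrib_left)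
    qed
    also have "\<dots> = 1" using i J by (simp add: coef_simple subset_iff)
    finally have le: "(\<Sum>j\<in>J. coef b j) \<le> 1" .
    have "\<exists>j\<in>J. coef b j \<noteq> 0"
    proof (rule ccontr)
      assume "\<not> ?thesis"
      hence "(\<Sum>j\<in>J. coef b j *\<^sub>R \<alpha> j) = 0" by simp
      hence "b = 0" by (subst expand[OF b])
      thus False using root_nonzero[OF pos_root[OF levi_pos_pos[OF b]]] by simp
    qed
    then obtain j where j: "j \<in> J" "coef b j \<noteq> 0" by blast
    have c: "coef b j = 1 \<and> (\<forall>k\<in>J - {j}. coef b k = 0)"
      using sum_Nats_eq_1[OF fJ bnat le j] .
    have "b = (\<Sum>k\<in>J. coef b k *\<^sub>R \<alpha> k)" by (rule expand[OF b])
    also have "\<dots> = coef b j *\<^sub>R \<alpha> j + (\<Sum>k\<in>J - {j}. coef b k *\<^sub>R \<alpha> k)"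
      using fJ j by (intro sum.remove)
    also have "\<dots> = \<alpha> j" using c by simp
    finally show ?thesis using j by (simp add: b_def)
  qed
  hence "(\<lambda>b. - w b) ` (\<alpha> ` J) \<subseteq> \<alpha> ` J" by blast
  moreover have "inj_on (\<lambda>b. - w b) (\<alpha> ` J)" using injw by (auto simp: inj_on_def inj_def)
  ultimately have "(\<lambda>b. - w b) ` (\<alpha> ` J) = \<alpha> ` J"
    by (intro endo_inj_surj finite_imageI fJ)
  hence "is_longest J w" unfolding is_longest_def by (intro conjI ballI allI wW surj1 surj2 keep)
  thus ?thesis by blast
qed

section \<open>Conjugacy to simple roots\<close>

text \<open>Since \<open>b \<bullet> b > 0\<close>, the root \<open>b\<close> has a positive inner product with some simple root \<open>\<alpha> i\<close>, and \<open>s i\<close> lowers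
  the sum of its coordinates.\<close>
lemma pos_root_induct [consumes 1, case_names simple step]:
  assumes "b \<in> Pos"
    and simple: "\<And>i. i \<in> II \<Longrightarrow> P (\<alpha> i)"
    and step: "\<And>b i. b \<in> Pos \<Longrightarrow> i \<in> II \<Longrightarrow> P b \<Longrightarrow> P (s i b)"
  shows "P b"
  using assms(1)
proof (induction "nat \<lfloor>\<Sum>k\<in>II. coef b k\<rfloor>" arbitrary: b rule: less_induct)
  case (less b)
  show ?case
  proof (cases "b \<in> \<alpha> ` II")
    case True thus ?thesis using simple by auto
  next
    case False
    have "0 < b \<bullet> b" using root_nonzero[OF pos_root[OF less(2)]] by simp
    also have "b \<bullet> b = (\<Sum>i\<in>II. coef b i * (b \<bullet> \<alpha> i))"
      by (subst (2) coef_expand) (simp add: inner_sum_right)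
    finally obtain i where i: "i \<in> II" "coef b i * (b \<bullet> \<alpha> i) > 0"
      by (metis (no_types, lifting) not_le sum_nonpos)
    hence pos: "b \<bullet> \<alpha> i > 0" using coef_pos_nonneg[OF less(2) i(1)] by (simp add: zero_less_mult_iff)
    define b' where "b' = s i b"
    have b': "b' \<in> Pos" unfolding b'_def using less(2) i False by (intro simple_reflection_pos) auto
    have c: "b \<bullet> coroot (\<alpha> i) > 0" using pos simple_nonzero[OF i(1)] by (simp add: coroot_def)
    have "b \<bullet> coroot (\<alpha> i) \<in> \<int>" using less(2) i by (intro root_coroot_int simple_in_roots pos_root)
    then obtain m :: int where m: "b \<bullet> coroot (\<alpha> i) = real_of_int m" by (auto elim!: Ints_cases)
    have "(\<Sum>k\<in>II. coef b' k) = (\<Sum>k\<in>II. coef b k) - real_of_int m"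
      using i(1) unfolding b'_def by (simp add: coef_reflection sum_subtractf m)
    moreover have "m \<ge> 1" using c m by simp
    moreover have "(\<Sum>k\<in>II. coef b' k) \<ge> 0" using b' by (intro sum_nonneg coef_pos_nonneg)
    ultimately have "nat \<lfloor>\<Sum>k\<in>II. coef b' k\<rfloor> < nat \<lfloor>\<Sum>k\<in>II. coef b k\<rfloor>"
      by linarith
    hence "P (s i b')" using less(1)[OF _ b'] step[OF b' i(1)] by blast
    thus ?thesis by (simp add: b'_def reflection_reflection[OF simple_nonzero[OF i(1)]])
  qed
qed

lemma pos_root_conjugate_simple:
  assumes "b \<in> Pos"
  shows "\<exists>w\<in>simple_group II. \<exists>i\<in>II. b = w (\<alpha> i)"
  using assms
proof (induction rule: pos_root_induct)
  case (simple i)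
  thus ?case by (intro bexI[of _ id] bexI[of _ i]) (auto intro: simple_group.simple_id)
next
  case (step b i)
  then obtain w j where "w \<in> simple_group II" "j \<in> II" "b = w (\<alpha> j)" by blast
  thus ?case using simple_group_left[OF _ step(2)]
    by (intro bexI[of _ "s i \<circ> w"] bexI[of _ j]) auto
qed

lemma root_conjugate_simple:
  assumes "b \<in> \<Phi>"
  shows "\<exists>w\<in>simple_group II. \<exists>i\<in>II. b = w (\<alpha> i)"
proof (cases "b \<in> Pos")
  case True thus ?thesis by (rule pos_root_conjugate_simple)
next
  case False
  hence "- b \<in> Pos" using root_cases assms by auto
  then obtain w i where wi: "w \<in> simple_group II" "i \<in> II" "- b = w (\<alpha> i)"
    using pos_root_conjugate_simple by blast
  have "(w \<circ> s i) (\<alpha> i) = - w (\<alpha> i)"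
    using reflection_self[OF simple_nonzero[OF wi(2)]] weyl_uminus[OF simple_group_weyl[OF order.refl wi(1)]] by simp
  also have "\<dots> = b" using wi(3) by (metis minus_minus)
  finally show ?thesis using wi simple_group.simple_step[OF wi(1,2)] by metis
qed

section \<open>Fundamental weights and heights of coroots\<close>

abbreviation "wt \<equiv> fund_weight \<alpha>"
abbreviation "\<rho> \<equiv> half_sum \<Phi> \<alpha>"

lemma weight_eqI:
  assumes "\<And>i. i \<in> II \<Longrightarrow> coroot (\<alpha> i) \<bullet> u = coroot (\<alpha> i) \<bullet> v"
  shows "u = v"
proof -
  have "\<alpha> i \<bullet> (u - v) = 0" if "i \<in> II" for i
    using assms[OF that] simple_nonzero[OF that] by (simp add: coroot_def inner_diff_right)
  hence "(\<Sum>i\<in>II. coef (u - v) i *\<^sub>R \<alpha> i) \<bullet> (u - v) = 0" by (simp add: inner_sum_left)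
  hence "(u - v) \<bullet> (u - v) = 0" by (simp flip: coef_expand)
  thus ?thesis by simp
qed

text \<open>The \<open>j\<close>-th coordinate, suitably scaled, is a linear functional with the required values; the adjoint
  represents it by a vector, which is unique because the simple coroots span.\<close>
lemma fund_weight_coroot: "i \<in> II \<Longrightarrow> coroot (\<alpha> i) \<bullet> wt j = (if i = j then 1 else 0)"
proof -
  assume i: "i \<in> II"
  let ?P = "\<lambda>v. \<forall>i\<in>II. coroot (\<alpha> i) \<bullet> v = (if i = j then 1 else 0)"
  have "\<exists>v. ?P v"
  proof (cases "j \<in> II")
    case True
    define f where "f v = coef v j * ((\<alpha> j \<bullet> \<alpha> j) / 2)" for v
    have lf: "linear f" unfolding f_def by (intro linearI) (auto simp: coef_add coef_scale algebra_simps)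
    have "coroot (\<alpha> i) \<bullet> adjoint f 1 = (if i = j then 1 else 0)" if "i \<in> II" for i
    proof -
      have "coroot (\<alpha> i) \<bullet> adjoint f 1 = f (coroot (\<alpha> i))"
        using adjoint_works[OF lf, of "coroot (\<alpha> i)" 1] by simp
      also have "\<dots> = (if i = j then 1 else 0)"
        using that True simple_nonzero[OF that] by (auto simp: f_def coroot_def coef_scale coef_simple)
      finally show ?thesis .
    qed
    thus ?thesis by blast
  next
    case False
    thus ?thesis by (intro exI[of _ 0]) auto
  qed
  moreover have "u = v" if "?P u" "?P v" for u v
  proof (rule weight_eqI)
    fix i assume "i \<in> II"
    thus "coroot (\<alpha> i) \<bullet> u = coroot (\<alpha> i) \<bullet> v" using that by simp
  qed
  ultimately have "\<exists>!v. ?P v" by (rule ex_ex1I)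
  from theI'[OF this] show ?thesis using i unfolding fund_weight_II by simp
qed

lemma fund_weight_inner: "j \<in> II \<Longrightarrow> wt j \<bullet> v = coef v j * (\<alpha> j \<bullet> \<alpha> j) / 2"
proof -
  assume j: "j \<in> II"
  have a: "wt j \<bullet> \<alpha> i = (if i = j then (\<alpha> j \<bullet> \<alpha> j) / 2 else 0)" if "i \<in> II" for i
    using fund_weight_coroot[OF that, of j] simple_nonzero[OF that]
    by (auto simp: coroot_def inner_commute field_simps split: if_splits)
  have "wt j \<bullet> v = wt j \<bullet> (\<Sum>i\<in>II. coef v i *\<^sub>R \<alpha> i)" by (simp only: coef_expand[symmetric])
  also have "\<dots> = (\<Sum>i\<in>II. if i = j then coef v j * (\<alpha> j \<bullet> \<alpha> j) / 2 else 0)"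
    unfolding inner_sum_right by (intro sum.cong) (auto simp: a)
  also have "\<dots> = coef v j * (\<alpha> j \<bullet> \<alpha> j) / 2" using j by simp
  finally show ?thesis .
qed

lemma coroot_expand: "v = (\<Sum>j\<in>II. (wt j \<bullet> v) *\<^sub>R coroot (\<alpha> j))"
proof -
  have "(\<Sum>j\<in>II. (wt j \<bullet> v) *\<^sub>R coroot (\<alpha> j)) = (\<Sum>j\<in>II. coef v j *\<^sub>R \<alpha> j)"
  proof (rule sum.cong[OF refl])
    fix j assume j: "j \<in> II"
    show "(wt j \<bullet> v) *\<^sub>R coroot (\<alpha> j) = coef v j *\<^sub>R \<alpha> j"
      using simple_nonzero[OF j] by (simp add: fund_weight_inner[OF j] coroot_def)
  qed
  also have "\<dots> = v" by (rule coef_expand[symmetric])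
  finally show ?thesis by (rule sym)
qed

lemma weight_coroot_sign:
  assumes "j \<in> II" "a \<in> \<Phi>"
  shows "wt j \<bullet> coroot a = coef a j * ((\<alpha> j \<bullet> \<alpha> j) / (a \<bullet> a))"
  by (simp add: fund_weight_inner[OF assms(1)] coroot_def coef_scale)

text \<open>Coroots are integral combinations of simple coroots: a simple reflection \<open>s i\<close> changes a coroot by an
  integral multiple of the coroot of \<open>\<alpha> i\<close>.\<close>
lemma weight_coroot_int_pos:
  assumes "b \<in> Pos" "j \<in> II"
  shows "wt j \<bullet> coroot b \<in> \<int>"
  using assms(1)
proof (induction rule: pos_root_induct)
  case (simple i)
  thus ?case using fund_weight_coroot[of i j] by (simp add: inner_commute)
next
  case (step b i)
  have "s i \<in> W" using step by (intro weyl_reflection simple_in_roots)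
  hence "coroot (s i b) = s i (coroot b)" by (rule weyl_coroot)
  also have "\<dots> = coroot b - (coroot b \<bullet> \<alpha> i) *\<^sub>R coroot (\<alpha> i)"
    by (simp add: reflection_def inner_coroot_scaleR)
  finally have "wt j \<bullet> coroot (s i b) = wt j \<bullet> coroot b - (coroot b \<bullet> \<alpha> i) * (wt j \<bullet> coroot (\<alpha> i))"
    by (simp add: inner_diff_right)
  moreover have "coroot b \<bullet> \<alpha> i \<in> \<int>"
    using root_coroot_int[OF pos_root[OF step(1)] simple_in_roots[OF step(2)]] by (simp add: inner_commute)
  moreover have "wt j \<bullet> coroot (\<alpha> i) \<in> \<int>" using fund_weight_coroot[OF step(2), of j] by (simp add: inner_commute)
  ultimately show ?case using step(3) by simp
qed

lemma weight_coroot_nat: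
  assumes "b \<in> Pos" "j \<in> II"
  shows "wt j \<bullet> coroot b \<in> \<nat>"
proof -
  have "wt j \<bullet> coroot b \<ge> 0" using coef_pos_nonneg[OF assms] 
    by (simp add: weight_coroot_sign[OF assms(2) pos_root[OF assms(1)]])
  thus ?thesis using weight_coroot_int_pos[OF assms] by (auto elim!: Ints_cases simp: Nats_altdef2)
qed

lemma weight_coroot_eq_0_iff: "j \<in> II \<Longrightarrow> a \<in> \<Phi> \<Longrightarrow> wt j \<bullet> coroot a = 0 \<longleftrightarrow> coef a j = 0"
  using root_nonzero[of a] simple_nonzero[of j] by (simp add: weight_coroot_sign)

definition levi_half_sum :: "nat set \<Rightarrow> 'a" where
  "levi_half_sum J = (1/2) *\<^sub>R (\<Sum>a\<in>levi_pos J. a)"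

lemma half_sum_eq_levi: "\<rho> = levi_half_sum II"
  by (simp add: half_sum_def levi_half_sum_def levi_pos_all)

text \<open>The reflection \<open>s i\<close> permutes the positive roots of the Levi subgroup other than \<open>\<alpha> i\<close>, so that their sum
  is orthogonal to \<open>\<alpha> i\<close>.\<close>
lemma levi_half_sum_simple:
  assumes J: "J \<subseteq> II" and i: "i \<in> J"
  shows "levi_half_sum J \<bullet> coroot (\<alpha> i) = 1"
proof -
  have iI: "i \<in> II" using J i by auto
  let ?R = "levi_pos J - {\<alpha> i}"
  have "s i ` ?R = ?R"
  proof (rule endo_inj_surj)
    show "s i ` ?R \<subseteq> ?R"
    proof (intro subsetI)
      fix x assume "x \<in> s i ` ?R"
      then obtain b where b: "x = s i b" "b \<in> levi_pos J" "b \<noteq> \<alpha> i" by auto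
      have "x \<in> Pos" using b iI levi_pos_pos simple_reflection_pos by simp
      moreover have "x \<noteq> \<alpha> i" using b iI levi_pos_pos simple_reflection_neq by simp
      moreover have "coef x j = 0" if "j \<in> II - J" for j
        using b that iI i by (auto simp: coef_reflection levi_pos_def)
      ultimately show "x \<in> ?R" by (simp add: levi_pos_def)
    qed
    show "inj_on (s i) ?R"
      using weyl_inj[OF weyl_reflection[OF simple_in_roots[OF iI]]] by (rule inj_on_subset) auto
  qed simp
  moreover have "inj_on (s i) ?R"
    using weyl_inj[OF weyl_reflection[OF simple_in_roots[OF iI]]] by (rule inj_on_subset) auto
  ultimately have "(\<Sum>a\<in>?R. a) = (\<Sum>a\<in>?R. s i a)"
    using sum.reindex[of "s i" ?R "\<lambda>a. a"] by (simp only: o_def)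
  also have "\<dots> = s i (\<Sum>a\<in>?R. a)" by (simp add: linear_sum[OF linear_reflection])
  finally have "((\<Sum>a\<in>?R. a) \<bullet> coroot (\<alpha> i)) *\<^sub>R \<alpha> i = 0" by (simp add: reflection_def)
  hence "(\<Sum>a\<in>?R. a) \<bullet> coroot (\<alpha> i) = 0" using simple_nonzero[OF iI] by simp
  moreover have "(\<Sum>a\<in>levi_pos J. a) = \<alpha> i + (\<Sum>a\<in>?R. a)"
    by (rule sum.remove) (simp_all add: simple_levi_pos J i)
  ultimately show ?thesis using inner_coroot_self[OF simple_nonzero[OF iI]]
    by (simp add: levi_half_sum_def inner_add_left)
qed

lemma rho_simple: "i \<in> II \<Longrightarrow> \<rho> \<bullet> coroot (\<alpha> i) = 1"
  using levi_half_sum_simple[OF order.refl] by (simp add: half_sum_eq_levi)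

abbreviation "ht \<equiv> coroot_height \<Phi> \<alpha>"

lemma height_eq_sum: "ht a = (\<Sum>j\<in>II. wt j \<bullet> coroot a)"
proof -
  have "ht a = \<rho> \<bullet> (\<Sum>j\<in>II. (wt j \<bullet> coroot a) *\<^sub>R coroot (\<alpha> j))"
    unfolding coroot_height_def by (simp only: coroot_expand[symmetric])
  thus ?thesis by (simp add: inner_sum_right rho_simple)
qed

lemma height_simple: "i \<in> II \<Longrightarrow> ht (\<alpha> i) = 1"
  by (simp add: coroot_height_def rho_simple)

lemma height_uminus: "ht (- a) = - ht a"
  by (simp add: coroot_height_def coroot_uminus)

lemma weight_coroot_nonneg: "b \<in> Pos \<Longrightarrow> j \<in> II \<Longrightarrow> wt j \<bullet> coroot b \<ge> 0"
  using weight_coroot_nat[of b j] by (auto elim!: Nats_cases)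

lemma height_nat:
  assumes "b \<in> Pos"
  shows "ht b \<in> \<nat>"
proof -
  have "(\<Sum>j\<in>A. wt j \<bullet> coroot b) \<in> \<nat>" if "A \<subseteq> II" for A
    using finite_subset[OF that finite_II] that
    by (induction A rule: finite_induct) (use weight_coroot_nat[OF assms] in auto)
  thus ?thesis unfolding height_eq_sum by blast
qed

lemma height_ge_1:
  assumes "b \<in> Pos"
  shows "ht b \<ge> 1"
proof -
  obtain j where j: "j \<in> II" "coef b j > 0" using exists_coef_pos[OF assms] by auto
  hence "wt j \<bullet> coroot b \<noteq> 0" using weight_coroot_eq_0_iff[OF j(1) pos_root[OF assms]] by simp
  hence "wt j \<bullet> coroot b \<ge> 1" using weight_coroot_nat[OF assms j(1)] by (auto elim!: Nats_cases)
  also have "\<dots> \<le> ht b" unfolding height_eq_sum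
    using j weight_coroot_nonneg[OF assms] by (intro member_le_sum) auto
  finally show ?thesis .
qed

lemma height_eq_1:
  assumes "b \<in> Pos" "ht b = 1"
  shows "b \<in> \<alpha> ` II"
proof -
  obtain j where j: "j \<in> II" "coef b j > 0" using exists_coef_pos[OF assms(1)] by auto
  hence "wt j \<bullet> coroot b \<noteq> 0" using weight_coroot_eq_0_iff[OF j(1) pos_root[OF assms(1)]] by simp
  hence c: "wt j \<bullet> coroot b = 1 \<and> (\<forall>k\<in>II - {j}. wt k \<bullet> coroot b = 0)"
    using j(1) assms weight_coroot_nat[OF assms(1)] by (intro sum_Nats_eq_1) (auto simp: height_eq_sum)
  have "coroot b = (\<Sum>k\<in>II. (wt k \<bullet> coroot b) *\<^sub>R coroot (\<alpha> k))" by (rule coroot_expand)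
  also have "\<dots> = (wt j \<bullet> coroot b) *\<^sub>R coroot (\<alpha> j) + (\<Sum>k\<in>II - {j}. (wt k \<bullet> coroot b) *\<^sub>R coroot (\<alpha> k))"
    using j(1) by (intro sum.remove) auto
  also have "\<dots> = coroot (\<alpha> j)" using c by simp
  finally have "coroot (coroot b) = coroot (coroot (\<alpha> j))" by simp
  thus ?thesis using j by (simp add: coroot_coroot)
qed

text \<open>In the half sum, \<open>w\<close> changes the sign of the contribution of the Levi subgroup and fixes the rest.\<close>
lemma longest_rho:
  assumes "J \<subseteq> II" "is_longest J w"
  shows "w \<rho> = \<rho> - 2 *\<^sub>R levi_half_sum J"
proof -
  have w: "w \<in> W" and n: "(\<lambda>b. - w b) ` levi_pos J = levi_pos J"
    and q: "w ` (Pos - levi_pos J) = Pos - levi_pos J" using assms(2) by (auto simp: is_longest_def)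
  note lw = weyl_linear[OF w]
  have sub: "levi_pos J \<subseteq> Pos" using levi_pos_pos by blast
  have 1: "(\<Sum>b\<in>levi_pos J. - w b) = (\<Sum>b\<in>levi_pos J. b)"
    by (rule sum.reindex_cong[symmetric, of "\<lambda>b. - w b"])
       (use weyl_inj[OF w] n in \<open>auto simp: inj_on_def inj_def\<close>)
  have 2: "(\<Sum>b\<in>Pos - levi_pos J. w b) = (\<Sum>b\<in>Pos - levi_pos J. b)"
    by (rule sum.reindex_cong[symmetric, of w])
       (use weyl_inj[OF w] q in \<open>auto simp: inj_on_def inj_def\<close>)
  have S: "(\<Sum>b\<in>Pos. b) = (\<Sum>b\<in>Pos - levi_pos J. b) + (\<Sum>b\<in>levi_pos J. b)"
    using sub by (intro sum.subset_diff) auto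
  have "w (\<Sum>b\<in>Pos. b) = (\<Sum>b\<in>Pos - levi_pos J. w b) - (\<Sum>b\<in>levi_pos J. - w b)"
    unfolding S by (simp add: linear_add[OF lw] linear_sum[OF lw] sum_negf)
  also have "\<dots> = (\<Sum>b\<in>Pos. b) - 2 *\<^sub>R (\<Sum>b\<in>levi_pos J. b)"
    unfolding 1 2 S by (simp add: scaleR_2)
  finally have "(1/2) *\<^sub>R w (\<Sum>b\<in>Pos. b) = (1/2) *\<^sub>R ((\<Sum>b\<in>Pos. b) - 2 *\<^sub>R (\<Sum>b\<in>levi_pos J. b))"
    by (simp only:)
  thus ?thesis
    by (simp add: half_sum_def levi_half_sum_def linear_scale[OF lw] scaleR_diff_right)
qed

lemma longest_inner_weight:
  assumes "is_longest J w" "j \<in> II - J"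
  shows "wt j \<bullet> w v = wt j \<bullet> v"
  using assms unfolding is_longest_def by (auto simp: fund_weight_inner)

lemma parabolic_pos_roots_eq: "p \<in> II \<Longrightarrow> parabolic_pos_roots \<Phi> \<alpha> p = levi_pos (II - {p})"
  using simple_nonzero[of p] unfolding parabolic_pos_roots_def levi_pos_def
  by (auto simp: fund_weight_inner pos_root)

lemma parabolic_half_sum_eq: "p \<in> II \<Longrightarrow> parabolic_half_sum \<Phi> \<alpha> p = levi_half_sum (II - {p})"
  by (simp add: parabolic_half_sum_def levi_half_sum_def parabolic_pos_roots_eq)

text \<open>Both half sums pair to 1 with the simple coroots other than that of \<open>\<alpha> p\<close>, so that their difference is
  a multiple of the fundamental weight.\<close>
lemma rho_parabolic:
  assumes p: "p \<in> II"
  shows "2 *\<^sub>R \<rho> - 2 *\<^sub>R parabolic_half_sum \<Phi> \<alpha> p = parabolic_const \<Phi> \<alpha> p *\<^sub>R wt p"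
proof (rule weight_eqI)
  fix i assume i: "i \<in> II"
  show "coroot (\<alpha> i) \<bullet> (2 *\<^sub>R \<rho> - 2 *\<^sub>R parabolic_half_sum \<Phi> \<alpha> p) =
      coroot (\<alpha> i) \<bullet> (parabolic_const \<Phi> \<alpha> p *\<^sub>R wt p)"
  proof (cases "i = p")
    case True
    have "wt p \<bullet> coroot (\<alpha> p) = 1" using fund_weight_coroot[OF p, of p] by (simp add: inner_commute)
    thus ?thesis using True rho_simple[OF p] fund_weight_coroot[OF p, of p]
      by (simp add: parabolic_const_def inner_diff_right inner_diff_left inner_commute)
  next
    case False
    have "levi_half_sum (II - {p}) \<bullet> coroot (\<alpha> i) = 1"
      using i False by (intro levi_half_sum_simple) auto
    thus ?thesis using False rho_simple[OF i] fund_weight_coroot[OF i, of p]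
      by (simp add: parabolic_half_sum_eq[OF p] inner_diff_right inner_commute)
  qed
qed

lemma parabolic_const_int:
  assumes p: "p \<in> II"
  shows "parabolic_const \<Phi> \<alpha> p \<in> \<int>"
proof -
  have "(\<Sum>a\<in>levi_pos (II - {p}). a \<bullet> coroot (\<alpha> p)) \<in> \<int>"
    using p by (intro Ints_sum root_coroot_int simple_in_roots) (auto simp: levi_pos_def pos_root)
  moreover have "parabolic_const \<Phi> \<alpha> p = 2 - (\<Sum>a\<in>levi_pos (II - {p}). a \<bullet> coroot (\<alpha> p))"
  proof -
    have "wt p \<bullet> coroot (\<alpha> p) = 1" using fund_weight_coroot[OF p, of p] by (simp add: inner_commute)
    thus ?thesis
      by (simp add: parabolic_const_def parabolic_half_sum_eq[OF p] levi_half_sum_def inner_diff_left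
          inner_sum_left)
  qed
  ultimately show ?thesis by simp
qed

text \<open>The reason is \<open>w \<rho> = c\<^sub>p \<lambda>\<^sub>p - \<rho>\<close>. Together with the following lemma: among the roots of level \<open>k\<close>, those of
  height \<open>h\<close> and those of height \<open>c\<^sub>p k - h\<close> correspond to each other.\<close>
lemma longest_parabolic_height:
  assumes p: "p \<in> II" and w: "is_longest (II - {p}) w"
  shows "ht (w a) = parabolic_const \<Phi> \<alpha> p * (wt p \<bullet> coroot a) - ht a"
proof -
  have wW: "w \<in> W" using w by (simp add: is_longest_def)
  have "w \<rho> = parabolic_const \<Phi> \<alpha> p *\<^sub>R wt p - \<rho>"
  proof -
    have "w \<rho> = \<rho> - 2 *\<^sub>R parabolic_half_sum \<Phi> \<alpha> p"
      unfolding parabolic_half_sum_eq[OF p] by (rule longest_rho[OF _ w]) auto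
    also have "\<dots> = (2 *\<^sub>R \<rho> - 2 *\<^sub>R parabolic_half_sum \<Phi> \<alpha> p) - \<rho>" by (simp add: scaleR_2)
    finally show ?thesis by (simp only: rho_parabolic[OF p])
  qed
  hence "ht a = (parabolic_const \<Phi> \<alpha> p *\<^sub>R wt p - \<rho>) \<bullet> w (coroot a)"
    using weyl_inner[OF wW, of \<rho> "coroot a"] by (simp add: coroot_height_def)
  also have "\<dots> = parabolic_const \<Phi> \<alpha> p * (wt p \<bullet> w (coroot a)) - ht (w a)"
    by (simp add: inner_diff_left coroot_height_def weyl_coroot[OF wW])
  also have "wt p \<bullet> w (coroot a) = wt p \<bullet> coroot a"
    using p by (intro longest_inner_weight[OF w]) auto
  finally show ?thesis by simp
qed

lemma longest_parabolic_level:
  assumes p: "p \<in> II" and w: "is_longest (II - {p}) w"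
  shows "wt p \<bullet> coroot (w a) = wt p \<bullet> coroot a"
  using longest_inner_weight[OF w] weyl_coroot[of w a] w p by (simp add: is_longest_def)

section \<open>Diagram automorphisms\<close>

lemma simple_coroot_nonpos:
  assumes "i \<in> II" "j \<in> II" "i \<noteq> j"
  shows "\<alpha> i \<bullet> coroot (\<alpha> j) \<le> 0"
proof -
  have "s j (\<alpha> i) \<in> Pos"
    using assms inj_simple by (intro simple_reflection_pos simple_pos) (auto dest: inj_onD)
  hence "coef (s j (\<alpha> i)) j \<ge> 0" using assms by (intro coef_pos_nonneg)
  thus ?thesis using assms by (simp add: coef_reflection coef_simple)
qed

text \<open>This is the strict Cauchy-Schwarz inequality for the linearly independent vectors \<open>\<alpha> i\<close> and \<open>\<alpha> j\<close>.\<close>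
lemma dynkin_edges_less_4:
  assumes "i \<in> II" "j \<in> II" "i \<noteq> j"
  shows "(\<alpha> i \<bullet> coroot (\<alpha> j)) * (\<alpha> j \<bullet> coroot (\<alpha> i)) < 4"
proof -
  define x y z where "x = \<alpha> i \<bullet> \<alpha> i" and "y = \<alpha> j \<bullet> \<alpha> j" and "z = \<alpha> i \<bullet> \<alpha> j"
  have xy: "x > 0" "y > 0" using assms simple_nonzero by (auto simp: x_def y_def)
  define v where "v = \<alpha> i - (z / y) *\<^sub>R \<alpha> j"
  have "coef v i = 1" using assms by (simp add: v_def coef_diff coef_scale coef_simple)
  hence "v \<noteq> 0" by (auto simp: coef_def representation_zero)
  hence "0 < v \<bullet> v" by simp
  also have "v \<bullet> v = x - z * z / y"
    using xy by (simp add: v_def inner_diff_left inner_diff_right x_def y_def z_def inner_commute field_simps)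
  finally have "z * z < x * y" using xy by (simp add: field_simps)
  thus ?thesis using xy by (simp add: coroot_def x_def[symmetric] y_def[symmetric] z_def[symmetric]
        inner_commute[of "\<alpha> j" "\<alpha> i"] field_simps)
qed

text \<open>The product is 1, 2 or 3, so that at least one of the two integers is \<open>-1\<close>; the comparison tells
  which one.\<close>
lemma cartan_pair_unique:
  fixes a b a' b' :: int
  assumes "a \<le> 0" "b \<le> 0" "a' \<le> 0" "b' \<le> 0" "a * b = a' * b'" "a * b < 4" "a * b \<noteq> 0"
    and "a < b \<longleftrightarrow> a' < b'" "b < a \<longleftrightarrow> b' < a'"
  shows "a = a'"
proof -
  have *: "x \<in> {-3..-1}" if "x \<le> 0" "y \<le> 0" "x * y < 4" "x * y \<noteq> 0" for x y :: int
  proof -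
    have "x < 0" "y < 0" using that by auto
    hence "x * y \<ge> - x" using mult_right_mono_neg[of "y" "-1" x] by (simp add: mult.commute)
    thus ?thesis using that \<open>x < 0\<close> by auto
  qed
  have "a \<in> {-3..-1}" "b \<in> {-3..-1}" "a' \<in> {-3..-1}" "b' \<in> {-3..-1}"
    using *[of a b] *[of b a] *[of a' b'] *[of b' a'] assms by (auto simp: mult.commute)
  moreover have "{-3..-1::int} = {-3, -2, -1}" by auto
  ultimately show ?thesis using assms by (auto)
qed

lemma cartan_int:
  assumes "i \<in> II" "j \<in> II" obtains m :: int where "\<alpha> i \<bullet> coroot (\<alpha> j) = real_of_int m"
  using root_coroot_int[OF simple_in_roots[OF assms(2)] simple_in_roots[OF assms(1)]] that
  by (auto elim!: Ints_cases)

lemma cartan_less_iff: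
  assumes "i \<in> II" "j \<in> II" "i \<noteq> j" "\<alpha> i \<bullet> \<alpha> j \<noteq> 0"
  shows "\<alpha> i \<bullet> coroot (\<alpha> j) < \<alpha> j \<bullet> coroot (\<alpha> i) \<longleftrightarrow> norm (\<alpha> i) > norm (\<alpha> j)"
proof -
  have p: "\<alpha> i \<bullet> \<alpha> i > 0" "\<alpha> j \<bullet> \<alpha> j > 0" using assms simple_nonzero by auto
  have "2 * (\<alpha> i \<bullet> \<alpha> j) / (\<alpha> j \<bullet> \<alpha> j) \<le> 0"
    using simple_coroot_nonpos[OF assms(1-3)] by (simp add: coroot_def)
  hence z: "\<alpha> i \<bullet> \<alpha> j < 0"
    using p assms(4) unfolding divide_le_0_iff by linarith
  have "\<alpha> i \<bullet> coroot (\<alpha> j) < \<alpha> j \<bullet> coroot (\<alpha> i) \<longleftrightarrow>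
      2 * (\<alpha> i \<bullet> \<alpha> j) / (\<alpha> j \<bullet> \<alpha> j) < 2 * (\<alpha> i \<bullet> \<alpha> j) / (\<alpha> i \<bullet> \<alpha> i)"
    by (simp add: coroot_def inner_commute)
  also have "\<dots> \<longleftrightarrow> (\<alpha> i \<bullet> \<alpha> j) * (\<alpha> i \<bullet> \<alpha> i) < (\<alpha> i \<bullet> \<alpha> j) * (\<alpha> j \<bullet> \<alpha> j)"
    using p by (simp add: field_simps)
  also have "\<dots> \<longleftrightarrow> \<alpha> j \<bullet> \<alpha> j < \<alpha> i \<bullet> \<alpha> i" using z by simp
  also have "\<dots> \<longleftrightarrow> norm (\<alpha> j) < norm (\<alpha> i)" by (simp add: norm_lt)
  finally show ?thesis .
qed

text \<open>The edges give the products of opposite Cartan integers, and the arrows compare them.\<close>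
lemma dynkin_aut_cartan:
  assumes \<sigma>: "\<sigma> \<in> dynkin_aut \<alpha>" and i: "i \<in> II" and j: "j \<in> II"
  shows "\<alpha> (\<sigma> i) \<bullet> coroot (\<alpha> (\<sigma> j)) = \<alpha> i \<bullet> coroot (\<alpha> j)"
proof (cases "i = j")
  case True
  have "\<sigma> j \<in> II" using \<sigma> j by (auto simp: dynkin_aut_II permutes_in_image)
  thus ?thesis using True i j simple_nonzero by (simp add: inner_coroot_self)
next
  case False
  have perm: "\<sigma> permutes II" using \<sigma> by (simp add: dynkin_aut_II)
  have m: "\<sigma> i \<in> II" "\<sigma> j \<in> II" "\<sigma> i \<noteq> \<sigma> j"
    using perm i j False by (auto simp: permutes_in_image dest: permutes_inj injD)
  have e: "dynkin_edges \<alpha> (\<sigma> i) (\<sigma> j) = dynkin_edges \<alpha> i j"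
    and ar: "dynkin_arrow \<alpha> (\<sigma> i) (\<sigma> j) \<longleftrightarrow> dynkin_arrow \<alpha> i j" "dynkin_arrow \<alpha> (\<sigma> j) (\<sigma> i) \<longleftrightarrow> dynkin_arrow \<alpha> j i"
    using \<sigma> i j by (auto simp: dynkin_aut_II)
  obtain a where a: "\<alpha> i \<bullet> coroot (\<alpha> j) = real_of_int a" using cartan_int[OF i j] .
  obtain b where b: "\<alpha> j \<bullet> coroot (\<alpha> i) = real_of_int b" using cartan_int[OF j i] .
  obtain a' where a': "\<alpha> (\<sigma> i) \<bullet> coroot (\<alpha> (\<sigma> j)) = real_of_int a'" using cartan_int[OF m(1,2)] .
  obtain b' where b': "\<alpha> (\<sigma> j) \<bullet> coroot (\<alpha> (\<sigma> i)) = real_of_int b'" using cartan_int[OF m(2,1)] .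
  have e': "dynkin_edges \<alpha> i j = real_of_int (a * b)" "dynkin_edges \<alpha> (\<sigma> i) (\<sigma> j) = real_of_int (a' * b')"
      "dynkin_edges \<alpha> j i = real_of_int (a * b)" "dynkin_edges \<alpha> (\<sigma> j) (\<sigma> i) = real_of_int (a' * b')"
    using False m(3) by (auto simp: dynkin_edges_def a b a' b' simp del: mult_eq_0_iff)
  have prod: "a * b = a' * b'" using e unfolding e' of_int_eq_iff by simp
  have zero: "real_of_int (x * y) = 0 \<longleftrightarrow> \<alpha> k \<bullet> \<alpha> l = 0"
    if "\<alpha> k \<bullet> coroot (\<alpha> l) = real_of_int x" "\<alpha> l \<bullet> coroot (\<alpha> k) = real_of_int y" "k \<in> II" "l \<in> II" for x y k l
    using simple_nonzero[OF that(3)] simple_nonzero[OF that(4)]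
    unfolding of_int_mult that(1,2)[symmetric] by (auto simp: coroot_def inner_commute)
  show ?thesis
  proof (cases "a * b = 0")
    case True
    hence "\<alpha> i \<bullet> \<alpha> j = 0" "\<alpha> (\<sigma> i) \<bullet> \<alpha> (\<sigma> j) = 0"
      using zero[OF a b i j] zero[OF a' b' m(1,2)] prod by simp_all
    thus ?thesis by (simp add: coroot_def)
  next
    case nz: False
    hence n: "\<alpha> i \<bullet> \<alpha> j \<noteq> 0" "\<alpha> (\<sigma> i) \<bullet> \<alpha> (\<sigma> j) \<noteq> 0"
      using zero[OF a b i j] zero[OF a' b' m(1,2)] prod by auto
    have n': "\<alpha> j \<bullet> \<alpha> i \<noteq> 0" "\<alpha> (\<sigma> j) \<bullet> \<alpha> (\<sigma> i) \<noteq> 0" using n by (simp_all add: inner_commute)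
    have nzr: "real_of_int (a * b) \<noteq> 0" "real_of_int (a' * b') \<noteq> 0"
      using nz prod unfolding of_int_eq_0_iff by simp_all
    have "a < b \<longleftrightarrow> a' < b'"
      using cartan_less_iff[OF i j False n(1)] cartan_less_iff[OF m n(2)] ar(1) nzr
      unfolding dynkin_arrow_def e' a b a' b' of_int_less_iff by blast
    moreover have "b < a \<longleftrightarrow> b' < a'"
      using cartan_less_iff[OF j i False[symmetric] n'(1)] cartan_less_iff[OF m(2,1) m(3)[symmetric] n'(2)] ar(2) nzr
      unfolding dynkin_arrow_def e' a b a' b' of_int_less_iff by blast
    moreover have "a * b < 4"
    proof -
      have "real_of_int (a * b) < real_of_int 4"
        using dynkin_edges_less_4[OF i j False] by (simp add: a b)
      thus ?thesis unfolding of_int_less_iff .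
    qed
    moreover have "a \<le> 0" "b \<le> 0" "a' \<le> 0" "b' \<le> 0"
      using simple_coroot_nonpos[OF i j False] simple_coroot_nonpos[OF j i False[symmetric]]
        simple_coroot_nonpos[OF m] simple_coroot_nonpos[OF m(2,1) m(3)[symmetric]]
      unfolding a b a' b' by simp_all
    ultimately have "a = a'" using nz prod cartan_pair_unique by blast
    thus ?thesis by (simp add: a a')
  qed
qed

text \<open>In general not an isometry: the permutation may interchange components of the diagram whose roots
  differ in length.\<close>
definition diagram_map :: "(nat \<Rightarrow> nat) \<Rightarrow> 'a \<Rightarrow> 'a" where
  "diagram_map \<sigma> v = (\<Sum>i\<in>II. coef v i *\<^sub>R \<alpha> (\<sigma> i))"

end

locale diagram_symmetry = based_root_system +
  fixes \<sigma> :: "nat \<Rightarrow> nat"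
  assumes \<sigma>: "\<sigma> \<in> dynkin_aut \<alpha>"
begin

abbreviation "L \<equiv> diagram_map \<sigma>"

lemma perm: "\<sigma> permutes II" using \<sigma> by (simp add: dynkin_aut_II)
lemma perm_in [simp]: "\<sigma> i \<in> II \<longleftrightarrow> i \<in> II" using perm by (simp add: permutes_in_image)
lemma perm_eq [simp]: "\<sigma> i = \<sigma> j \<longleftrightarrow> i = j" using permutes_inj[OF perm] by (simp add: inj_eq)

lemma linear_L: "linear L"
  unfolding diagram_map_def
  by (intro linearI) (simp_all add: coef_add coef_scale scaleR_add_left sum.distrib scaleR_sum_right)

lemma L_simple: "i \<in> II \<Longrightarrow> L (\<alpha> i) = \<alpha> (\<sigma> i)"
proof -
  assume i: "i \<in> II"
  have "L (\<alpha> i) = (\<Sum>k\<in>II. if k = i then \<alpha> (\<sigma> k) else 0)"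
    unfolding diagram_map_def by (intro sum.cong) (auto simp: coef_simple i)
  thus ?thesis using i by simp
qed

lemma coef_L: "i \<in> II \<Longrightarrow> coef (L v) (\<sigma> i) = coef v i"
proof -
  assume i: "i \<in> II"
  have "coef (L v) (\<sigma> i) = (\<Sum>k\<in>II. if k = i then coef v k else 0)"
    unfolding diagram_map_def coef_sum coef_scale by (intro sum.cong) (auto simp: coef_simple i)
  thus ?thesis using i by simp
qed

lemma L_inj: "inj L"
proof (rule injI)
  fix u v assume "L u = L v"
  thus "u = v" using coef_L[of _ u] coef_L[of _ v] by (intro coef_eqI) metis
qed

lemma L_bij: "bij L"
  using L_inj linear_L linear_injective_imp_surjective by (auto simp: bij_def)

lemma L_inner_simple: "i \<in> II \<Longrightarrow> L v \<bullet> coroot (\<alpha> (\<sigma> i)) = v \<bullet> coroot (\<alpha> i)"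
proof -
  assume i: "i \<in> II"
  have "L v \<bullet> coroot (\<alpha> (\<sigma> i)) = (\<Sum>j\<in>II. coef v j * (\<alpha> j \<bullet> coroot (\<alpha> i)))"
    unfolding diagram_map_def inner_sum_left by (intro sum.cong) (auto simp: dynkin_aut_cartan[OF \<sigma> _ i])
  also have "\<dots> = (\<Sum>j\<in>II. coef v j *\<^sub>R \<alpha> j) \<bullet> coroot (\<alpha> i)" by (simp add: inner_sum_left)
  also have "\<dots> = v \<bullet> coroot (\<alpha> i)" by (simp only: coef_expand[symmetric])
  finally show ?thesis .
qed

lemma L_simple_reflection: "i \<in> II \<Longrightarrow> L (s i v) = s (\<sigma> i) (L v)"
  by (simp add: reflection_def linear_diff[OF linear_L] linear_scale[OF linear_L] L_simple L_inner_simple)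

lemma L_simple_group:
  assumes "w \<in> simple_group II"
  shows "\<exists>w'\<in>W. \<forall>v. L (w v) = w' (L v)"
  using assms
proof (induction rule: simple_group.induct)
  case simple_id
  show ?case using weyl_group.weyl_id by (intro bexI[of _ id]) auto
next
  case (simple_step w i)
  then obtain w' where w': "w' \<in> W" "\<And>v. L (w v) = w' (L v)" by blast
  show ?case
  proof (intro bexI[of _ "w' \<circ> s (\<sigma> i)"] allI)
    show "L ((w \<circ> s i) v) = (w' \<circ> s (\<sigma> i)) (L v)" for v
      using simple_step by (simp add: w' L_simple_reflection)
    show "w' \<circ> s (\<sigma> i) \<in> W"
      using simple_step w' by (intro weyl_comp weyl_reflection simple_in_roots) auto
  qed
qed

text \<open>Conjugation by \<open>L\<close> takes simple reflections to simple reflections, and every root is conjugate to a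
  simple root. Therefore both statements reduce to simple roots, where the second one is the invariance
  of the Cartan integers.\<close>
lemma L_root_data:
  assumes "b \<in> \<Phi>"
  shows "L b \<in> \<Phi>" and "L v \<bullet> coroot (L b) = v \<bullet> coroot b"
proof -
  obtain w i where w: "w \<in> simple_group II" and i: "i \<in> II" and b: "b = w (\<alpha> i)"
    using root_conjugate_simple[OF assms] by blast
  have wW: "w \<in> W" using simple_group_weyl[OF order.refl w] .
  obtain w' where w': "w' \<in> W" "\<And>v. L (w v) = w' (L v)" using L_simple_group[OF w] by blast
  have Lb: "L b = w' (\<alpha> (\<sigma> i))" using w' i by (simp add: b L_simple)
  have "\<alpha> (\<sigma> i) \<in> \<Phi>" using i by (intro simple_in_roots) simp
  thus "L b \<in> \<Phi>" unfolding Lb by (rule weyl_root[OF w'(1)])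
  have "L v = w' (L (inv w v))" using w'(2)[of "inv w v"] by (simp add: weyl_inv(2)[OF wW])
  hence "L v \<bullet> coroot (L b) = w' (L (inv w v)) \<bullet> w' (coroot (\<alpha> (\<sigma> i)))"
    by (simp add: Lb weyl_coroot[OF w'(1)])
  also have "\<dots> = inv w v \<bullet> coroot (\<alpha> i)" using i by (simp add: weyl_inner[OF w'(1)] L_inner_simple)
  also have "\<dots> = v \<bullet> w (coroot (\<alpha> i))" by (simp add: weyl_inner_inv[OF wW])
  also have "\<dots> = v \<bullet> coroot b" by (simp add: b weyl_coroot[OF wW])
  finally show "L v \<bullet> coroot (L b) = v \<bullet> coroot b" .
qed

lemma L_roots: "L ` \<Phi> = \<Phi>"
  by (rule endo_inj_surj[OF finite_roots]) (use L_root_data L_inj in \<open>auto intro: inj_on_subset\<close>)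

lemma L_pos_iff: "b \<in> \<Phi> \<Longrightarrow> L b \<in> Pos \<longleftrightarrow> b \<in> Pos"
proof -
  assume b: "b \<in> \<Phi>"
  have "(\<forall>i\<in>II. coef (L b) i \<in> \<nat>) \<longleftrightarrow> (\<forall>i\<in>II. coef (L b) (\<sigma> i) \<in> \<nat>)"
    using permutes_image[OF perm] by (metis imageE imageI)
  thus ?thesis using b L_root_data(1)[OF b] by (simp add: pos_roots_iff coef_L)
qed

lemma L_pos: "L ` Pos = Pos"
proof
  show "L ` Pos \<subseteq> Pos" using L_pos_iff pos_root by auto
  show "Pos \<subseteq> L ` Pos"
  proof
    fix b assume b: "b \<in> Pos"
    then obtain a where "a \<in> \<Phi>" "b = L a" using L_roots pos_root by blast
    thus "b \<in> L ` Pos" using b L_pos_iff by auto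
  qed
qed

lemma L_uminus: "L (- v) = - L v" using linear_neg[OF linear_L] .

lemma L_rho: "L \<rho> = \<rho>"
proof -
  have "(\<Sum>a\<in>Pos. L a) = (\<Sum>a\<in>L ` Pos. a)"
    using sum.reindex[of L Pos "\<lambda>a. a"] inj_on_subset[OF L_inj] by (simp add: o_def)
  thus ?thesis unfolding half_sum_def L_pos
    by (simp add: linear_scale[OF linear_L] linear_sum[OF linear_L])
qed

lemma L_weight: "p \<in> II \<Longrightarrow> L (wt p) = wt (\<sigma> p)"
proof (rule weight_eqI)
  fix i assume p: "p \<in> II" and "i \<in> II"
  then obtain k where k: "k \<in> II" "i = \<sigma> k" using permutes_image[OF perm] by blast
  show "coroot (\<alpha> i) \<bullet> L (wt p) = coroot (\<alpha> i) \<bullet> wt (\<sigma> p)"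
    using L_inner_simple[OF k(1), of "wt p"] fund_weight_coroot[OF k(1), of p]
      fund_weight_coroot[of "\<sigma> k" "\<sigma> p"] k p by (simp add: inner_commute)
qed

lemma L_height: "b \<in> \<Phi> \<Longrightarrow> ht (L b) = ht b"
  unfolding coroot_height_def using L_root_data(2)[of b \<rho>] by (simp add: L_rho)

lemma L_level: "p \<in> II \<Longrightarrow> b \<in> \<Phi> \<Longrightarrow> wt (\<sigma> p) \<bullet> coroot (L b) = wt p \<bullet> coroot b"
  using L_root_data(2)[of b "wt p"] by (simp add: L_weight)

lemma L_const:
  assumes p: "p \<in> II"
  shows "parabolic_const \<Phi> \<alpha> (\<sigma> p) = parabolic_const \<Phi> \<alpha> p"
proof -
  have im: "levi_pos (II - {\<sigma> p}) = L ` levi_pos (II - {p})"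
  proof -
    have c: "b \<in> levi_pos (II - {k}) \<longleftrightarrow> b \<in> Pos \<and> coef b k = 0" if "k \<in> II" for b k
      using that by (auto simp: levi_pos_def)
    show ?thesis
    proof (intro equalityI subsetI)
      fix b assume b: "b \<in> levi_pos (II - {\<sigma> p})"
      hence "b \<in> L ` Pos" using c p by (simp add: L_pos)
      then obtain a where "a \<in> Pos" "b = L a" by blast
      thus "b \<in> L ` levi_pos (II - {p})" using b c p coef_L by auto
    next
      fix b assume "b \<in> L ` levi_pos (II - {p})"
      thus "b \<in> levi_pos (II - {\<sigma> p})" using c p coef_L L_pos by auto
    qed
  qed
  have "(\<Sum>a\<in>levi_pos (II - {p}). L a) = (\<Sum>a\<in>levi_pos (II - {\<sigma> p}). a)"
    unfolding im using sum.reindex[of L "levi_pos (II - {p})" "\<lambda>a. a"] inj_on_subset[OF L_inj] by (simp add: o_def)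
  hence h: "parabolic_half_sum \<Phi> \<alpha> (\<sigma> p) = L (parabolic_half_sum \<Phi> \<alpha> p)"
    using p by (simp add: parabolic_half_sum_eq levi_half_sum_def linear_scale[OF linear_L] linear_sum[OF linear_L])
  have "(L (wt p) - L (parabolic_half_sum \<Phi> \<alpha> p)) \<bullet> coroot (\<alpha> (\<sigma> p)) =
      (wt p - parabolic_half_sum \<Phi> \<alpha> p) \<bullet> coroot (\<alpha> p)"
    using L_inner_simple[OF p, of "wt p - parabolic_half_sum \<Phi> \<alpha> p"] by (simp add: linear_diff[OF linear_L])
  thus ?thesis by (simp add: parabolic_const_def h L_weight[OF p])
qed

definition conj_map :: "('a \<Rightarrow> 'a) \<Rightarrow> 'a \<Rightarrow> 'a" where
  "conj_map w = L \<circ> w \<circ> inv L"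

lemma inv_L [simp]: "inv L (L v) = v" "L (inv L v) = v"
  using L_bij by (simp_all add: bij_is_inj bij_is_surj surj_f_inv_f)

lemma conj_map_L: "conj_map w (L v) = L (w v)" by (simp add: conj_map_def)

lemma L_reflection: "a \<in> \<Phi> \<Longrightarrow> L (reflection a v) = reflection (L a) (L v)"
  by (simp add: reflection_def linear_diff[OF linear_L] linear_scale[OF linear_L] L_root_data)

lemma conj_map_weyl: "w \<in> W \<Longrightarrow> conj_map w \<in> W"
proof (induction rule: weyl_group.induct)
  case weyl_id
  have "conj_map id = id" by (simp add: conj_map_def fun_eq_iff)
  thus ?case using weyl_group.weyl_id by (simp only:)
next
  case (weyl_step a w)
  have "conj_map (reflection a \<circ> w) = reflection (L a) \<circ> conj_map w"
    using weyl_step by (auto simp: conj_map_def fun_eq_iff L_reflection)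
  thus ?case using weyl_group.weyl_step[OF L_root_data(1)[OF weyl_step(1)] weyl_step(3)] by (simp only:)
qed

lemma conj_map_bij: "bij_betw conj_map W W"
proof -
  have "inj_on conj_map W"
  proof (rule inj_onI)
    fix v w assume "conj_map v = conj_map w"
    hence "L (v x) = L (w x)" for x using conj_map_L by metis
    thus "v = w" using L_inj by (auto simp: fun_eq_iff inj_eq)
  qed
  moreover from this have "conj_map ` W = W"
    using conj_map_weyl finite_weyl by (intro endo_inj_surj) auto
  ultimately show ?thesis by (simp add: bij_betw_def)
qed

end

context based_root_system
begin

section \<open>The residue of the period\<close>

text \<open>The pairing of the point \<open>\<rho> + \<Sum>\<^sub>k t\<^sub>k \<lambda>\<^sub>k\<close> with the coroot of \<open>a\<close>, as a function of the coordinates.\<close>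
definition pairing :: "'a \<Rightarrow> (nat \<Rightarrow> complex) \<Rightarrow> complex" where
  "pairing a t = of_real (ht a) + (\<Sum>k\<in>II. t k * of_real (wt k \<bullet> coroot a))"

lemma cinner_weight_point: "cinner (weight_point \<Phi> \<alpha> t) (coroot a) = pairing a t"
  by (simp add: cinner_def weight_point_II pairing_def complex_eq_iff inner_add_left inner_sum_left
        coroot_height_def)

lemma cinner_weyl_shift:
  assumes w: "w \<in> W"
  shows "cinner (map_prod w w (weight_point \<Phi> \<alpha> t) - (\<rho>, 0)) (coroot b) = pairing (inv w b) t - of_real (ht b)"
proof -
  have iw: "inv w \<in> W" by (rule weyl_inv(1)[OF w])
  have "w u \<bullet> coroot b = u \<bullet> coroot (inv w b)" for u
    using weyl_inner_inv[OF iw, of u "coroot b"] weyl_coroot[OF iw, of b] weyl_bij[OF w] by (simp add: inv_inv_eq)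
  thus ?thesis
    unfolding cinner_weight_point[symmetric]
    by (simp add: cinner_def coroot_height_def inner_diff_left complex_eq_iff minus_prod_def)
qed

lemma period_at_0:
  "period \<Phi> \<alpha> (weight_point \<Phi> \<alpha> t) 0 =
    (\<Sum>w\<in>W. (\<Prod>b\<in>Simple. 1 / (pairing (inv w b) t - 1)) *
       (\<Prod>a\<in>Inv w. completed_zeta (pairing a t) / completed_zeta (pairing a t + 1)))"
  unfolding period_def cinner_weight_point
proof (rule sum.cong[OF refl])
  fix w assume w: "w \<in> W"
  have "(\<Prod>b\<in>Simple. 1 / cinner (map_prod w w (weight_point \<Phi> \<alpha> t) - (\<rho>, 0)) (coroot b)) =
      (\<Prod>b\<in>Simple. 1 / (pairing (inv w b) t - 1))"
    unfolding cinner_weyl_shift[OF w]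
    by (intro prod.cong) (auto simp: simple_roots_II height_simple)
  thus "exp (cinner (map_prod w w (weight_point \<Phi> \<alpha> t) - (\<rho>, 0)) 0) *
      (\<Prod>b\<in>Simple. 1 / cinner (map_prod w w (weight_point \<Phi> \<alpha> t) - (\<rho>, 0)) (coroot b)) *
      (\<Prod>a\<in>Inv w. completed_zeta (pairing a t) / completed_zeta (pairing a t + 1)) =
      (\<Prod>b\<in>Simple. 1 / (pairing (inv w b) t - 1)) *
      (\<Prod>a\<in>Inv w. completed_zeta (pairing a t) / completed_zeta (pairing a t + 1))"
    by (simp add: cinner_def zero_complex.code[symmetric])
qed

definition Del :: "nat \<Rightarrow> 'a set" where "Del p = simple_roots_except \<alpha> p"

lemma Del_eq: "p \<in> II \<Longrightarrow> Del p = \<alpha> ` (II - {p})"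
  using inj_simple unfolding Del_def simple_roots_except_def simple_roots_II
  by (auto dest: inj_onD)

lemma finite_Del [simp]: "finite (Del p)"
  by (simp add: Del_def simple_roots_except_def simple_roots_II)

lemma pairing_simple: "j \<in> II \<Longrightarrow> pairing (\<alpha> j) t = 1 + t j"
proof -
  assume j: "j \<in> II"
  have "(\<Sum>k\<in>II. t k * of_real (wt k \<bullet> coroot (\<alpha> j))) = (\<Sum>k\<in>II. if k = j then t k else 0)"
    using fund_weight_coroot[OF j] by (intro sum.cong) (auto simp: inner_commute)
  thus ?thesis using j by (simp add: pairing_def height_simple)
qed

text \<open>The term of \<open>w\<close> in the period has simple poles along the hyperplanes \<open>t\<^sub>j = 0\<close> with \<open>j\<close> in \<open>pole_indices\<close>,
  and \<open>reg_term\<close> is what remains when these are split off: \<open>1 / t\<^sub>j\<close> arises from the rational factor if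
  \<open>w (\<alpha> j)\<close> is simple, and from \<open>\<xi>(1 + t\<^sub>j) = xi_reg t\<^sub>j / t\<^sub>j\<close> if it is negative.\<close>
definition reg_term :: "nat \<Rightarrow> ('a \<Rightarrow> 'a) \<Rightarrow> (nat \<Rightarrow> complex) \<Rightarrow> complex" where
  "reg_term p w t =
     (\<Prod>b\<in>{b\<in>Simple. inv w b \<notin> Del p}. 1 / (pairing (inv w b) t - 1)) *
     ((\<Prod>a\<in>Inv w \<inter> Del p. xi_reg (pairing a t - 1)) *
      (\<Prod>a\<in>Inv w - Del p. completed_zeta (pairing a t)) /
      (\<Prod>a\<in>Inv w. completed_zeta (pairing a t + 1)))"

definition pole_indices :: "nat \<Rightarrow> ('a \<Rightarrow> 'a) \<Rightarrow> nat set" where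
  "pole_indices p w = {j\<in>II - {p}. w (\<alpha> j) \<in> Simple \<union> Neg}"

lemma inversions_iff: "a \<in> Inv w \<longleftrightarrow> a \<in> Pos \<and> - w a \<in> Pos"
  by (auto simp: inversions_def neg_roots_iff)

lemma finite_inversions [simp]: "finite (Inv w)"
  by (simp add: inversions_def)

lemma inj_simple_subset: "A \<subseteq> II \<Longrightarrow> inj_on \<alpha> A"
  using inj_simple by (rule inj_on_subset)

lemma admissible_eq: "p \<in> II \<Longrightarrow> Adm p = {w \<in> W. II - {p} \<subseteq> pole_indices p w}"
  unfolding admissible_def pole_indices_def by (auto simp: Del_def[symmetric] Del_eq)

lemma period_term_eq:
  assumes p: "p \<in> II" and w: "w \<in> W"
  shows "(\<Prod>b\<in>Simple. 1 / (pairing (inv w b) t - 1)) *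
       (\<Prod>a\<in>Inv w. completed_zeta (pairing a t) / completed_zeta (pairing a t + 1)) =
     reg_term p w t / (\<Prod>k\<in>pole_indices p w \<inter> (II - {p}). t k)"
proof -
  define A1 where "A1 = {j\<in>II - {p}. w (\<alpha> j) \<in> Simple}"
  define A2 where "A2 = {j\<in>II - {p}. w (\<alpha> j) \<in> Neg}"
  let ?S = "Simple" and ?I = "Inv w"
  have fS: "finite ?S" by (simp add: simple_roots_II)
  have SP: "?S \<subseteq> Pos" using simple_pos by (auto simp: simple_roots_II)
  have "{b\<in>?S. inv w b \<in> Del p} = (\<lambda>j. w (\<alpha> j)) ` A1"
    unfolding A1_def Del_eq[OF p] using weyl_inv[OF w] by (auto simp: image_iff) metis+
  moreover have "inj_on (\<lambda>j. w (\<alpha> j)) A1"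
    using inj_simple weyl_inj[OF w] unfolding A1_def inj_on_def inj_def by blast
  ultimately have "(\<Prod>b\<in>{b\<in>?S. inv w b \<in> Del p}. 1 / (pairing (inv w b) t - 1)) =
      (\<Prod>j\<in>A1. 1 / (pairing (inv w (w (\<alpha> j))) t - 1))"
    by (simp only: prod.reindex o_def)
  also have "\<dots> = (\<Prod>j\<in>A1. 1 / t j)"
    by (intro prod.cong) (auto simp: A1_def weyl_inv[OF w] pairing_simple)
  finally have 1: "(\<Prod>b\<in>{b\<in>?S. inv w b \<in> Del p}. 1 / (pairing (inv w b) t - 1)) = (\<Prod>j\<in>A1. 1 / t j)" .
  have I: "?I \<inter> Del p = \<alpha> ` A2"
    unfolding A2_def Del_eq[OF p] using simple_pos by (auto simp: inversions_iff neg_roots_iff)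
  have injA2: "inj_on \<alpha> A2" by (rule inj_simple_subset) (auto simp: A2_def)
  have "(\<Prod>a\<in>?I \<inter> Del p. completed_zeta (pairing a t)) = (\<Prod>j\<in>A2. completed_zeta (1 + t j))"
    unfolding I prod.reindex[OF injA2] o_def by (intro prod.cong) (auto simp: A2_def pairing_simple)
  also have "\<dots> = (\<Prod>j\<in>A2. xi_reg (t j)) * (\<Prod>j\<in>A2. 1 / t j)"
    unfolding completed_zeta_near_1 prod.distrib[symmetric] by simp
  also have "(\<Prod>j\<in>A2. xi_reg (t j)) = (\<Prod>a\<in>?I \<inter> Del p. xi_reg (pairing a t - 1))"
    unfolding I prod.reindex[OF injA2] o_def by (intro prod.cong) (auto simp: A2_def pairing_simple)
  finally have 2: "(\<Prod>a\<in>?I \<inter> Del p. completed_zeta (pairing a t)) =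
      (\<Prod>a\<in>?I \<inter> Del p. xi_reg (pairing a t - 1)) * (\<Prod>j\<in>A2. 1 / t j)" .
  have disj: "A1 \<inter> A2 = {}" using SP not_pos_and_neg by (auto simp: A1_def A2_def neg_roots_iff)
  have "pole_indices p w \<inter> (II - {p}) = A1 \<union> A2" by (auto simp: pole_indices_def A1_def A2_def)
  hence 3: "(\<Prod>k\<in>pole_indices p w \<inter> (II - {p}). t k) = (\<Prod>k\<in>A1. t k) * (\<Prod>k\<in>A2. t k)"
    using disj by (simp add: prod.union_disjoint A1_def A2_def)
  have 4: "(\<Prod>b\<in>?S. 1 / (pairing (inv w b) t - 1)) =
     (\<Prod>b\<in>{b\<in>?S. inv w b \<notin> Del p}. 1 / (pairing (inv w b) t - 1)) *
     (\<Prod>b\<in>{b\<in>?S. inv w b \<in> Del p}. 1 / (pairing (inv w b) t - 1))"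
    by (subst prod.union_disjoint[symmetric]) (auto simp: fS intro!: prod.cong)
  have 5: "(\<Prod>a\<in>?I. completed_zeta (pairing a t)) =
     (\<Prod>a\<in>?I \<inter> Del p. completed_zeta (pairing a t)) * (\<Prod>a\<in>?I - Del p. completed_zeta (pairing a t))"
    by (subst prod.union_disjoint[symmetric]) (auto intro!: prod.cong)
  have 6: "(\<Prod>a\<in>?I. completed_zeta (pairing a t) / completed_zeta (pairing a t + 1)) =
     (\<Prod>a\<in>?I. completed_zeta (pairing a t)) / (\<Prod>a\<in>?I. completed_zeta (pairing a t + 1))"
    by (rule prod_dividef)
  have 7: "(\<Prod>j\<in>A. 1 / t j) = 1 / (\<Prod>j\<in>A. t j)" for A by (simp add: prod_dividef)
  have gen: "P * (1 / X) * (B * (1 / Y) * C / D) = P * (B * C / D) / (X * Y)" for P X B Y C D :: complex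
    by (simp add: divide_inverse mult_ac)
  show ?thesis
    unfolding 4 1 6 5 2 3 7 reg_term_def by (rule gen)
qed

text \<open>The coordinates of \<open>\<rho> + z \<lambda>\<^sub>p\<close>, and the pairing of this point with the coroot of \<open>a\<close>.\<close>
definition axis :: "nat \<Rightarrow> complex \<Rightarrow> nat \<Rightarrow> complex" where
  "axis p z = (\<lambda>_. 0)(p := z)"

definition axis_pairing :: "nat \<Rightarrow> 'a \<Rightarrow> complex \<Rightarrow> complex" where
  "axis_pairing p a z = of_real (wt p \<bullet> coroot a) * z + of_real (ht a)"

lemma pairing_axis: "p \<in> II \<Longrightarrow> pairing a (axis p z) = axis_pairing p a z"
proof -
  assume p: "p \<in> II"
  have "(\<Sum>k\<in>II. axis p z k * of_real (wt k \<bullet> coroot a)) = (\<Sum>k\<in>II. if k = p then z * of_real (wt p \<bullet> coroot a) else 0)"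
    by (intro sum.cong) (auto simp: axis_def)
  thus ?thesis using p by (simp add: pairing_def axis_pairing_def)
qed

text \<open>The excluded parameters form a discrete set. Pairings that are constant in \<open>z\<close> are left out here;
  they are heights and are dealt with in \<open>generic_safe\<close>.\<close>
definition generic :: "nat \<Rightarrow> complex \<Rightarrow> bool" where
  "generic p z \<longleftrightarrow> (\<forall>a\<in>\<Phi>. wt p \<bullet> coroot a \<noteq> 0 \<longrightarrow>
     axis_pairing p a z \<notin> \<int> \<and> axis_pairing p a z \<in> xi_good \<and> axis_pairing p a z + 1 \<in> xi_good)"

text \<open>The values of the pairing with the coroot of \<open>a\<close> at which no factor of \<open>reg_term\<close> belonging to \<open>a\<close> is
  singular.\<close>
definition safe_values :: "nat \<Rightarrow> 'a \<Rightarrow> complex set" where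
  "safe_values p a = {x. (a \<notin> Del p \<longrightarrow> x \<noteq> 1) \<and> (a \<in> Pos - Del p \<longrightarrow> x \<in> xi_good) \<and> (a \<in> Pos \<longrightarrow> x + 1 \<in> xi_good)}"

lemma open_safe_values: "open (safe_values p a)"
proof -
  have "open ((\<lambda>x. x + 1) -` xi_good)"
    by (intro continuous_open_vimage open_xi_good continuous_intros)
  hence "open {x. x + 1 \<in> xi_good}" by (simp add: vimage_def)
  moreover have "open {x::complex. x \<noteq> 1}" by (simp add: open_Collect_neq)
  moreover have "open {x. x \<in> xi_good}" using open_xi_good by simp
  ultimately show ?thesis unfolding safe_values_def
    by (intro open_Collect_conj open_Collect_imp) (auto simp: closed_Collect_const)
qed

text \<open>If the pairing does not depend on \<open>z\<close>, its value is the height of \<open>a\<close>. For a positive root that is not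
  simple this is an integer greater than 1, and \<open>\<xi>\<close> is analytic and nonzero at the integers greater than 1.\<close>
lemma generic_safe:
  assumes p: "p \<in> II" and z: "generic p z" and a: "a \<in> \<Phi>"
  shows "axis_pairing p a z \<in> safe_values p a"
proof (cases "wt p \<bullet> coroot a = 0")
  case False
  hence "axis_pairing p a z \<notin> \<int>" "axis_pairing p a z \<in> xi_good" "axis_pairing p a z + 1 \<in> xi_good"
    using z a by (auto simp: generic_def)
  thus ?thesis by (auto simp: safe_values_def)
next
  case True
  hence v: "axis_pairing p a z = of_real (ht a)" by (simp add: axis_pairing_def)
  have ap: "a \<noteq> \<alpha> p" using True fund_weight_coroot[OF p, of p] by (auto simp: inner_commute)
  have nat: "\<exists>n::nat. ht b = real n \<and> n \<ge> 1" if "b \<in> Pos" for b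
    using height_nat[OF that] height_ge_1[OF that] by (auto elim!: Nats_cases)
  have 2: "ht a \<ge> 2" if "a \<in> Pos" "a \<notin> Del p"
  proof -
    have "ht a \<noteq> 1" using height_eq_1[OF that(1)] that(2) ap by (auto simp: Del_eq[OF p])
    thus ?thesis using nat[OF that(1)] by auto
  qed
  have good: "of_real (ht a) \<in> xi_good" if "a \<in> Pos" "a \<notin> Del p"
    using nat[OF that(1)] 2[OF that] nat_in_xi_good by (auto simp: numeral_le_real_of_nat_iff)
  moreover have "of_real (ht a) + 1 \<in> xi_good" if "a \<in> Pos"
  proof -
    obtain n where n: "ht a = real n" "n \<ge> 1" using nat[OF \<open>a \<in> Pos\<close>] by auto
    thus ?thesis using nat_in_xi_good[of "Suc n"] by (simp add: add.commute)
  qed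
  moreover have "complex_of_real (ht a) \<noteq> 1" if "a \<notin> Del p"
  proof (cases "a \<in> Pos")
    case True thus ?thesis using 2 that by auto
  next
    case False
    hence "ht (- a) \<ge> 1" using root_cases a height_ge_1 by blast
    thus ?thesis by (auto simp: height_uminus)
  qed
  ultimately show ?thesis by (auto simp: safe_values_def v)
qed

end

lemma completed_zeta_comp_holomorphic:
  assumes "f holomorphic_on S" "\<And>x. x \<in> S \<Longrightarrow> f x \<in> xi_good"
  shows "(\<lambda>x. completed_zeta (f x)) holomorphic_on S"
  using holomorphic_on_compose_gen[OF assms(1) completed_zeta_holomorphic_good] assms(2)
  by (auto simp: o_def)

lemma xi_reg_comp_holomorphic:
  assumes "f holomorphic_on S" "\<And>x. x \<in> S \<Longrightarrow> Re (f x) > -1"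
  shows "(\<lambda>x. xi_reg (f x)) holomorphic_on S"
  using holomorphic_on_compose_gen[OF assms(1) xi_reg_holomorphic] assms(2)
  by (auto simp: o_def)

lemma ex_common_radius:
  assumes "finite A" "\<And>a. a \<in> A \<Longrightarrow> open (V a)" "\<And>a. a \<in> A \<Longrightarrow> c a \<in> V a"
  shows "\<exists>d>0. \<forall>a\<in>A. ball (c a :: complex) d \<subseteq> V a"
  using assms
proof (induction A rule: finite_induct)
  case empty thus ?case by (intro exI[of _ 1]) auto
next
  case (insert x A)
  then obtain d where d: "d > 0" "\<forall>a\<in>A. ball (c a) d \<subseteq> V a" by auto
  obtain d' where d': "d' > 0" "ball (c x) d' \<subseteq> V x"
    using insert.prems by (meson insertI1 open_contains_ball)
  show ?case
  proof (intro exI[of _ "min d d'"] conjI ballI)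
    show "min d d' > 0" using d d' by simp
    fix a assume "a \<in> insert x A"
    thus "ball (c a) (min d d') \<subseteq> V a"
      using d(2) d'(2) subset_ball[of "min d d'" d] subset_ball[of "min d d'" d'] by fastforce
  qed
qed

context based_root_system
begin

definition axis_term :: "nat \<Rightarrow> ('a \<Rightarrow> 'a) \<Rightarrow> complex \<Rightarrow> complex" where
  "axis_term p w z =
     (\<Prod>b\<in>{b\<in>Simple. inv w b \<notin> Del p}. 1 / (axis_pairing p (inv w b) z - 1)) *
     (xi_reg 0 ^ card (Inv w \<inter> Del p) *
      (\<Prod>a\<in>Inv w - Del p. completed_zeta (axis_pairing p a z)) /
      (\<Prod>a\<in>Inv w. completed_zeta (axis_pairing p a z + 1)))"

lemma axis_pairing_Del: "p \<in> II \<Longrightarrow> a \<in> Del p \<Longrightarrow> axis_pairing p a z = 1"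
  using fund_weight_coroot[of _ p]
  by (auto simp: Del_eq axis_pairing_def height_simple inner_commute split: if_splits)

lemma reg_term_axis: "p \<in> II \<Longrightarrow> reg_term p w (axis p z) = axis_term p w z"
  by (simp add: reg_term_def axis_term_def pairing_axis axis_pairing_Del)

lemma pairing_holomorphic: "(\<lambda>x. pairing a (t(k := x))) holomorphic_on A"
proof -
  have "(\<lambda>x. (t(k := x)) j) holomorphic_on A" for j by (cases "j = k") (auto intro!: holomorphic_intros)
  thus ?thesis unfolding pairing_def by (intro holomorphic_intros)
qed

lemma reg_term_holomorphic:
  assumes p: "p \<in> II" and w: "w \<in> W"
    and safe: "\<And>a x. a \<in> \<Phi> \<Longrightarrow> x \<in> B \<Longrightarrow> pairing a (t(k := x)) \<in> safe_values p a"
    and small: "\<And>a x. a \<in> Del p \<Longrightarrow> x \<in> B \<Longrightarrow> norm (pairing a (t(k := x)) - 1) < 1"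
  shows "(\<lambda>x. reg_term p w (t(k := x))) holomorphic_on B"
proof -
  have root: "inv w b \<in> \<Phi>" if "b \<in> Simple" for b
  proof -
    have "b \<in> \<Phi>" using that simple_in_roots by (auto simp: simple_roots_II)
    thus ?thesis by (rule weyl_root[OF weyl_inv(1)[OF w]])
  qed
  have inv: "a \<in> Pos \<and> a \<in> \<Phi>" if "a \<in> Inv w" for a
    using that pos_root by (simp add: inversions_iff)
  have 1: "(\<lambda>x. 1 / (pairing (inv w b) (t(k := x)) - 1)) holomorphic_on B"
    if "b \<in> Simple" "inv w b \<notin> Del p" for b
    using safe[OF root[OF that(1)]] that(2)
    by (intro holomorphic_intros pairing_holomorphic) (auto simp: safe_values_def)
  have 2: "(\<lambda>x. xi_reg (pairing a (t(k := x)) - 1)) holomorphic_on B" if "a \<in> Del p" for a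
  proof (rule xi_reg_comp_holomorphic)
    show "(\<lambda>x. pairing a (t(k := x)) - 1) holomorphic_on B" by (intro holomorphic_intros pairing_holomorphic)
    fix x assume "x \<in> B"
    from small[OF that this] show "Re (pairing a (t(k := x)) - 1) > - 1"
      using abs_Re_le_cmod[of "pairing a (t(k := x)) - 1"] by linarith
  qed
  have 3: "(\<lambda>x. completed_zeta (pairing a (t(k := x)))) holomorphic_on B"
    if "a \<in> Inv w" "a \<notin> Del p" for a
    using safe[of a] inv[OF that(1)] that
    by (intro completed_zeta_comp_holomorphic pairing_holomorphic) (auto simp: safe_values_def)
  have 4: "pairing a (t(k := x)) + 1 \<in> xi_good" if "a \<in> Inv w" "x \<in> B" for a x
    using safe[of a x] inv[OF that(1)] that by (auto simp: safe_values_def)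
  have 5: "(\<lambda>x. completed_zeta (pairing a (t(k := x)) + 1)) holomorphic_on B"
    if "a \<in> Inv w" for a
    by (intro completed_zeta_comp_holomorphic holomorphic_intros pairing_holomorphic 4 that)
  have 6: "(\<Prod>a\<in>Inv w. completed_zeta (pairing a (t(k := x)) + 1)) \<noteq> 0" if "x \<in> B" for x
    using 4[OF _ that] by (auto simp: xi_good_def)
  have P: "(\<lambda>x. \<Prod>b\<in>{b\<in>Simple. inv w b \<notin> Del p}. 1 / (pairing (inv w b) (t(k := x)) - 1)) holomorphic_on B"
    by (rule holomorphic_on_prod) (use 1 in blast)
  have Q: "(\<lambda>x. \<Prod>a\<in>Inv w \<inter> Del p. xi_reg (pairing a (t(k := x)) - 1)) holomorphic_on B"
    by (rule holomorphic_on_prod) (use 2 in blast)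
  have R: "(\<lambda>x. \<Prod>a\<in>Inv w - Del p. completed_zeta (pairing a (t(k := x)))) holomorphic_on B"
    by (rule holomorphic_on_prod) (use 3 in blast)
  have S: "(\<lambda>x. \<Prod>a\<in>Inv w. completed_zeta (pairing a (t(k := x)) + 1)) holomorphic_on B"
    by (rule holomorphic_on_prod) (use 5 in blast)
  show ?thesis unfolding reg_term_def
    by (rule holomorphic_on_mult[OF P holomorphic_on_divide[OF holomorphic_on_mult[OF Q R] S 6]])
qed

text \<open>On a small polydisc around the point of the axis all factors of \<open>reg_term\<close> are analytic. Hence only the
  coordinates in the denominators matter, and the term of \<open>w\<close> survives all residues if and only if every
  index other than \<open>p\<close> is a pole index, that is, if \<open>w\<close> is admissible.\<close>
theorem parabolic_period_eq:
  assumes p: "p \<in> II" and z: "generic p z"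
  shows "parabolic_period \<Phi> \<alpha> p z 0 = (\<Sum>w\<in>Adm p. axis_term p w z)"
proof -
  obtain d where d: "d > 0" and dV: "\<And>a. a \<in> \<Phi> \<Longrightarrow> ball (axis_pairing p a z) d \<subseteq> safe_values p a"
    using ex_common_radius[OF finite_roots open_safe_values generic_safe[OF p z], of "\<lambda>a. a"] by auto
  define M where "M = 1 + (\<Sum>a\<in>\<Phi>. \<Sum>k\<in>II. \<bar>wt k \<bullet> coroot a\<bar>)"
  have M1: "M \<ge> 1" unfolding M_def by (simp add: sum_nonneg)
  have Ma: "(\<Sum>k\<in>II. \<bar>wt k \<bullet> coroot a\<bar>) \<le> M - 1" if "a \<in> \<Phi>" for a
    unfolding M_def using that finite_roots
    by (simp add: member_le_sum[of a \<Phi> "\<lambda>a. \<Sum>k\<in>II. \<bar>wt k \<bullet> coroot a\<bar>"] sum_nonneg)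
  \<comment> \<open>Below \<open>d / M\<close> the pairings stay in the safe discs; below 1 the arguments of \<^const>\<open>xi_reg\<close> stay
    in its domain.\<close>
  define e where "e = min 1 (d / M)"
  have e: "e > 0" "e \<le> 1" "e * M \<le> d" using d M1 by (auto simp: e_def min_def field_simps)
  define U where "U = {t. t p = z \<and> (\<forall>k\<in>II - {p}. norm (t k) < e)}"
  have pair: "pairing a t \<in> safe_values p a" if t: "t \<in> U" and a: "a \<in> \<Phi>" for t a
  proof -
    have "pairing a t = axis_pairing p a z + (\<Sum>k\<in>II - {p}. t k * of_real (wt k \<bullet> coroot a))"
      using t p unfolding pairing_def axis_pairing_def U_def
      by (subst sum.remove[of _ p]) (auto simp: mult.commute)
    hence "dist (axis_pairing p a z) (pairing a t) = norm (\<Sum>k\<in>II - {p}. t k * of_real (wt k \<bullet> coroot a))"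
      by (simp add: dist_norm)
    also have "\<dots> \<le> (\<Sum>k\<in>II - {p}. norm (t k) * \<bar>wt k \<bullet> coroot a\<bar>)"
      by (rule order.trans[OF norm_sum]) (simp add: norm_mult)
    also have "\<dots> \<le> (\<Sum>k\<in>II - {p}. e * \<bar>wt k \<bullet> coroot a\<bar>)"
      using t unfolding U_def by (intro sum_mono mult_right_mono) (auto intro: less_imp_le)
    also have "\<dots> \<le> (\<Sum>k\<in>II. e * \<bar>wt k \<bullet> coroot a\<bar>)"
      using e by (intro sum_mono2) auto
    also have "\<dots> = e * (\<Sum>k\<in>II. \<bar>wt k \<bullet> coroot a\<bar>)" by (simp add: sum_distrib_left)
    also have "\<dots> \<le> e * (M - 1)" using Ma[OF a] e by (intro mult_left_mono) auto
    also have "\<dots> < d" using e by (simp add: algebra_simps)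
    finally show ?thesis using dV[OF a] by auto
  qed
  have upd: "t(k := x) \<in> U" if "t \<in> U" "k \<in> II - {p}" "norm x < e" for t k x
    using that by (auto simp: U_def)
  have axisU: "axis p z \<in> U" using e by (auto simp: U_def axis_def)
  let ?ks = "sorted_list_of_set (II - {p})"
  have ks: "set ?ks = II - {p}" by simp
  have "parabolic_period \<Phi> \<alpha> p z 0 = iterated_residue ?ks (\<lambda>t. period \<Phi> \<alpha> (weight_point \<Phi> \<alpha> t) 0) (axis p z)"
    by (simp add: parabolic_period_II axis_def)
  also have "\<dots> = (\<Sum>w | w \<in> W \<and> set ?ks \<subseteq> pole_indices p w.
      reg_term p w (\<lambda>k. if k \<in> set ?ks then 0 else axis p z k))"
  proof (rule iterated_residue_simple_poles[where U = U and e = e])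
    show "(\<lambda>x. reg_term p w (t(k := x))) holomorphic_on ball 0 e"
      if "w \<in> W" "t \<in> U" "k \<in> set ?ks" for w t k
    proof (rule reg_term_holomorphic[OF p that(1)])
      fix a and x :: complex assume x: "x \<in> ball 0 e"
      hence tU: "t(k := x) \<in> U" using that by (intro upd) auto
      show "pairing a (t(k := x)) \<in> safe_values p a" if "a \<in> \<Phi>" by (rule pair[OF tU that])
      assume "a \<in> Del p"
      then obtain j where j: "j \<in> II - {p}" "a = \<alpha> j" by (auto simp: Del_eq[OF p])
      have "norm ((t(k := x)) j) < e" using tU j(1) unfolding U_def by blast
      thus "norm (pairing a (t(k := x)) - 1) < 1" using j e by (simp only: j(2)) (simp add: pairing_simple)
    qed
    show "period \<Phi> \<alpha> (weight_point \<Phi> \<alpha> t) 0 =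
        (\<Sum>w\<in>W. reg_term p w t / (\<Prod>k\<in>pole_indices p w \<inter> set ?ks. t k))" for t
      unfolding period_at_0 ks by (intro sum.cong refl period_term_eq p)
  qed (use finite_weyl e upd axisU in \<open>simp_all only: ks distinct_sorted_list_of_set\<close>)
  also have "(\<lambda>k. if k \<in> set ?ks then 0 else axis p z k) = axis p z"
    by (auto simp: axis_def fun_eq_iff)
  also have "{w. w \<in> W \<and> set ?ks \<subseteq> pole_indices p w} = Adm p"
    by (simp add: admissible_eq[OF p])
  finally show ?thesis by (simp add: reg_term_axis[OF p])
qed

lemma admissible_iff:
  "w \<in> Adm p \<longleftrightarrow> w \<in> W \<and> (\<forall>a\<in>Del p. w a \<in> Simple \<or> - w a \<in> Pos)"
  by (auto simp: admissible_def Del_def neg_roots_iff)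

lemma finite_admissible: "finite (Adm p)"
  by (rule finite_subset[OF _ finite_weyl]) (auto simp: admissible_def)

end

section \<open>The reflection of the parameter\<close>

text \<open>Let \<open>w0\<close> and \<open>wp\<close> be the longest elements of the Weyl group and of its subgroup belonging to \<open>p\<close>. Since
  \<open>wp (\<rho> + z \<lambda>\<^sub>p) = - (\<rho> + dual z \<lambda>\<^sub>p)\<close>, replacing \<open>w\<close> by \<open>flip w = w0 w wp\<close> amounts to replacing \<open>z\<close> by
  \<open>dual z = - c\<^sub>p - z\<close>.\<close>
locale parabolic_flip = based_root_system +
  fixes p :: nat and w0 wp :: "'a \<Rightarrow> 'a"
  assumes p: "p \<in> II" and w0: "is_longest II w0" and wp: "is_longest (II - {p}) wp"
begin

abbreviation "c \<equiv> parabolic_const \<Phi> \<alpha> p"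
abbreviation "lvl a \<equiv> wt p \<bullet> coroot a"
abbreviation "Levi \<equiv> levi_pos (II - {p})"
abbreviation "Upper \<equiv> Pos - Levi"

definition flip :: "('a \<Rightarrow> 'a) \<Rightarrow> 'a \<Rightarrow> 'a" where "flip w = w0 \<circ> w \<circ> wp"
definition dual :: "complex \<Rightarrow> complex" where "dual z = - of_real c - z"

lemma dual_dual [simp]: "dual (dual z) = z" by (simp add: dual_def)

lemma w0_weyl: "w0 \<in> W" and wp_weyl: "wp \<in> W"
  using w0 wp by (auto simp: is_longest_def)

lemma flip_weyl: "w \<in> W \<Longrightarrow> flip w \<in> W"
  unfolding flip_def using w0_weyl wp_weyl by (intro weyl_comp)

lemma w0_Pos: "(\<lambda>b. - w0 b) ` Pos = Pos"
  using w0 by (simp add: is_longest_def levi_pos_all)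
lemma w0_simple: "(\<lambda>b. - w0 b) ` Simple = Simple"
  using w0 by (simp add: is_longest_def simple_roots_II)
lemma wp_Levi: "(\<lambda>b. - wp b) ` Levi = Levi" and wp_Upper: "wp ` Upper = Upper"
  using wp by (auto simp: is_longest_def)
lemma wp_Del: "(\<lambda>b. - wp b) ` Del p = Del p"
  using wp by (simp add: is_longest_def Del_eq[OF p])

lemma neg_weyl_inj: "w \<in> W \<Longrightarrow> inj (\<lambda>b. - w b)"
  using weyl_inj by (auto simp: inj_def)

lemma neg_weyl_mem_iff: "w \<in> W \<Longrightarrow> (\<lambda>b. - w b) ` A = A \<Longrightarrow> - w x \<in> A \<longleftrightarrow> x \<in> A"
  using inj_image_mem_iff[OF neg_weyl_inj, of w x A] by simp

lemma w0_Pos_iff: "- w0 x \<in> Pos \<longleftrightarrow> x \<in> Pos"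
  using neg_weyl_mem_iff[OF w0_weyl w0_Pos] .
lemma w0_simple_iff: "- w0 x \<in> Simple \<longleftrightarrow> x \<in> Simple"
  using neg_weyl_mem_iff[OF w0_weyl w0_simple] .
lemma wp_Levi_iff: "- wp x \<in> Levi \<longleftrightarrow> x \<in> Levi"
  using neg_weyl_mem_iff[OF wp_weyl wp_Levi] .
lemma wp_Del_iff: "- wp x \<in> Del p \<longleftrightarrow> x \<in> Del p"
  using neg_weyl_mem_iff[OF wp_weyl wp_Del] .
lemma wp_Upper_iff: "wp x \<in> Upper \<longleftrightarrow> x \<in> Upper"
  using inj_image_mem_iff[OF weyl_inj[OF wp_weyl], of x Upper] wp_Upper by simp

lemma Levi_iff: "a \<in> Levi \<longleftrightarrow> a \<in> Pos \<and> lvl a = 0"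
  using p pos_root by (auto simp: levi_pos_def weight_coroot_eq_0_iff)

lemma Upper_iff: "a \<in> Upper \<longleftrightarrow> a \<in> Pos \<and> lvl a \<noteq> 0"
  using Levi_iff by blast

lemma Del_Levi: "Del p \<subseteq> Levi"
  unfolding Del_eq[OF p] using simple_levi_pos[of "II - {p}"] by blast

lemma inversions_flip: "w \<in> W \<Longrightarrow> a \<in> Inv (flip w) \<longleftrightarrow> a \<in> Pos \<and> w (wp a) \<in> Pos"
  using w0_Pos_iff by (simp add: inversions_iff flip_def)

text \<open>On the roots of level 0 the inversions of \<open>w\<close> and of \<open>flip w\<close> correspond under \<open>- wp\<close>.\<close>
lemma inversions_flip_Levi: "w \<in> W \<Longrightarrow> a \<in> Levi \<Longrightarrow> a \<in> Inv (flip w) \<longleftrightarrow> - wp a \<in> Inv w"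
  using wp_Levi_iff[of a] levi_pos_pos
  by (auto simp: inversions_flip inversions_iff[of "- wp a"] weyl_uminus)

text \<open>On the positive roots of positive level it is the inversions of \<open>flip w\<close> and the non-inversions of \<open>w\<close>
  that correspond, under \<open>wp\<close>.\<close>
lemma inversions_flip_Upper: "w \<in> W \<Longrightarrow> a \<in> Upper \<Longrightarrow> a \<in> Inv (flip w) \<longleftrightarrow> wp a \<in> Upper - Inv w"
proof -
  assume w: "w \<in> W" and a: "a \<in> Upper"
  have u: "wp a \<in> Upper" using a wp_Upper_iff by blast
  hence "w (wp a) \<in> \<Phi>" using w weyl_root pos_root by blast
  hence "w (wp a) \<in> Pos \<longleftrightarrow> - w (wp a) \<notin> Pos" using not_pos_iff by blast
  thus ?thesis using a u inversions_flip[OF w, of a] inversions_iff[of "wp a" w] by blast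
qed

lemma flip_admissible:
  assumes "w \<in> Adm p"
  shows "flip w \<in> Adm p"
proof -
  have w: "w \<in> W" using assms by (simp add: admissible_iff)
  have "flip w a \<in> Simple \<or> - flip w a \<in> Pos" if a: "a \<in> Del p" for a
  proof -
    have d: "- wp a \<in> Del p" using a wp_Del_iff by blast
    have e: "flip w a = - w0 (w (- wp a))"
      by (simp add: flip_def weyl_uminus[OF w] weyl_uminus[OF w0_weyl])
    from d assms have "w (- wp a) \<in> Simple \<or> - w (- wp a) \<in> Pos" by (simp only: admissible_iff)
    thus ?thesis
    proof
      assume "w (- wp a) \<in> Simple"
      thus ?thesis unfolding e w0_simple_iff by blast
    next
      assume "- w (- wp a) \<in> Pos"
      hence "- w0 (- w (- wp a)) \<in> Pos" unfolding w0_Pos_iff .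
      hence "- flip w a \<in> Pos" unfolding e by (simp add: weyl_uminus[OF w0_weyl])
      thus ?thesis by blast
    qed
  qed
  thus ?thesis using flip_weyl[OF w] by (simp add: admissible_iff)
qed

lemma flip_bij: "bij_betw flip (Adm p) (Adm p)"
proof -
  have "inj_on flip (Adm p)"
  proof (rule inj_onI)
    fix v w assume eq: "flip v = flip w"
    have "v x = w x" for x
    proof -
      have "flip v (inv wp x) = flip w (inv wp x)" using eq by simp
      hence "w0 (v x) = w0 (w x)" by (simp add: flip_def weyl_inv(2)[OF wp_weyl])
      thus ?thesis using weyl_inj[OF w0_weyl] by (simp add: inj_eq)
    qed
    thus "v = w" by blast
  qed
  moreover from this have "flip ` Adm p = Adm p"
    using flip_admissible by (intro endo_inj_surj finite_admissible) auto
  ultimately show ?thesis by (simp add: bij_betw_def)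
qed

lemma axis_pairing_uminus: "axis_pairing p (- a) z = - axis_pairing p a z"
  by (simp add: axis_pairing_def coroot_uminus height_uminus)

lemma axis_pairing_wp: "axis_pairing p (wp a) (dual z) = - axis_pairing p a z"
  by (simp add: axis_pairing_def dual_def longest_parabolic_height[OF p wp] longest_parabolic_level[OF p wp]
        algebra_simps)

text \<open>The map \<open>- w0\<close> permutes the simple roots over which the product extends.\<close>
lemma rational_factor_flip:
  assumes w: "w \<in> W"
  shows "(\<Prod>b\<in>{b\<in>Simple. inv (flip w) b \<notin> Del p}. 1 / (axis_pairing p (inv (flip w) b) z - 1)) =
     (\<Prod>b\<in>{b\<in>Simple. inv w b \<notin> Del p}. 1 / (axis_pairing p (inv w b) (dual z) - 1))"
proof -
  have fw: "flip w \<in> W" by (rule flip_weyl[OF w])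
  have key: "inv w b = - wp (inv (flip w) (- w0 b))" for b
  proof -
    define g where "g = inv (flip w) (- w0 b)"
    have "flip w g = - w0 b" by (simp add: g_def weyl_inv(2)[OF fw])
    hence "w0 (w (wp g)) = w0 (- b)" by (simp add: flip_def weyl_uminus[OF w0_weyl])
    hence "w (wp g) = - b" using weyl_inj[OF w0_weyl] by (simp add: inj_eq)
    hence "w (- wp g) = w (inv w b)" by (simp add: weyl_uminus[OF w] weyl_inv(2)[OF w])
    thus ?thesis using weyl_inj[OF w] unfolding g_def by (simp only: inj_eq)
  qed
  have del: "inv w b \<in> Del p \<longleftrightarrow> inv (flip w) (- w0 b) \<in> Del p" for b
    unfolding key[of b] wp_Del_iff ..
  have img: "{b\<in>Simple. inv (flip w) b \<notin> Del p} = (\<lambda>b. - w0 b) ` {b\<in>Simple. inv w b \<notin> Del p}"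
    unfolding del by (rule image_Collect_stable[OF w0_simple, symmetric])
  have inj: "inj_on (\<lambda>b. - w0 b) {b\<in>Simple. inv w b \<notin> Del p}"
    using neg_weyl_inj[OF w0_weyl] by (rule inj_on_subset) auto
  show ?thesis unfolding img prod.reindex[OF inj] o_def
  proof (rule prod.cong[OF refl])
    fix b
    have "axis_pairing p (inv w b) (dual z) = axis_pairing p (inv (flip w) (- w0 b)) z"
      unfolding key[of b] axis_pairing_uminus axis_pairing_wp by simp
    thus "1 / (axis_pairing p (inv (flip w) (- w0 b)) z - 1) = 1 / (axis_pairing p (inv w b) (dual z) - 1)"
      by simp
  qed
qed

lemma prod_flip_Levi:
  assumes w: "w \<in> W"
  shows "(\<Prod>a\<in>(Inv (flip w) - D) \<inter> Levi. f (axis_pairing p a z)) =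
     (\<Prod>a\<in>(Inv w - (\<lambda>b. - wp b) ` D) \<inter> Levi. f (axis_pairing p a (dual z)))"
proof -
  let ?f = "\<lambda>b. - wp b"
  have "?f b \<in> Inv w - ?f ` D \<longleftrightarrow> b \<in> Inv (flip w) - D" if "b \<in> Levi" for b
    using inversions_flip_Levi[OF w that] inj_image_mem_iff[OF neg_weyl_inj[OF wp_weyl], of b D] by simp
  hence "{b \<in> Levi. ?f b \<in> Inv w - ?f ` D} = (Inv (flip w) - D) \<inter> Levi" by blast
  moreover have "{x \<in> Levi. x \<in> Inv w - ?f ` D} = (Inv w - ?f ` D) \<inter> Levi" by blast
  ultimately have img: "(Inv w - ?f ` D) \<inter> Levi = ?f ` ((Inv (flip w) - D) \<inter> Levi)"
    using image_Collect_stable[OF wp_Levi, of "\<lambda>x. x \<in> Inv w - ?f ` D"] by (simp only:)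
  have inj: "inj_on (\<lambda>b. - wp b) ((Inv (flip w) - D) \<inter> Levi)"
    using neg_weyl_inj[OF wp_weyl] by (rule inj_on_subset) auto
  show ?thesis unfolding img prod.reindex[OF inj] o_def axis_pairing_uminus axis_pairing_wp by simp
qed

lemma card_flip_Del:
  assumes w: "w \<in> W"
  shows "card (Inv (flip w) \<inter> Del p) = card (Inv w \<inter> Del p)"
proof -
  have "Inv (flip w) \<inter> Del p = {b \<in> Del p. - wp b \<in> Inv w}"
    using inversions_flip_Levi[OF w] Del_Levi by blast
  hence "Inv w \<inter> Del p = (\<lambda>b. - wp b) ` (Inv (flip w) \<inter> Del p)"
    using image_Collect_stable[OF wp_Del, of "\<lambda>x. x \<in> Inv w"] by blast
  moreover have "inj_on (\<lambda>b. - wp b) (Inv (flip w) \<inter> Del p)"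
    using neg_weyl_inj[OF wp_weyl] by (rule inj_on_subset) auto
  ultimately show ?thesis by (simp only: card_image)
qed

lemma image_flip_Upper:
  assumes w: "w \<in> W"
  shows "wp ` (Inv (flip w) \<inter> Upper) = Upper - Inv w"
proof -
  have "Inv (flip w) \<inter> Upper = {b \<in> Upper. wp b \<notin> Inv w}"
    using inversions_flip_Upper[OF w] wp_Upper_iff by blast
  thus ?thesis using image_Collect_stable[OF wp_Upper, of "\<lambda>x. x \<notin> Inv w"] by blast
qed

lemma prod_flip_Upper:
  assumes w: "w \<in> W"
  shows "(\<Prod>a\<in>Inv (flip w) \<inter> Upper. f (axis_pairing p a z)) =
     (\<Prod>b\<in>Upper - Inv w. f (- axis_pairing p b (dual z)))"
proof -
  have inj: "inj_on wp (Inv (flip w) \<inter> Upper)"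
    using weyl_inj[OF wp_weyl] by (rule inj_on_subset) auto
  show ?thesis unfolding image_flip_Upper[OF w, symmetric] prod.reindex[OF inj] o_def axis_pairing_wp by simp
qed

lemma prod_split_Levi:
  assumes "finite A" "A \<subseteq> Pos"
  shows "(\<Prod>a\<in>A. f a) = (\<Prod>a\<in>A \<inter> Levi. f a) * (\<Prod>a\<in>A \<inter> Upper. f a :: complex)"
proof -
  have "A = (A \<inter> Levi) \<union> (A \<inter> Upper)" using assms(2) by blast
  hence "(\<Prod>a\<in>A. f a) = (\<Prod>a\<in>(A \<inter> Levi) \<union> (A \<inter> Upper). f a)" by simp
  also have "\<dots> = (\<Prod>a\<in>A \<inter> Levi. f a) * (\<Prod>a\<in>A \<inter> Upper. f a)"
    using assms(1) by (intro prod.union_disjoint) auto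
  finally show ?thesis .
qed

lemma generic_Upper:
  assumes "generic p z" "a \<in> Upper"
  shows "axis_pairing p a z \<notin> \<int>" "completed_zeta (axis_pairing p a z) \<noteq> 0"
    "completed_zeta (axis_pairing p a z + 1) \<noteq> 0"
proof -
  have "a \<in> \<Phi>" "lvl a \<noteq> 0" using assms(2) Upper_iff pos_root by blast+
  thus "axis_pairing p a z \<notin> \<int>" "completed_zeta (axis_pairing p a z) \<noteq> 0"
    "completed_zeta (axis_pairing p a z + 1) \<noteq> 0"
    using assms(1) by (auto simp: generic_def xi_good_def)
qed

text \<open>The factors of level 0 agree. At positive level the factors of \<open>flip w\<close> belong to the non-inversions of
  \<open>w\<close>, and by the functional equation of \<open>\<xi>\<close> numerators and denominators are exchanged. Multiplying by all
  denominators and dividing by all numerators turns them into the factors of \<open>w\<close> itself.\<close>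
lemma axis_term_flip:
  assumes w: "w \<in> W" and z: "generic p (dual z)"
  shows "axis_term p (flip w) z * (\<Prod>b\<in>Upper. completed_zeta (axis_pairing p b (dual z))) =
     axis_term p w (dual z) * (\<Prod>b\<in>Upper. completed_zeta (axis_pairing p b (dual z) + 1))"
proof -
  let ?x = "\<lambda>b. axis_pairing p b (dual z)" and ?\<xi> = completed_zeta
  have IP: "Inv v \<subseteq> Pos" for v by (auto simp: inversions_iff)
  have DU: "(Inv v - Del p) \<inter> Upper = Inv v \<inter> Upper" for v using Del_Levi by blast
  define R where "R = (\<Prod>b\<in>{b\<in>Simple. inv w b \<notin> Del p}. 1 / (?x (inv w b) - 1)) * xi_reg 0 ^ card (Inv w \<inter> Del p)"
  define N M where "N = (\<Prod>a\<in>(Inv w - Del p) \<inter> Levi. ?\<xi> (?x a))" and "M = (\<Prod>a\<in>Inv w \<inter> Levi. ?\<xi> (?x a + 1))"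
  define A A' where "A = (\<Prod>b\<in>Upper \<inter> Inv w. ?\<xi> (?x b))" and "A' = (\<Prod>b\<in>Upper \<inter> Inv w. ?\<xi> (?x b + 1))"
  define B B' where "B = (\<Prod>b\<in>Upper - Inv w. ?\<xi> (?x b))" and "B' = (\<Prod>b\<in>Upper - Inv w. ?\<xi> (?x b + 1))"
  have nz: "A' \<noteq> 0" "B \<noteq> 0" using generic_Upper[OF z] by (auto simp: A'_def B_def prod_zero_iff)
  have U: "(\<Prod>b\<in>Upper. ?\<xi> (?x b)) = A * B" "(\<Prod>b\<in>Upper. ?\<xi> (?x b + 1)) = A' * B'"
    unfolding A_def B_def A'_def B'_def
    by (subst prod.union_disjoint[symmetric]; (intro prod.cong)?; auto)+
  have t1: "axis_term p w (dual z) = R * (N * A / (M * A'))"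
    unfolding axis_term_def
    by (subst (2 3) prod_split_Levi) (use IP in \<open>auto simp: DU R_def N_def M_def A_def A'_def Int_commute\<close>)
  have f1: "(\<Prod>a\<in>(Inv (flip w) - Del p) \<inter> Levi. ?\<xi> (axis_pairing p a z)) = N"
    using prod_flip_Levi[OF w, where D = "Del p" and f = ?\<xi> and z = z] by (simp only: N_def wp_Del)
  have f2: "(\<Prod>a\<in>Inv (flip w) \<inter> Levi. ?\<xi> (axis_pairing p a z + 1)) = M"
    using prod_flip_Levi[OF w, where D = "{}" and f = "\<lambda>x. ?\<xi> (x + 1)" and z = z] by (simp add: M_def)
  have "(\<Prod>a\<in>Inv (flip w) \<inter> Upper. ?\<xi> (axis_pairing p a z)) = (\<Prod>b\<in>Upper - Inv w. ?\<xi> (- ?x b))"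
    by (rule prod_flip_Upper[OF w])
  also have "\<dots> = B'" unfolding B'_def
  proof (rule prod.cong[OF refl])
    fix b assume "b \<in> Upper - Inv w"
    hence "- ?x b \<notin> \<int>" using generic_Upper(1)[OF z] by auto
    from completed_zeta_reflection[OF this] show "?\<xi> (- ?x b) = ?\<xi> (?x b + 1)" by (simp add: add.commute)
  qed
  finally have f3: "(\<Prod>a\<in>Inv (flip w) \<inter> Upper. ?\<xi> (axis_pairing p a z)) = B'" .
  have "(\<Prod>a\<in>Inv (flip w) \<inter> Upper. ?\<xi> (axis_pairing p a z + 1)) = (\<Prod>b\<in>Upper - Inv w. ?\<xi> (- ?x b + 1))"
    by (rule prod_flip_Upper[OF w, of "\<lambda>x. ?\<xi> (x + 1)"])
  also have "\<dots> = B" unfolding B_def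
  proof (rule prod.cong[OF refl])
    fix b assume "b \<in> Upper - Inv w"
    hence "?x b \<notin> \<int>" using generic_Upper(1)[OF z] by auto
    from completed_zeta_reflection[OF this] show "?\<xi> (- ?x b + 1) = ?\<xi> (?x b)" by simp
  qed
  finally have f4: "(\<Prod>a\<in>Inv (flip w) \<inter> Upper. ?\<xi> (axis_pairing p a z + 1)) = B" .
  have n: "(\<Prod>a\<in>Inv (flip w) - Del p. ?\<xi> (axis_pairing p a z)) = N * B'"
    by (subst prod_split_Levi) (use IP f1 f3 in \<open>auto simp: DU\<close>)
  have d: "(\<Prod>a\<in>Inv (flip w). ?\<xi> (axis_pairing p a z + 1)) = M * B"
    by (subst prod_split_Levi) (use IP f2 f4 in auto)
  have t2: "axis_term p (flip w) z = R * (N * B' / (M * B))"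
    unfolding axis_term_def n d rational_factor_flip[OF w] card_flip_Del[OF w] R_def by simp
  show ?thesis unfolding t1 t2 U using nz by (simp add: divide_simps mult_ac)
qed

end

section \<open>Exponents of the completed zeta function\<close>

lemma prod_group_power:
  fixes F :: "'b \<Rightarrow> 'c::comm_monoid_mult"
  assumes "finite S" "finite T" "g ` S \<subseteq> T"
  shows "(\<Prod>x\<in>S. F (g x)) = (\<Prod>y\<in>T. F y ^ card {x\<in>S. g x = y})"
proof -
  have "(\<Prod>x\<in>S. F (g x)) = (\<Prod>y\<in>T. \<Prod>x | x \<in> S \<and> g x = y. F (g x))"
    by (rule prod.group[OF assms, symmetric])
  also have "\<dots> = (\<Prod>y\<in>T. F y ^ card {x\<in>S. g x = y})"
    by (intro prod.cong refl) simp
  finally show ?thesis .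
qed

context parabolic_flip
begin

text \<open>Numbers of roots by level and height. The arguments are real, so that neighbouring heights can be
  written as differences without truncation.\<close>
definition cnt :: "('a \<Rightarrow> 'a) \<Rightarrow> real \<Rightarrow> real \<Rightarrow> nat" where
  "cnt w k x = card {a \<in> Inv w. lvl a = k \<and> ht a = x}"
definition tot :: "real \<Rightarrow> real \<Rightarrow> nat" where
  "tot k x = card {a \<in> Pos. lvl a = k \<and> ht a = x}"

lemma lvl_wp: "lvl (wp a) = lvl a" and ht_wp: "ht (wp a) = c * lvl a - ht a"
  using longest_parabolic_level[OF p wp] longest_parabolic_height[OF p wp] by auto

lemma tot_symmetric:
  assumes "k \<noteq> 0"
  shows "tot k (c * k - x) = tot k x"
proof -
  have U: "{a \<in> Pos. lvl a = k \<and> ht a = y} = {a \<in> Upper. lvl a = k \<and> ht a = y}" for y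
    using assms Upper_iff by blast
  have "lvl (wp a) = k \<and> ht (wp a) = c * k - x \<longleftrightarrow> lvl a = k \<and> ht a = x" for a
    by (auto simp: lvl_wp ht_wp)
  from image_Collect_stable[OF wp_Upper, of "\<lambda>a. lvl a = k \<and> ht a = c * k - x", unfolded this]
  have "wp ` {a \<in> Pos. lvl a = k \<and> ht a = x} = {a \<in> Pos. lvl a = k \<and> ht a = c * k - x}"
    unfolding U .
  moreover have "inj_on wp {a \<in> Pos. lvl a = k \<and> ht a = x}"
    using weyl_inj[OF wp_weyl] by (rule inj_on_subset) auto
  from card_image[OF this]
  have "card (wp ` {a \<in> Pos. lvl a = k \<and> ht a = x}) = tot k x" by (simp only: tot_def)
  ultimately show ?thesis by (simp only: tot_def)
qed

lemma cnt_flip: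
  assumes w: "w \<in> W" and k: "k \<noteq> 0"
  shows "cnt (flip w) k x + cnt w k (c * k - x) = tot k (c * k - x)"
proof -
  have IP: "Inv v \<subseteq> Pos" for v by (auto simp: inversions_iff)
  have "{a \<in> Inv (flip w). lvl a = k \<and> ht a = x} = {a \<in> Inv (flip w) \<inter> Upper. lvl a = k \<and> ht a = x}"
    using IP k Upper_iff by blast
  moreover have "wp ` {a \<in> Inv (flip w) \<inter> Upper. lvl a = k \<and> ht a = x} =
      {b \<in> wp ` (Inv (flip w) \<inter> Upper). lvl b = k \<and> ht b = c * k - x}"
    by (auto simp: lvl_wp ht_wp)
  ultimately have img: "wp ` {a \<in> Inv (flip w). lvl a = k \<and> ht a = x} =
      {a \<in> Upper - Inv w. lvl a = k \<and> ht a = c * k - x}"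
    by (simp only: image_flip_Upper[OF w])
  have "inj_on wp {a \<in> Inv (flip w). lvl a = k \<and> ht a = x}"
    using weyl_inj[OF wp_weyl] by (rule inj_on_subset) auto
  from card_image[OF this]
  have "cnt (flip w) k x = card {a \<in> Upper - Inv w. lvl a = k \<and> ht a = c * k - x}"
    by (simp only: cnt_def img)
  moreover have "{a \<in> Pos. lvl a = k \<and> ht a = c * k - x} =
     {a \<in> Upper - Inv w. lvl a = k \<and> ht a = c * k - x} \<union> {a \<in> Inv w. lvl a = k \<and> ht a = c * k - x}"
    using IP k Upper_iff by blast
  moreover have "card ({a \<in> Upper - Inv w. lvl a = k \<and> ht a = c * k - x} \<union> {a \<in> Inv w. lvl a = k \<and> ht a = c * k - x}) =
     card {a \<in> Upper - Inv w. lvl a = k \<and> ht a = c * k - x} + card {a \<in> Inv w. lvl a = k \<and> ht a = c * k - x}"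
    by (rule card_Un_disjoint) auto
  ultimately show ?thesis unfolding tot_def cnt_def by simp
qed

lemma xi_exponent_eq_cnt:
  assumes "k \<ge> 1"
  shows "xi_exponent \<Phi> \<alpha> p w k h = int (cnt w (real k) (real h)) - int (cnt w (real k) (real h - 1))"
proof -
  have "{a \<in> Inv w - simple_roots_except \<alpha> p. lvl a = real k \<and> ht a = real h} =
      {a \<in> Inv w. lvl a = real k \<and> ht a = real h}"
    using Del_Levi Levi_iff assms unfolding Del_def by fastforce
  thus ?thesis unfolding xi_exponent_def cnt_def by simp
qed

lemma Upper_height:
  assumes "a \<in> Upper"
  shows "1 \<le> ht a" "ht a \<le> c * lvl a - 1"
proof -
  have "a \<in> Pos" "wp a \<in> Pos" using assms wp_Upper_iff by blast+
  thus "1 \<le> ht a" "ht a \<le> c * lvl a - 1" using height_ge_1[of a] height_ge_1[of "wp a"] by (auto simp: ht_wp)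
qed

text \<open>The constant \<open>c\<^sub>p\<close> as a natural number.\<close>
definition cn :: nat where "cn = nat \<lfloor>c\<rfloor>"

lemma c_eq: "c = real cn"
proof -
  have l: "lvl (\<alpha> p) = 1" using fund_weight_coroot[OF p, of p] by (simp add: inner_commute)
  hence "\<alpha> p \<in> Upper" using simple_pos[OF p] by (simp add: Upper_iff del: Diff_iff)
  hence "c \<ge> 0" using Upper_height[of "\<alpha> p"] l by simp
  thus ?thesis using parabolic_const_int[OF p] unfolding cn_def by (auto elim!: Ints_cases)
qed

text \<open>The two inversion counts in the exponent are complemented, level by level, and the reflection
  \<open>h \<mapsto> c\<^sub>p k - h\<close> of the heights exchanges their roles.\<close>
lemma xi_exponent_flip:
  assumes w: "w \<in> W" and k: "k \<ge> 1" and h: "h + h' = cn * k + 1"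
  shows "xi_exponent \<Phi> \<alpha> p (flip w) k h' =
     xi_exponent \<Phi> \<alpha> p w k h + int (tot (real k) (real h - 1)) - int (tot (real k) (real h))"
proof -
  have "real h + real h' = real cn * real k + 1" using h by (metis of_nat_1 of_nat_add of_nat_mult)
  hence r: "c * real k - real h' = real h - 1" "c * real k - (real h' - 1) = real h" by (simp_all add: c_eq)
  have "real k \<noteq> 0" using k by simp
  from cnt_flip[OF w this, of "real h'"] cnt_flip[OF w this, of "real h' - 1"]
  show ?thesis unfolding r xi_exponent_eq_cnt[OF k] by linarith
qed

lemma id_admissible: "id \<in> Adm p"
  by (auto simp: admissible_iff weyl_group.weyl_id Del_def simple_roots_except_def)

lemma xi_exponent_id: "xi_exponent \<Phi> \<alpha> p id k h = 0"
proof -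
  have "Inv id = {}" using not_pos_and_neg by (auto simp: inversions_iff)
  thus ?thesis by (simp add: xi_exponent_def)
qed

lemma le_max_exponent:
  assumes "w \<in> Adm p"
  shows "- xi_exponent \<Phi> \<alpha> p w k h \<le> int (max_exponent \<Phi> \<alpha> p k h)"
proof -
  have "max 0 (- xi_exponent \<Phi> \<alpha> p w k h) \<le> Max ((\<lambda>w. max 0 (- xi_exponent \<Phi> \<alpha> p w k h)) ` Adm p)"
    using assms finite_admissible by (intro Max_ge) auto
  thus ?thesis unfolding max_exponent_def by linarith
qed

text \<open>The identity is admissible and all its exponents are 0, so that the maximum of the negated exponents
  over the admissible elements is nonnegative already. Hence a common shift of the exponents shifts the
  maximum by the same amount.\<close>
lemma max_exponent_le:
  assumes "\<And>w. w \<in> Adm p \<Longrightarrow> - xi_exponent \<Phi> \<alpha> p w k h \<le> B"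
  shows "int (max_exponent \<Phi> \<alpha> p k h) \<le> B"
proof -
  have "0 \<le> B" using assms[OF id_admissible] by (simp add: xi_exponent_id)
  moreover have "Max ((\<lambda>w. max 0 (- xi_exponent \<Phi> \<alpha> p w k h)) ` Adm p) \<le> B"
    using finite_admissible id_admissible assms \<open>0 \<le> B\<close> by (subst Max_le_iff) auto
  ultimately show ?thesis unfolding max_exponent_def by linarith
qed

lemma max_exponent_flip_le:
  assumes k: "k \<ge> 1" and h: "h + h' = cn * k + 1"
  shows "int (max_exponent \<Phi> \<alpha> p k h') \<le>
     int (max_exponent \<Phi> \<alpha> p k h) + int (tot (real k) (real h)) - int (tot (real k) (real h - 1))"
proof (rule max_exponent_le)
  fix v assume "v \<in> Adm p"
  then obtain w where w: "w \<in> Adm p" "v = flip w" using flip_bij by (auto simp: bij_betw_def)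
  have "w \<in> W" using w by (simp add: admissible_iff)
  thus "- xi_exponent \<Phi> \<alpha> p v k h' \<le>
     int (max_exponent \<Phi> \<alpha> p k h) + int (tot (real k) (real h)) - int (tot (real k) (real h - 1))"
    using le_max_exponent[OF w(1), of k h] unfolding w(2) by (simp add: xi_exponent_flip[OF _ k h])
qed

text \<open>Both inequalities are instances of the preceding lemma, since the reflection of the heights is an
  involution.\<close>
lemma max_exponent_flip:
  assumes k: "k \<ge> 1" and h: "h + h' = cn * k + 1"
  shows "max_exponent \<Phi> \<alpha> p k h' + tot (real k) (real h - 1) = max_exponent \<Phi> \<alpha> p k h + tot (real k) (real h)"
proof -
  have "real h + real h' = real cn * real k + 1" using h by (metis of_nat_1 of_nat_add of_nat_mult)
  hence r: "c * real k - real h' = real h - 1" "c * real k - (real h' - 1) = real h" by (simp_all add: c_eq)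
  have k0: "real k \<noteq> 0" using k by simp
  have "tot (real k) (real h') = tot (real k) (real h - 1)" "tot (real k) (real h' - 1) = tot (real k) (real h)"
    using tot_symmetric[OF k0, of "real h'"] tot_symmetric[OF k0, of "real h' - 1"] unfolding r by simp_all
  moreover have "h' + h = cn * k + 1" using h by simp
  ultimately show ?thesis
    using max_exponent_flip_le[OF k h] max_exponent_flip_le[OF k, of h' h] by linarith
qed

text \<open>All pairs \<open>(k, h)\<close> with \<open>k \<ge> 1\<close> for which \<open>\<xi>(k z + h)\<close> can occur lie in \<open>box\<close>, and \<open>box\<close> is stable under
  \<open>h \<mapsto> c\<^sub>p k + 1 - h\<close>.\<close>
definition levels :: "nat set" where "levels = {k. k \<ge> 1 \<and> (\<exists>a\<in>Pos. lvl a = real k)}"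
definition box :: "(nat \<times> nat) set" where "box = Sigma levels (\<lambda>k. {1..cn * k})"

lemma lvl_nat: "a \<in> Pos \<Longrightarrow> lvl a = real (nat \<lfloor>lvl a\<rfloor>)" and ht_nat: "a \<in> Pos \<Longrightarrow> ht a = real (nat \<lfloor>ht a\<rfloor>)"
  using weight_coroot_nat[OF _ p, of a] height_nat[of a] by (auto elim!: Nats_cases)

lemma finite_levels: "finite levels"
proof (rule finite_subset)
  show "levels \<subseteq> (\<lambda>a. nat \<lfloor>lvl a\<rfloor>) ` Pos"
  proof
    fix k assume "k \<in> levels"
    then obtain a where "a \<in> Pos" "lvl a = real k" by (auto simp: levels_def)
    thus "k \<in> (\<lambda>a. nat \<lfloor>lvl a\<rfloor>) ` Pos" by (intro image_eqI[of _ _ a]) auto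
  qed
qed simp

lemma finite_box [simp]: "finite box" using finite_levels by (simp add: box_def)

lemma Upper_in_box:
  assumes a: "a \<in> Upper"
  obtains k h where "lvl a = real k" "ht a = real h" "(k, h) \<in> box" "(k, Suc h) \<in> box"
proof -
  have aP: "a \<in> Pos" "lvl a \<noteq> 0" using a Upper_iff by blast+
  define k h where "k = nat \<lfloor>lvl a\<rfloor>" and "h = nat \<lfloor>ht a\<rfloor>"
  have kh: "lvl a = real k" "ht a = real h" using lvl_nat ht_nat aP unfolding k_def h_def by blast+
  have "k \<in> levels" using aP kh by (auto simp: levels_def)
  moreover have "1 \<le> real h" "real h \<le> real cn * real k - 1" using Upper_height[OF a] by (simp_all add: kh c_eq)
  hence "1 \<le> h" "Suc h \<le> cn * k" by (simp_all flip: of_nat_mult)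
  ultimately show ?thesis using that kh by (auto simp: box_def)
qed

text \<open>Both \<open>d = 0\<close> and \<open>d = 1\<close> occur: the arguments of \<open>\<xi>\<close> in the numerators and in the denominators.\<close>
lemma prod_Upper_eq_box:
  assumes "d \<le> 1"
  shows "(\<Prod>b\<in>Upper. completed_zeta (axis_pairing p b z + of_nat d)) =
     (\<Prod>(k, h)\<in>box. completed_zeta (of_nat k * z + of_nat h) ^ tot (real k) (real h - real d))"
proof -
  define F where "F = (\<lambda>(k, h). completed_zeta (of_nat k * z + of_nat h))"
  define K where "K a = nat \<lfloor>lvl a\<rfloor>" for a
  define H where "H a = nat \<lfloor>ht a\<rfloor>" for a
  have KH: "lvl a = real (K a)" "ht a = real (H a)" if "a \<in> Pos" for a
    unfolding K_def H_def by (rule lvl_nat[OF that], rule ht_nat[OF that])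
  define g where "g a = (K a, H a + d)" for a
  have "g a \<in> box" if a: "a \<in> Upper" for a
  proof -
    obtain k h where kh: "lvl a = real k" "ht a = real h" "(k, h) \<in> box" "(k, Suc h) \<in> box"
      using Upper_in_box[OF a] .
    hence "K a = k" "H a = h" by (simp_all add: K_def H_def)
    moreover have "d = 0 \<or> d = 1" using assms by auto
    ultimately show ?thesis using kh by (auto simp: g_def)
  qed
  hence im: "g ` Upper \<subseteq> box" by blast
  have v: "completed_zeta (axis_pairing p a z + of_nat d) = F (g a)" if "a \<in> Upper" for a
  proof -
    have "a \<in> Pos" using that by blast
    thus ?thesis by (simp add: axis_pairing_def KH F_def g_def add.assoc)
  qed
  have card: "card {a \<in> Upper. g a = (k, h)} = tot (real k) (real h - real d)" if "(k, h) \<in> box" for k h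
  proof -
    have k0: "k \<noteq> 0" using that by (auto simp: box_def levels_def)
    have "g a = (k, h) \<longleftrightarrow> lvl a = real k \<and> ht a = real h - real d" if "a \<in> Pos" for a
      using KH[OF that] by (auto simp: g_def)
    moreover have "a \<in> Upper" if "a \<in> Pos" "lvl a = real k" for a using that k0 Upper_iff by force
    ultimately have "{a \<in> Upper. g a = (k, h)} = {a \<in> Pos. lvl a = real k \<and> ht a = real h - real d}"
      by blast
    thus ?thesis by (simp add: tot_def)
  qed
  have "(\<Prod>b\<in>Upper. completed_zeta (axis_pairing p b z + of_nat d)) = (\<Prod>b\<in>Upper. F (g b))"
    by (intro prod.cong refl v)
  also have "\<dots> = (\<Prod>x\<in>box. F x ^ card {b\<in>Upper. g b = x})"
    by (rule prod_group_power[OF _ finite_box im]) simp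
  also have "\<dots> = (\<Prod>(k, h)\<in>box. completed_zeta (of_nat k * z + of_nat h) ^ tot (real k) (real h - real d))"
    by (rule prod.cong[OF refl]) (auto simp: F_def card simp del: Diff_iff)
  finally show ?thesis .
qed

text \<open>The product that cancels the denominators of the residue.\<close>
definition clearing :: "complex \<Rightarrow> complex" where
  "clearing z = (\<Prod>(k, h)\<in>{(k, h). h \<ge> 1 \<and> max_exponent \<Phi> \<alpha> p k h \<noteq> 0}.
        completed_zeta (of_nat k * z + of_nat h) ^ max_exponent \<Phi> \<alpha> p k h)"

lemma max_exponent_support:
  assumes "max_exponent \<Phi> \<alpha> p k h \<noteq> 0"
  shows "\<exists>a\<in>Pos. lvl a = real k \<and> (ht a = real h \<or> ht a = real h - 1)"
proof (rule ccontr)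
  assume no: "\<not> ?thesis"
  have "int (max_exponent \<Phi> \<alpha> p k h) \<le> 0"
  proof (rule max_exponent_le)
    fix w
    have "\<not> (lvl a = real k \<and> (ht a = real h \<or> ht a = real h - 1))" if "a \<in> Inv w" for a
      using that no inversions_iff by blast
    hence "{a \<in> Inv w. lvl a = real k \<and> ht a = real h - 1} = {}"
      "{a \<in> Inv w - simple_roots_except \<alpha> p. lvl a = real k \<and> ht a = real h} = {}"
      by blast+
    thus "- xi_exponent \<Phi> \<alpha> p w k h \<le> 0" unfolding xi_exponent_def by (simp only: card.empty)
  qed
  thus False using assms by simp
qed

text \<open>The factors of level 0 do not depend on \<open>z\<close>.\<close>
lemma clearing_eq: "\<exists>C. \<forall>z. clearing z =
    C * (\<Prod>(k, h)\<in>box. completed_zeta (of_nat k * z + of_nat h) ^ max_exponent \<Phi> \<alpha> p k h)"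
proof -
  define T where "T = {(k, h). h \<ge> 1 \<and> max_exponent \<Phi> \<alpha> p k h \<noteq> 0}"
  define T0 where "T0 = {x\<in>T. fst x = 0}"
  define T1 where "T1 = {x\<in>T. fst x \<noteq> 0}"
  have fT: "finite T"
  proof (rule finite_subset)
    show "T \<subseteq> (\<Union>a\<in>Pos. {(nat \<lfloor>lvl a\<rfloor>, nat \<lfloor>ht a\<rfloor>), (nat \<lfloor>lvl a\<rfloor>, Suc (nat \<lfloor>ht a\<rfloor>))})"
    proof (intro subsetI)
      fix x assume "x \<in> T"
      then obtain k h where x: "x = (k, h)" "h \<ge> 1" "max_exponent \<Phi> \<alpha> p k h \<noteq> 0" by (auto simp: T_def)
      obtain a where a: "a \<in> Pos" "lvl a = real k" "ht a = real h \<or> ht a = real h - 1"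
        using max_exponent_support[OF x(3)] by blast
      have "real h - 1 = real (h - 1)" using x by simp
      hence "nat \<lfloor>lvl a\<rfloor> = k" "nat \<lfloor>ht a\<rfloor> = h \<or> Suc (nat \<lfloor>ht a\<rfloor>) = h" using a x(2) by auto
      thus "x \<in> (\<Union>a\<in>Pos. {(nat \<lfloor>lvl a\<rfloor>, nat \<lfloor>ht a\<rfloor>), (nat \<lfloor>lvl a\<rfloor>, Suc (nat \<lfloor>ht a\<rfloor>))})"
        using a(1) x(1) by auto
    qed
  qed simp
  have T1: "T1 \<subseteq> box"
  proof
    fix x assume "x \<in> T1"
    then obtain k h where x: "x = (k, h)" "k \<noteq> 0" "h \<ge> 1" "max_exponent \<Phi> \<alpha> p k h \<noteq> 0"
      by (auto simp: T1_def T_def)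
    obtain a where a: "a \<in> Pos" "lvl a = real k" "ht a = real h \<or> ht a = real h - 1"
      using max_exponent_support[OF x(4)] by blast
    have "lvl a \<noteq> 0" using a x by simp
    hence "a \<in> Upper" using a(1) Upper_iff by blast
    from Upper_height(2)[OF this] have "real h \<le> real (cn * k)" using a by (auto simp: c_eq)
    hence "h \<le> cn * k" by (simp only: of_nat_le_iff)
    moreover have "k \<in> levels" using a x(2) unfolding levels_def by force
    ultimately show "x \<in> box" using x by (simp add: box_def)
  qed
  define C where "C = (\<Prod>(k, h)\<in>T0. completed_zeta (of_nat h) ^ max_exponent \<Phi> \<alpha> p k h)"
  have "clearing z = C * (\<Prod>(k, h)\<in>box. completed_zeta (of_nat k * z + of_nat h) ^ max_exponent \<Phi> \<alpha> p k h)" for z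
  proof -
    let ?f = "\<lambda>(k, h). completed_zeta (of_nat k * z + of_nat h) ^ max_exponent \<Phi> \<alpha> p k h"
    have "clearing z = prod ?f T" by (simp add: clearing_def T_def)
    also have "T = T0 \<union> T1" by (auto simp: T0_def T1_def)
    also have "prod ?f \<dots> = prod ?f T0 * prod ?f T1"
      using fT by (intro prod.union_disjoint) (auto simp: T0_def T1_def)
    also have "prod ?f T0 = C" unfolding C_def by (intro prod.cong) (auto simp: T0_def)
    also have "prod ?f T1 = prod ?f box"
    proof (rule prod.mono_neutral_left[OF finite_box T1])
      show "\<forall>x\<in>box - T1. ?f x = 1"
      proof
        fix x assume x: "x \<in> box - T1"
        obtain k h where kh: "x = (k, h)" by (cases x)
        hence "max_exponent \<Phi> \<alpha> p k h = 0" using x by (auto simp: T1_def T_def box_def levels_def)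
        thus "?f x = 1" by (simp add: kh)
      qed
    qed
    finally show ?thesis .
  qed
  thus ?thesis by blast
qed

text \<open>The functional equation of \<open>\<xi>\<close> moves the exponent at \<open>(k, h)\<close> to \<open>(k, c\<^sub>p k + 1 - h)\<close>, where it differs
  from the exponent there by a number of roots. This difference makes up exactly for the factor by which
  the terms of \<open>w\<close> and \<open>flip w\<close> differ.\<close>
lemma clearing_flip:
  assumes z: "generic p (dual z)"
  shows "clearing z * (\<Prod>b\<in>Upper. completed_zeta (axis_pairing p b (dual z) + 1)) =
     clearing (dual z) * (\<Prod>b\<in>Upper. completed_zeta (axis_pairing p b (dual z)))"
proof -
  let ?\<xi> = "\<lambda>k h. completed_zeta (of_nat k * dual z + of_nat h)"
  let ?m = "max_exponent \<Phi> \<alpha> p"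
  obtain C where C: "\<And>z. clearing z = C * (\<Prod>(k, h)\<in>box. completed_zeta (of_nat k * z + of_nat h) ^ ?m k h)"
    using clearing_eq by blast
  define r where "r = (\<lambda>(k, h). (k, cn * k + 1 - h) :: nat \<times> nat)"
  have r_box: "r x \<in> box" "r (r x) = x" if "x \<in> box" for x
    using that by (auto simp: r_def box_def)
  have "bij_betw r box box" by (rule bij_betw_byWitness[where f' = r]) (use r_box in auto)
  hence "(\<Prod>(k, h)\<in>box. completed_zeta (of_nat k * z + of_nat h) ^ ?m k h) =
      (\<Prod>x\<in>box. case r x of (k, h) \<Rightarrow> completed_zeta (of_nat k * z + of_nat h) ^ ?m k h)"
    by (rule prod.reindex_bij_betw[symmetric])
  also have "\<dots> = (\<Prod>(k, h)\<in>box. ?\<xi> k h ^ ?m k (cn * k + 1 - h))"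
  proof (rule prod.cong[OF refl])
    fix x assume "x \<in> box"
    then obtain k h where x: "x = (k, h)" "k \<in> levels" "h \<ge> 1" "h \<le> cn * k" by (auto simp: box_def)
    define h' where "h' = cn * k + 1 - h"
    have "h + h' = cn * k + 1" using x by (simp add: h'_def)
    hence hh: "of_nat h + of_nat h' = (of_nat cn * of_nat k + 1 :: complex)"
      by (metis of_nat_1 of_nat_add of_nat_mult)
    have dz: "dual z = - of_nat cn - z" by (simp add: dual_def c_eq)
    have e: "of_nat k * z + of_nat h' = 1 - (of_nat k * dual z + of_nat h)"
      using hh unfolding dz by (simp add: algebra_simps)
    obtain a where a: "a \<in> Pos" "lvl a = real k" "k \<ge> 1" using x(2) by (auto simp: levels_def)
    hence "axis_pairing p a (dual z) \<notin> \<int>" using z pos_root by (auto simp: generic_def)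
    moreover have "ht a \<in> \<int>" using ht_nat[OF a(1)] by (metis Ints_of_nat)
    hence "complex_of_real (ht a) \<in> \<int>" by (auto elim!: Ints_cases)
    ultimately have "of_nat k * dual z \<notin> \<int>" using a by (auto simp: axis_pairing_def)
    hence "of_nat k * dual z + of_nat h \<notin> \<int>" by simp
    from completed_zeta_reflection[OF this] have "completed_zeta (of_nat k * z + of_nat h') = ?\<xi> k h" by (simp only: e)
    thus "(case r x of (k, h) \<Rightarrow> completed_zeta (of_nat k * z + of_nat h) ^ ?m k h) =
        (case x of (k, h) \<Rightarrow> ?\<xi> k h ^ ?m k (cn * k + 1 - h))"
      by (simp add: x(1) r_def h'_def)
  qed
  finally have 1: "clearing z = C * (\<Prod>(k, h)\<in>box. ?\<xi> k h ^ ?m k (cn * k + 1 - h))" using C[of z] by simp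
  have "(\<Prod>(k, h)\<in>box. ?\<xi> k h ^ ?m k (cn * k + 1 - h)) * (\<Prod>(k, h)\<in>box. ?\<xi> k h ^ tot (real k) (real h - 1)) =
      (\<Prod>(k, h)\<in>box. ?\<xi> k h ^ ?m k h) * (\<Prod>(k, h)\<in>box. ?\<xi> k h ^ tot (real k) (real h))"
    unfolding prod.distrib[symmetric]
  proof (rule prod.cong[OF refl])
    fix x assume "x \<in> box"
    then obtain k h where x: "x = (k, h)" "k \<ge> 1" "h \<ge> 1" "h \<le> cn * k" by (auto simp: box_def levels_def)
    have "?m k (cn * k + 1 - h) + tot (real k) (real h - 1) = ?m k h + tot (real k) (real h)"
      using x by (intro max_exponent_flip) auto
    thus "(case x of (k, h) \<Rightarrow> ?\<xi> k h ^ ?m k (cn * k + 1 - h)) * (case x of (k, h) \<Rightarrow> ?\<xi> k h ^ tot (real k) (real h - 1)) =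
        (case x of (k, h) \<Rightarrow> ?\<xi> k h ^ ?m k h) * (case x of (k, h) \<Rightarrow> ?\<xi> k h ^ tot (real k) (real h))"
      unfolding x(1) prod.case power_add[symmetric] by simp
  qed
  thus ?thesis unfolding 1 C[of "dual z"]
    using prod_Upper_eq_box[of 0 "dual z"] prod_Upper_eq_box[of 1 "dual z"] by (simp add: mult.assoc del: Diff_iff)
qed

theorem weng_zeta_unnormalized_dual:
  assumes "generic p z" "generic p (dual z)"
  shows "weng_zeta_unnormalized \<Phi> \<alpha> p z 0 = weng_zeta_unnormalized \<Phi> \<alpha> p (dual z) 0"
proof -
  let ?A = "Adm p"
  define E where "E = (\<Prod>b\<in>Upper. completed_zeta (axis_pairing p b (dual z)))"
  define E' where "E' = (\<Prod>b\<in>Upper. completed_zeta (axis_pairing p b (dual z) + 1))"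
  have E0: "E \<noteq> 0" using generic_Upper(2)[OF assms(2)] by (simp add: E_def prod_zero_iff del: Diff_iff)
  have u: "weng_zeta_unnormalized \<Phi> \<alpha> p x 0 = (\<Sum>w\<in>?A. axis_term p w x) * clearing x" if "generic p x" for x
    by (simp add: weng_zeta_unnormalized_def clearing_def parabolic_period_eq[OF p that])
  have "(\<Sum>w\<in>?A. axis_term p w z) = (\<Sum>w\<in>?A. axis_term p (flip w) z)"
    by (rule sum.reindex_bij_betw[OF flip_bij, symmetric])
  hence "(\<Sum>w\<in>?A. axis_term p w z) * E = (\<Sum>w\<in>?A. axis_term p (flip w) z * E)"
    by (simp add: sum_distrib_right)
  also have "\<dots> = (\<Sum>w\<in>?A. axis_term p w (dual z) * E')"
    unfolding E_def E'_def by (intro sum.cong refl axis_term_flip assms(2)) (simp add: admissible_iff)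
  also have "\<dots> = (\<Sum>w\<in>?A. axis_term p w (dual z)) * E'" by (simp add: sum_distrib_right)
  finally have S: "(\<Sum>w\<in>?A. axis_term p w z) * E = (\<Sum>w\<in>?A. axis_term p w (dual z)) * E'" .
  have "weng_zeta_unnormalized \<Phi> \<alpha> p z 0 * E = ((\<Sum>w\<in>?A. axis_term p w z) * E) * clearing z"
    unfolding u[OF assms(1)] by (simp only: mult_ac)
  also have "\<dots> = (\<Sum>w\<in>?A. axis_term p w (dual z)) * (clearing z * E')" unfolding S by (simp only: mult_ac)
  also have "clearing z * E' = clearing (dual z) * E"
    unfolding E_def E'_def by (rule clearing_flip[OF assms(2)])
  also have "(\<Sum>w\<in>?A. axis_term p w (dual z)) * (clearing (dual z) * E) = weng_zeta_unnormalized \<Phi> \<alpha> p (dual z) 0 * E"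
    unfolding u[OF assms(2)] by (simp only: mult_ac)
  finally show ?thesis using E0 by simp
qed

end

section \<open>Invariance under diagram automorphisms\<close>

context diagram_symmetry
begin

lemma L_mem_iff: "L ` A = A \<Longrightarrow> L x \<in> A \<longleftrightarrow> x \<in> A"
  using inj_image_mem_iff[OF L_inj, of x A] by simp

lemma L_simple_roots: "L ` Simple = Simple"
proof -
  have "L ` Simple = (\<lambda>i. \<alpha> (\<sigma> i)) ` II"
    unfolding simple_roots_II image_image by (intro image_cong) (auto simp: L_simple)
  also have "\<dots> = \<alpha> ` (\<sigma> ` II)" by (simp add: image_image)
  finally show ?thesis using permutes_image[OF perm] by (simp add: simple_roots_II)
qed

lemma L_Del: "p \<in> II \<Longrightarrow> L ` Del p = Del (\<sigma> p)"
proof -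
  assume p: "p \<in> II"
  have "L ` Del p = (\<lambda>i. \<alpha> (\<sigma> i)) ` (II - {p})"
    unfolding Del_eq[OF p] image_image by (intro image_cong) (auto simp: L_simple)
  also have "\<dots> = \<alpha> ` (\<sigma> ` (II - {p}))" by (simp add: image_image)
  also have "\<sigma> ` (II - {p}) = II - {\<sigma> p}"
    using permutes_image[OF perm] by (simp add: image_set_diff permutes_inj[OF perm])
  finally show ?thesis using p by (simp add: Del_eq)
qed

lemma L_Del_iff: "p \<in> II \<Longrightarrow> L x \<in> Del (\<sigma> p) \<longleftrightarrow> x \<in> Del p"
  using inj_image_mem_iff[OF L_inj, of x "Del p"] by (simp add: L_Del)

lemma conj_map_neg_pos_iff:
  assumes "w \<in> W" "a \<in> \<Phi>"
  shows "- conj_map w (L a) \<in> Pos \<longleftrightarrow> - w a \<in> Pos"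
proof -
  have "- w a \<in> \<Phi>" using assms weyl_root uminus_root by blast
  thus ?thesis using L_pos_iff by (simp add: conj_map_L L_uminus[symmetric])
qed

lemma L_inversions:
  assumes w: "w \<in> W"
  shows "Inv (conj_map w) = L ` Inv w"
proof -
  have "{a \<in> Pos. - conj_map w (L a) \<in> Pos} = Inv w"
  proof (rule set_eqI)
    show "a \<in> {a \<in> Pos. - conj_map w (L a) \<in> Pos} \<longleftrightarrow> a \<in> Inv w" for a
      using conj_map_neg_pos_iff[OF w pos_root, of a] unfolding inversions_iff mem_Collect_eq by blast
  qed
  moreover have "{a \<in> Pos. - conj_map w a \<in> Pos} = Inv (conj_map w)"
    by (rule set_eqI) (simp only: inversions_iff mem_Collect_eq)
  ultimately show ?thesis
    using image_Collect_stable[OF L_pos, of "\<lambda>a. - conj_map w a \<in> Pos"] by (simp only:)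
qed

lemma L_admissible:
  assumes p: "p \<in> II"
  shows "conj_map ` Adm p = Adm (\<sigma> p)"
proof -
  have iff: "conj_map w \<in> Adm (\<sigma> p) \<longleftrightarrow> w \<in> Adm p" if w: "w \<in> W" for w
  proof -
    have eq: "conj_map w (L a) \<in> Simple \<or> - conj_map w (L a) \<in> Pos \<longleftrightarrow>
        w a \<in> Simple \<or> - w a \<in> Pos" if a: "a \<in> Del p" for a
    proof -
      have "a \<in> \<Phi>" using a simple_in_roots by (auto simp: Del_eq[OF p])
      moreover have "conj_map w (L a) \<in> Simple \<longleftrightarrow> w a \<in> Simple"
        using L_mem_iff[OF L_simple_roots, of "w a"] by (simp add: conj_map_L)
      ultimately show ?thesis using conj_map_neg_pos_iff[OF w] by simp
    qed
    have "conj_map w \<in> Adm (\<sigma> p) \<longleftrightarrow>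
        (\<forall>a\<in>Del p. conj_map w (L a) \<in> Simple \<or> - conj_map w (L a) \<in> Pos)"
      using conj_map_weyl[OF w] by (simp add: admissible_iff L_Del[OF p, symmetric])
    also have "\<dots> \<longleftrightarrow> w \<in> Adm p" using eq w by (simp add: admissible_iff)
    finally show ?thesis .
  qed
  show ?thesis
  proof (intro equalityI subsetI)
    fix v assume "v \<in> conj_map ` Adm p"
    then obtain w where w: "w \<in> Adm p" "v = conj_map w" by blast
    hence "w \<in> W" by (simp add: admissible_iff)
    thus "v \<in> Adm (\<sigma> p)" using iff w by blast
  next
    fix v assume v: "v \<in> Adm (\<sigma> p)"
    hence "v \<in> W" by (simp add: admissible_iff)
    then obtain w where w: "w \<in> W" "v = conj_map w" using conj_map_bij by (auto simp: bij_betw_def)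
    thus "v \<in> conj_map ` Adm p" using v iff by blast
  qed
qed

lemma L_axis_pairing: "p \<in> II \<Longrightarrow> a \<in> \<Phi> \<Longrightarrow> axis_pairing (\<sigma> p) (L a) z = axis_pairing p a z"
  by (simp add: axis_pairing_def L_level L_height)

lemma inv_conj_map: "w \<in> W \<Longrightarrow> inv (conj_map w) (L b) = L (inv w b)"
proof -
  assume w: "w \<in> W"
  have "conj_map w (L (inv w b)) = L b" by (simp add: conj_map_L weyl_inv(2)[OF w])
  thus ?thesis using weyl_inv(3)[OF conj_map_weyl[OF w], of "L (inv w b)"] by simp
qed

lemma prod_L_inversions:
  assumes "p \<in> II" "A \<subseteq> \<Phi>"
  shows "(\<Prod>a\<in>L ` A. f (axis_pairing (\<sigma> p) a z)) = (\<Prod>a\<in>A. f (axis_pairing p a z))"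
proof -
  have "inj_on L A" using L_inj by (rule inj_on_subset) auto
  hence "(\<Prod>a\<in>L ` A. f (axis_pairing (\<sigma> p) a z)) = (\<Prod>a\<in>A. f (axis_pairing (\<sigma> p) (L a) z))"
    by (simp add: prod.reindex o_def)
  also have "\<dots> = (\<Prod>a\<in>A. f (axis_pairing p a z))"
    using assms by (intro prod.cong refl) (auto simp: L_axis_pairing)
  finally show ?thesis .
qed

text \<open>Levels, heights, inversions and the chosen simple roots are all carried over by \<open>L\<close>.\<close>
lemma L_axis_term:
  assumes p: "p \<in> II" and w: "w \<in> W"
  shows "axis_term (\<sigma> p) (conj_map w) z = axis_term p w z"
proof -
  let ?S = "{b \<in> Simple. inv w b \<notin> Del p}"
  have IR: "Inv w \<subseteq> \<Phi>" using pos_root by (auto simp: inversions_iff)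
  have S: "{b \<in> Simple. inv (conj_map w) b \<notin> Del (\<sigma> p)} = L ` ?S"
    using image_Collect_stable[OF L_simple_roots, of "\<lambda>b. inv (conj_map w) b \<notin> Del (\<sigma> p)"]
    by (simp add: inv_conj_map[OF w] L_Del_iff[OF p])
  have "inj_on L ?S" using L_inj by (rule inj_on_subset) auto
  hence "(\<Prod>b\<in>L ` ?S. 1 / (axis_pairing (\<sigma> p) (inv (conj_map w) b) z - 1)) =
      (\<Prod>b\<in>?S. 1 / (axis_pairing (\<sigma> p) (inv (conj_map w) (L b)) z - 1))"
    by (simp add: prod.reindex o_def)
  also have "\<dots> = (\<Prod>b\<in>?S. 1 / (axis_pairing p (inv w b) z - 1))"
  proof (rule prod.cong[OF refl])
    fix b assume b: "b \<in> ?S"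
    hence "b \<in> \<Phi>" using simple_in_roots by (auto simp: simple_roots_II)
    hence "inv w b \<in> \<Phi>" by (rule weyl_root[OF weyl_inv(1)[OF w]])
    thus "1 / (axis_pairing (\<sigma> p) (inv (conj_map w) (L b)) z - 1) = 1 / (axis_pairing p (inv w b) z - 1)"
      by (simp add: inv_conj_map[OF w] L_axis_pairing[OF p])
  qed
  finally have 1: "(\<Prod>b\<in>L ` ?S. 1 / (axis_pairing (\<sigma> p) (inv (conj_map w) b) z - 1)) = \<dots>" .
  have I: "L ` Inv w \<inter> Del (\<sigma> p) = L ` (Inv w \<inter> Del p)"
    "L ` Inv w - Del (\<sigma> p) = L ` (Inv w - Del p)"
    unfolding L_Del[OF p, symmetric] using L_inj by (auto simp: image_Int image_set_diff)
  have 2: "card (L ` A) = card A" for A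
    using L_inj by (intro card_image) (auto intro: inj_on_subset)
  have 3: "(\<Prod>a\<in>L ` (Inv w - Del p). completed_zeta (axis_pairing (\<sigma> p) a z)) =
      (\<Prod>a\<in>Inv w - Del p. completed_zeta (axis_pairing p a z))"
    using IR by (intro prod_L_inversions p) auto
  have 4: "(\<Prod>a\<in>L ` Inv w. completed_zeta (axis_pairing (\<sigma> p) a z + 1)) =
      (\<Prod>a\<in>Inv w. completed_zeta (axis_pairing p a z + 1))"
    using prod_L_inversions[OF p IR, where f = "\<lambda>x. completed_zeta (x + 1)"] .
  show ?thesis unfolding axis_term_def S 1 L_inversions[OF w] I 2 3 4 ..
qed

lemma L_xi_exponent:
  assumes p: "p \<in> II" and w: "w \<in> W"
  shows "xi_exponent \<Phi> \<alpha> (\<sigma> p) (conj_map w) k h = xi_exponent \<Phi> \<alpha> p w k h"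
proof -
  have IR: "Inv w \<subseteq> \<Phi>" using pos_root by (auto simp: inversions_iff)
  have c: "card {a \<in> L ` A. wt (\<sigma> p) \<bullet> coroot a = x \<and> ht a = y} = card {a \<in> A. wt p \<bullet> coroot a = x \<and> ht a = y}"
    if "A \<subseteq> \<Phi>" for A x y
  proof -
    have "{a \<in> L ` A. wt (\<sigma> p) \<bullet> coroot a = x \<and> ht a = y} = L ` {a \<in> A. wt p \<bullet> coroot a = x \<and> ht a = y}"
      using that L_level[OF p] L_height by auto
    moreover have "inj_on L B" for B using L_inj by (rule inj_on_subset) auto
    ultimately show ?thesis by (simp add: card_image)
  qed
  have "Inv (conj_map w) - simple_roots_except \<alpha> (\<sigma> p) =
      L ` (Inv w - simple_roots_except \<alpha> p)"
    using L_Del[OF p] L_inj unfolding L_inversions[OF w] Del_def by (simp add: image_set_diff)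
  moreover have "Inv w - simple_roots_except \<alpha> p \<subseteq> \<Phi>" using IR by blast
  ultimately show ?thesis unfolding xi_exponent_def using c IR by (simp add: L_inversions[OF w])
qed

lemma L_max_exponent:
  assumes p: "p \<in> II"
  shows "max_exponent \<Phi> \<alpha> (\<sigma> p) k h = max_exponent \<Phi> \<alpha> p k h"
proof -
  have "(\<lambda>w. max 0 (- xi_exponent \<Phi> \<alpha> (\<sigma> p) w k h)) ` Adm (\<sigma> p) =
      (\<lambda>w. max 0 (- xi_exponent \<Phi> \<alpha> p w k h)) ` Adm p"
    unfolding L_admissible[OF p, symmetric] image_image
    by (intro image_cong refl) (simp add: L_xi_exponent[OF p] admissible_iff)
  thus ?thesis by (simp add: max_exponent_def)
qed

lemma L_generic:
  assumes p: "p \<in> II" and z: "generic p z"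
  shows "generic (\<sigma> p) z"
  unfolding generic_def
proof (intro ballI impI)
  fix a assume a: "a \<in> \<Phi>" "wt (\<sigma> p) \<bullet> coroot a \<noteq> 0"
  then obtain b where b: "b \<in> \<Phi>" "a = L b" using L_roots by blast
  have "wt p \<bullet> coroot b \<noteq> 0" using a b by (simp add: L_level[OF p])
  thus "axis_pairing (\<sigma> p) a z \<notin> \<int> \<and> axis_pairing (\<sigma> p) a z \<in> xi_good \<and> axis_pairing (\<sigma> p) a z + 1 \<in> xi_good"
    using z b by (simp add: generic_def L_axis_pairing[OF p])
qed

theorem L_weng_zeta_unnormalized:
  assumes p: "p \<in> II" and z: "generic p z"
  shows "weng_zeta_unnormalized \<Phi> \<alpha> (\<sigma> p) z 0 = weng_zeta_unnormalized \<Phi> \<alpha> p z 0"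
proof -
  have "inj_on conj_map (Adm p)"
    using conj_map_bij by (auto simp: bij_betw_def admissible_iff intro: inj_on_subset)
  hence "(\<Sum>w\<in>Adm (\<sigma> p). axis_term (\<sigma> p) w z) =
      (\<Sum>w\<in>Adm p. axis_term (\<sigma> p) (conj_map w) z)"
    unfolding L_admissible[OF p, symmetric] by (simp add: sum.reindex o_def)
  also have "\<dots> = (\<Sum>w\<in>Adm p. axis_term p w z)"
    by (intro sum.cong refl L_axis_term p) (simp add: admissible_iff)
  finally have "parabolic_period \<Phi> \<alpha> (\<sigma> p) z 0 = parabolic_period \<Phi> \<alpha> p z 0"
    using p by (simp add: parabolic_period_eq L_generic z)
  thus ?thesis by (simp add: weng_zeta_unnormalized_def L_max_exponent[OF p])
qed

end

section \<open>Meromorphy and the functional equation\<close>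

text \<open>An affine bijection maps punctured neighbourhoods to punctured neighbourhoods.\<close>
lemma eventually_cosparse_affine:
  fixes k h :: complex
  assumes "eventually P (cosparse UNIV)" "k \<noteq> 0"
  shows "eventually (\<lambda>z. P (k * z + h)) (cosparse UNIV)"
proof -
  have "eventually (\<lambda>z. P (k * z + h)) (at x)" for x
  proof -
    have "eventually P (at (k * x + h))"
      using eventually_cosparse_imp_eventually_at[OF assms(1)] by simp
    moreover have "filterlim (\<lambda>z. k * z + h) (at (k * x + h)) (at x)"
      using assms(2) by (intro filterlim_atI tendsto_intros) (auto simp: eventually_at_filter)
    ultimately show ?thesis by (simp add: filterlim_iff)
  qed
  thus ?thesis by (simp add: eventually_cosparse_open_eq)
qed

lemma eventually_not_Ints: "eventually (\<lambda>z::complex. z \<notin> \<int>) (cosparse UNIV)"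
proof -
  have "eventually (\<lambda>z. z \<notin> \<int>) (at x)" for x :: complex
  proof -
    have "closed (\<int> - {x})" by (rule closed_subset_Ints) auto
    hence "eventually (\<lambda>z. z \<in> - (\<int> - {x}) - {x}) (at x)"
      by (intro eventually_at_in_open open_Compl) simp_all
    thus ?thesis by eventually_elim auto
  qed
  thus ?thesis by (simp add: eventually_cosparse_open_eq)
qed

lemma completed_zeta_affine_meromorphic: "(\<lambda>z. completed_zeta (k * z + h)) meromorphic_on A"
proof -
  have "(\<lambda>z. k * z + h) analytic_on A" by (intro analytic_intros)
  thus ?thesis by (rule meromorphic_on_compose[OF completed_zeta_meromorphic[of UNIV]]) auto
qed

context based_root_system
begin

lemma eventually_generic: "eventually (generic p) (cosparse UNIV)"
proof -
  have "eventually (\<lambda>z. wt p \<bullet> coroot a \<noteq> 0 \<longrightarrow> axis_pairing p a z \<notin> \<int> \<and> axis_pairing p a z \<in> xi_good \<and>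
          axis_pairing p a z + 1 \<in> xi_good) (cosparse UNIV)" for a
  proof (cases "wt p \<bullet> coroot a = 0")
    case False
    hence k: "complex_of_real (wt p \<bullet> coroot a) \<noteq> 0" by simp
    show ?thesis
      using eventually_cosparse_affine[OF eventually_not_Ints k, of "of_real (ht a)"]
        eventually_cosparse_affine[OF eventually_xi_good k, of "of_real (ht a)"]
        eventually_cosparse_affine[OF eventually_xi_good k, of "of_real (ht a) + 1"]
      by eventually_elim (simp add: axis_pairing_def add.assoc)
  qed simp
  hence "eventually (\<lambda>z. \<forall>a\<in>\<Phi>. wt p \<bullet> coroot a \<noteq> 0 \<longrightarrow> axis_pairing p a z \<notin> \<int> \<and> axis_pairing p a z \<in> xi_good \<and>
          axis_pairing p a z + 1 \<in> xi_good) (cosparse UNIV)"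
    using finite_roots by (intro eventually_ball_finite) auto
  thus ?thesis by (simp add: generic_def[abs_def])
qed

lemma weng_zeta_meromorphic:
  assumes p: "p \<in> II"
  shows "weng_zeta \<Phi> \<alpha> p meromorphic_on UNIV"
proof -
  define \<kappa> where "\<kappa> = complex_of_real ((parabolic_const \<Phi> \<alpha> p + 1) / 2)"
  define K where "K z = (\<Prod>(k, h)\<in>{(k, h). h \<ge> 1 \<and> max_exponent \<Phi> \<alpha> p k h \<noteq> 0}.
        completed_zeta (of_nat k * z + of_nat h) ^ max_exponent \<Phi> \<alpha> p k h)" for z
  have ev: "eventually (\<lambda>s. weng_zeta \<Phi> \<alpha> p s = (\<Sum>w\<in>Adm p. axis_term p w (s - \<kappa>)) * K (s - \<kappa>)) (cosparse UNIV)"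
    using eventually_cosparse_affine[OF eventually_generic[of p] one_neq_zero, of "- \<kappa>"]
    by (rule eventually_mono)
       (auto simp: weng_zeta_def weng_zeta_unnormalized_def K_def \<kappa>_def parabolic_period_eq[OF p])
  have xi: "(\<lambda>s. completed_zeta (x * (s - \<kappa>) + y)) meromorphic_on UNIV" for x y
    using completed_zeta_affine_meromorphic[of x "y - x * \<kappa>" UNIV] by (simp add: algebra_simps)
  have xi': "(\<lambda>s. completed_zeta (x * (s - \<kappa>) + y + 1)) meromorphic_on UNIV" for x y
    using xi[of x "y + 1"] by (simp add: add.assoc)
  have 1: "(\<lambda>s. axis_term p w (s - \<kappa>)) meromorphic_on UNIV" for w
    unfolding axis_term_def axis_pairing_def by (intro meromorphic_intros xi xi')
  have "(\<lambda>s. case x of (k, h) \<Rightarrow> completed_zeta (of_nat k * (s - \<kappa>) + of_nat h) ^ max_exponent \<Phi> \<alpha> p k h)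
      meromorphic_on UNIV" for x
    by (cases x) (auto intro!: meromorphic_on_power xi)
  hence 2: "(\<lambda>s. K (s - \<kappa>)) meromorphic_on UNIV" unfolding K_def by (intro meromorphic_on_prod)
  have "(\<lambda>s. (\<Sum>w\<in>Adm p. axis_term p w (s - \<kappa>)) * K (s - \<kappa>)) meromorphic_on UNIV"
    by (intro meromorphic_on_mult meromorphic_on_sum 1 2)
  thus ?thesis using meromorphic_on_cong'[OF ev refl] by blast
qed

text \<open>The normalization moves the centre \<open>- c\<^sub>p / 2\<close> of the reflection \<open>dual\<close> to \<open>1 / 2\<close>.\<close>
lemma weng_zeta_functional_equation:
  assumes p: "p \<in> II"
  shows "eventually (\<lambda>s. weng_zeta \<Phi> \<alpha> p (1 - s) = weng_zeta \<Phi> \<alpha> p s) (cosparse UNIV)"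
proof -
  obtain w0 where w0: "is_longest II w0" using longest_exists[OF order.refl] by blast
  obtain wp where wp: "is_longest (II - {p}) wp" using longest_exists[of "II - {p}"] by blast
  interpret parabolic_flip \<Phi> \<alpha> II p w0 wp by unfold_locales (use p w0 wp in auto)
  define \<kappa> where "\<kappa> = complex_of_real ((c + 1) / 2)"
  have d: "dual (s - \<kappa>) = 1 - s - \<kappa>" for s
    by (simp add: dual_def \<kappa>_def field_simps)
  have m1: "- 1 \<noteq> (0::complex)" by simp
  show ?thesis
    using eventually_cosparse_affine[OF eventually_generic[of p] one_neq_zero, of "- \<kappa>"]
      eventually_cosparse_affine[OF eventually_generic[of p] m1, of "1 - \<kappa>"]
  proof eventually_elim
    case (elim s)
    hence "generic p (s - \<kappa>)" "generic p (dual (s - \<kappa>))" by (simp_all add: d algebra_simps)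
    from weng_zeta_unnormalized_dual[OF this] show ?case
      unfolding weng_zeta_def \<kappa>_def[symmetric] d by (rule sym)
  qed
qed

end

lemma (in diagram_symmetry) weng_zeta_diagram_symmetry:
  assumes p: "p \<in> II"
  shows "eventually (\<lambda>s. weng_zeta \<Phi> \<alpha> p s = weng_zeta \<Phi> \<alpha> (\<sigma> p) s) (cosparse UNIV)"
  using eventually_cosparse_affine[OF eventually_generic[of p] one_neq_zero,
      of "- of_real ((parabolic_const \<Phi> \<alpha> p + 1) / 2)"]
  by (rule eventually_mono) (simp add: weng_zeta_def L_const[OF p] L_weng_zeta_unnormalized[OF p])

theorem theorem2p6:
  fixes \<Phi> :: "'a::euclidean_space set" and \<alpha> :: "nat \<Rightarrow> 'a" and p q :: nat
  assumes "root_system \<Phi>"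
    and "fundamental_system \<Phi> \<alpha>"
    and "p \<in> {1..DIM('a)}"
    and "q \<in> {\<sigma> p | \<sigma>. \<sigma> \<in> dynkin_aut \<alpha>}"
  shows "weng_zeta \<Phi> \<alpha> p meromorphic_on UNIV \<and>
    weng_zeta \<Phi> \<alpha> q meromorphic_on UNIV \<and>
    eventually (\<lambda>s. weng_zeta \<Phi> \<alpha> p (1 - s) = weng_zeta \<Phi> \<alpha> p s \<and>
                     weng_zeta \<Phi> \<alpha> p s = weng_zeta \<Phi> \<alpha> q s) (cosparse UNIV)"
proof -
  obtain \<sigma> where \<sigma>: "\<sigma> \<in> dynkin_aut \<alpha>" and q: "q = \<sigma> p" using assms(4) by blast
  interpret diagram_symmetry \<Phi> \<alpha> "indices TYPE('a)" \<sigma> by unfold_locales (use assms \<sigma> in auto)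
  have p: "p \<in> indices TYPE('a)" using assms(3) by (simp add: indices_def)
  have "eventually (\<lambda>s. weng_zeta \<Phi> \<alpha> p (1 - s) = weng_zeta \<Phi> \<alpha> p s \<and>
                     weng_zeta \<Phi> \<alpha> p s = weng_zeta \<Phi> \<alpha> q s) (cosparse UNIV)"
    unfolding q using weng_zeta_functional_equation[OF p] weng_zeta_diagram_symmetry[OF p]
    by eventually_elim simp
  moreover have "q \<in> indices TYPE('a)" using p q by simp
  ultimately show ?thesis using weng_zeta_meromorphic p by blast
qed

end
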